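(* Let $S_l=\Gamma_l\backslash H$ be a family of geometrically finite hyperbolic surfaces degenerating, as $l\to0$, to a surface $S$ with only one geodesic $c_l$ (of length $l$) being pinched, where $S_l$ has only one funnel $F_1$, $c_l$ is the closed geodesic bounding $F_1$, and the right side of the collar of $c_l$ is contained in $S_l\setminus F_1$. Let $p=\infty$ be the cusp of $S$ arising from the right side of the $c_l$-collar and $S_0=\Gamma\backslash H$ the component of $S$ containing it. For $\Re s>1$ put $$\alpha_l(s,z)=\sum_{\gamma\in\langle\sigma_l\rangle\backslash\Gamma_l}\gamma^*\Big[\Big(\frac{y}{|z|}\Big)^{s-1}\operatorname{Im}(z^{-1}dz)\Big],\qquad \sigma_l(z)=e^lz .$$ Then, for $\Re s>1$, the family of $1$-forms $\frac1{l^s}\alpha_l(s,\pi_l(\cdot))$ converges, as $l\to 0$, uniformly on compact subsets of $S_0$ to $\operatorname{Im}\mathcal E_\infty(s,\cdot)$, where $\mathcal E_\infty$ is the horocyclic Eisenstein series of $S_0$ at the cusp $\infty$, $$\mathcal E_\infty(s,w)=\sum_{\gamma\in\Gamma_\infty\backslash\Gamma}(\operatorname{Im}\gamma w)^{s-1}\,d(\gamma w).$$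
   Context: Degenerating family: an oriented surface $M$ of negative Euler characteristic with hyperbolic metrics $g_l$ ($l>0$), such that there are finitely many closed curves $c_i$, geodesic for all $g_l$, with lengths $l_i\to0$ as $l\to 0$, and finitely many disjoint open sets $C_i\subset M$ diffeomorphic to $F_i\times J_i$ ($F_i$ a circle, $J_i\subset\mathbb R$ a neighborhood of $0$), with complement of $\bigcup C_i$ relatively compact, on which $g_l=(l_i^2+a^2)dx^2+(l_i^2+a^2)^{-1}da^2$ (with $c_i=F_i\times\{0\}$); off the curves $c_i$ the metrics converge to a complete hyperbolic metric. Here there is one pinched geodesic $c_l$, of length $l$; $S_l$ is $M$ with metric $g_l$ and $S$ is the limit surface. A funnel is an infinite-area end isometric to half a hyperbolic cylinder $\langle z\mapsto e^{\ell}z\rangle\backslash H$, bounded by a closed geodesic. Notation. $S_l=\Gamma_l\backslash H$, where $\sigma_l(z)=e^lz\in\Gamma_l$ corresponds to $c_l$ (the imaginary axis is a lift of $c_l$). The standard collar $C_l$ of $c_l$ is the image of $\{re^{i\theta}:1\le r\le e^l,\ l<\theta<\pi-l\}$; its right half is the image of $\{l<\theta<\pi/2\}$; $K_l=S_l\setminus C_l$. There are homeomorphisms $f_l:S_l\setminus c_l\to S$ tending to isometries $C^2$-uniformly on $K_l$; $\pi_l=f_l^{-1}$. $\Gamma$ is conjugated so that the cusp $p$ is at $\infty$ with stabilizer $\Gamma_\infty=\langle w\mapsto w+1\rangle$. Coordinates. $w=\frac1l\log z$ maps $H$ onto $\{0<\operatorname{Im}w<\pi/l\}$ and conjugates $\sigma_l$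 to $w\mapsto w+1$. Let $\mathcal A_l$ be the component of $H$ minus all lifts of $c_l$ which contains $\{re^{i\theta}:1\le r\le e^l,\ l<\theta<\pi/2\}$, let $F_l:\mathcal A_l\to H$ be a lift of the restriction of $f_l$ to the component of $S_l\setminus c_l$ containing the right half-collar, and let $\tilde f_l=F_l\circ w^{-1}:w(\mathcal A_l)\to H$, normalized so that the translation $w\mapsto w+1$ corresponds to itself and $\tilde f_l(i)=i$. Let $\mathcal F=\{w\in H:0\le\operatorname{Re}w<1,\ \operatorname{Im}w\ge\operatorname{Im}A(w)\ \forall A\in\Gamma\}$ be the standard fundamental domain of $\Gamma$. Meaning of the convergence: in the coordinate $w$, $\alpha_l$ is obtained by writing $\sum_{\gamma\in\langle\sigma_l\rangle\backslash\Gamma_l}\gamma^*\big[(y/|z|)^{s-1}z^{-1}dz\big]=a_l(s,w)\,dw$ and taking imaginary parts as differential forms (i.e. $\operatorname{Im}$ acts on the forms $\gamma^*(dz/z)$, not on the complex power; likewise for $\operatorname{Im}\mathcal E_\infty$). The form is evaluated at $\pi_l(x)$ through the point $\tilde f_l^{-1}(w)$, where $w\in\mathcal F$ represents $x\in S_0$; convergence is that of the coefficients with respect to the coordinate $w$.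
   Formalization: The maps f_l are assumed to tend to isometries C²-uniformly not only on K_l but also on π_l(K) for every compact K in S; without control inside the collar the claim fails, since f_l could rotate a horocycle of the cusp. *)

theory Defs
  imports "HOL-Analysis.Analysis" "HOL-Algebra.Bij" "HOL-Algebra.Generated_Groups"
    "HOL-Homology.Homology"
begin

section \<open>The upper half-plane and Fuchsian groups\<close>

definition hplane :: "complex set" where
  "hplane = {z. Im z > 0}"

text \<open>The hyperbolic metric at \<open>z\<close>, as a bilinear form on tangent vectors.\<close>

definition hyp_metric :: "complex \<Rightarrow> complex \<Rightarrow> complex \<Rightarrow> real" where
  "hyp_metric z u v = (u \<bullet> v) / (Im z)\<^sup>2"

text \<open>Elements of \<open>PSL(2, \<real>)\<close> are identified with the transformations of \<^const>\<open>hplane\<close>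
  they induce; these are extensional, so that they live in \<^term>\<open>BijGroup hplane\<close>.\<close>

definition PSL2R :: "(complex \<Rightarrow> complex) set" where
  "PSL2R = {\<gamma>. \<exists>a b c d :: real. a * d - b * c = 1 \<and>
     \<gamma> = (\<lambda>z\<in>hplane. (complex_of_real a * z + of_real b) / (of_real c * z + of_real d))}"

definition dilation :: "real \<Rightarrow> complex \<Rightarrow> complex" where
  "dilation l = (\<lambda>z\<in>hplane. complex_of_real (exp l) * z)"

definition translation :: "complex \<Rightarrow> complex" where
  "translation = (\<lambda>z\<in>hplane. z + 1)"

definition group_generated_by :: "(complex \<Rightarrow> complex) \<Rightarrow> (complex \<Rightarrow> complex) set" where
  "group_generated_by \<gamma> = generate (BijGroup hplane) {\<gamma>}"

definition stabilizer_infinity :: "(complex \<Rightarrow> complex) set \<Rightarrow> (complex \<Rightarrow> complex) set" where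
  "stabilizer_infinity \<Gamma> =
     {\<gamma> \<in> \<Gamma>. \<exists>a b :: real. \<forall>z\<in>hplane. \<gamma> z = of_real a * z + of_real b}"

definition standard_fundamental_domain :: "(complex \<Rightarrow> complex) set \<Rightarrow> complex set" where
  "standard_fundamental_domain \<Gamma> =
     {w \<in> hplane. 0 \<le> Re w \<and> Re w < 1 \<and> (\<forall>A\<in>\<Gamma>. Im (A w) \<le> Im w)}"

text \<open>Geometric finiteness: there is a locally finite convex fundamental polygon with finitely
  many sides, i.e. one which is an intersection of finitely many closed half-planes.\<close>

definition geometrically_finite :: "(complex \<Rightarrow> complex) set \<Rightarrow> bool" where
  "geometrically_finite \<Gamma> \<longleftrightarrow>
     (\<exists>\<H> P. finite \<H> \<and> \<H> \<subseteq> {A ` {z \<in> hplane. 0 \<le> Re z} | A. A \<in> PSL2R} \<and>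
        P = hplane \<inter> \<Inter>\<H> \<and>
        (\<Union>\<gamma>\<in>\<Gamma>. \<gamma> ` P) = hplane \<and>
        (\<forall>\<gamma>\<in>\<Gamma>. \<gamma> \<noteq> \<one>\<^bsub>BijGroup hplane\<^esub> \<longrightarrow> interior P \<inter> \<gamma> ` interior P = {}) \<and>
        (\<forall>K. compact K \<and> K \<subseteq> hplane \<longrightarrow> finite {\<gamma> \<in> \<Gamma>. \<gamma> ` P \<inter> K \<noteq> {}}))"

section \<open>Smooth surfaces and Riemannian metrics\<close>

text \<open>Functions of class \<open>C\<^sup>k\<close> on an open subset of the plane, through the partial derivatives
  in the directions \<open>1\<close> and \<open>\<i>\<close>.\<close>

definition dderiv :: "(complex \<Rightarrow> 'b::real_normed_vector) \<Rightarrow> complex \<Rightarrow> complex \<Rightarrow> 'b" where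
  "dderiv f v = (\<lambda>z. frechet_derivative f (at z) v)"

primrec Ck_on :: "nat \<Rightarrow> complex set \<Rightarrow> (complex \<Rightarrow> 'b::real_normed_vector) \<Rightarrow> bool" where
  "Ck_on 0 U f \<longleftrightarrow> continuous_on U f"
| "Ck_on (Suc k) U f \<longleftrightarrow> f differentiable_on U \<and> (\<forall>v\<in>{1, \<i>}. Ck_on k U (dderiv f v))"

definition smooth_fun_on :: "complex set \<Rightarrow> (complex \<Rightarrow> 'b::real_normed_vector) \<Rightarrow> bool" where
  "smooth_fun_on U f \<longleftrightarrow> (\<forall>k. Ck_on k U f)"

text \<open>Jacobian determinant.\<close>

definition jacobian :: "(complex \<Rightarrow> complex) \<Rightarrow> complex \<Rightarrow> real" where
  "jacobian f z = Im (cnj (dderiv f 1 z) * dderiv f \<i> z)"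

type_synonym 'm surface_chart = "'m set \<times> ('m \<Rightarrow> complex)"

text \<open>A metric assigns to a chart and a point of its domain a bilinear form on the tangent
  vectors, which are expressed in that chart.\<close>

type_synonym 'm metric_field = "'m surface_chart \<Rightarrow> 'm \<Rightarrow> complex \<Rightarrow> complex \<Rightarrow> real"

definition chart_inv :: "'m surface_chart \<Rightarrow> complex \<Rightarrow> 'm" where
  "chart_inv \<kappa> = inv_into (fst \<kappa>) (snd \<kappa>)"

definition oriented_surface ::
    "('m::{t2_space, second_countable_topology}) surface_chart set \<Rightarrow> bool" where
  "oriented_surface atl \<longleftrightarrow>
     connected (UNIV :: 'm set) \<and>
     (\<Union>\<kappa>\<in>atl. fst \<kappa>) = UNIV \<and>
     (\<forall>\<kappa>\<in>atl. open (fst \<kappa>) \<and> open (snd \<kappa> ` fst \<kappa>) \<and>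
        homeomorphism (fst \<kappa>) (snd \<kappa> ` fst \<kappa>) (snd \<kappa>) (chart_inv \<kappa>)) \<and>
     (\<forall>\<kappa>\<in>atl. \<forall>\<kappa>'\<in>atl.
        smooth_fun_on (snd \<kappa> ` (fst \<kappa> \<inter> fst \<kappa>')) (snd \<kappa>' \<circ> chart_inv \<kappa>) \<and>
        (\<forall>q \<in> snd \<kappa> ` (fst \<kappa> \<inter> fst \<kappa>'). jacobian (snd \<kappa>' \<circ> chart_inv \<kappa>) q > 0))"

definition riemannian_metric ::
    "('m::topological_space) surface_chart set \<Rightarrow> 'm set \<Rightarrow> 'm metric_field \<Rightarrow> bool" where
  "riemannian_metric atl S g \<longleftrightarrow> open S \<and>
     (\<forall>\<kappa>\<in>atl. \<forall>x \<in> fst \<kappa> \<inter> S.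
        bilinear (g \<kappa> x) \<and> (\<forall>u v. g \<kappa> x u v = g \<kappa> x v u) \<and> (\<forall>u. u \<noteq> 0 \<longrightarrow> g \<kappa> x u u > 0)) \<and>
     (\<forall>\<kappa>\<in>atl. \<forall>u v. smooth_fun_on (snd \<kappa> ` (fst \<kappa> \<inter> S)) (\<lambda>q. g \<kappa> (chart_inv \<kappa> q) u v)) \<and>
     (\<forall>\<kappa>\<in>atl. \<forall>\<kappa>'\<in>atl. \<forall>x \<in> fst \<kappa> \<inter> fst \<kappa>' \<inter> S. \<forall>u v.
        g \<kappa> x u v = g \<kappa>' x (dderiv (snd \<kappa>' \<circ> chart_inv \<kappa>) u (snd \<kappa> x))
                          (dderiv (snd \<kappa>' \<circ> chart_inv \<kappa>) v (snd \<kappa> x)))"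

text \<open>\<open>h\<close> is a smooth map from the open set \<open>W\<close> of the plane to \<open>S\<close> with \<open>h\<^sup>* g = G\<close>, where \<open>G\<close>
  is a metric on \<open>W\<close>.\<close>

definition local_isometry ::
    "('m::topological_space) surface_chart set \<Rightarrow> complex set
     \<Rightarrow> (complex \<Rightarrow> complex \<Rightarrow> complex \<Rightarrow> real) \<Rightarrow> 'm set \<Rightarrow> 'm metric_field
     \<Rightarrow> (complex \<Rightarrow> 'm) \<Rightarrow> bool" where
  "local_isometry atl W G S g h \<longleftrightarrow> open W \<and> h ` W \<subseteq> S \<and> continuous_on W h \<and>
     (\<forall>\<kappa>\<in>atl. smooth_fun_on (W \<inter> h -` fst \<kappa>) (snd \<kappa> \<circ> h) \<and>
        (\<forall>q \<in> W \<inter> h -` fst \<kappa>. \<forall>u v.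
           g \<kappa> (h q) (dderiv (snd \<kappa> \<circ> h) u q) (dderiv (snd \<kappa> \<circ> h) v q) = G q u v))"

text \<open>\<open>(S, g)\<close> is the quotient of \<open>H\<close> by \<open>\<Gamma>\<close>, with projection \<open>p\<close>: \<open>p\<close> is an orientation preserving Riemannian
  covering whose fibres are the orbits of \<open>\<Gamma>\<close>.  (Being fixed point free and discrete is then
  automatic for \<open>\<Gamma>\<close>.)\<close>

definition uniformization ::
    "('m::topological_space) surface_chart set \<Rightarrow> 'm set \<Rightarrow> 'm metric_field
     \<Rightarrow> (complex \<Rightarrow> complex) set \<Rightarrow> (complex \<Rightarrow> 'm) \<Rightarrow> bool" where
  "uniformization atl S g \<Gamma> p \<longleftrightarrow>
     \<Gamma> \<subseteq> PSL2R \<and> subgroup \<Gamma> (BijGroup hplane) \<and>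
     covering_space hplane p S \<and>
     (\<forall>z\<in>hplane. \<forall>w\<in>hplane. p z = p w \<longleftrightarrow> (\<exists>\<gamma>\<in>\<Gamma>. w = \<gamma> z)) \<and>
     local_isometry atl hplane hyp_metric S g p \<and>
     (\<forall>\<kappa>\<in>atl. \<forall>q \<in> hplane \<inter> p -` fst \<kappa>. jacobian (snd \<kappa> \<circ> p) q > 0)"

text \<open>Complete hyperbolic metrics on a possibly disconnected surface: every component is a
  quotient of the hyperbolic plane.\<close>

definition complete_hyperbolic_metric ::
    "('m::topological_space) surface_chart set \<Rightarrow> 'm set \<Rightarrow> 'm metric_field \<Rightarrow> bool" where
  "complete_hyperbolic_metric atl S g \<longleftrightarrow> riemannian_metric atl S g \<and>
     (\<forall>S'\<in>components S. \<exists>\<Gamma> p. uniformization atl S' g \<Gamma> p)"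

text \<open>Euler characteristic.  Only the homology in degrees \<open>0, 1, 2\<close> of a surface can be nonzero;
  the rank of an abelian group is the supremum of the sizes of its \<open>\<int>\<close>-independent subsets.\<close>

definition independent_sizes :: "('a, 'b) monoid_scheme \<Rightarrow> nat set" where
  "independent_sizes G = {card B | B. finite B \<and> B \<subseteq> carrier G \<and>
     (\<forall>k :: 'a \<Rightarrow> int. finprod G (\<lambda>b. b [^]\<^bsub>G\<^esub> k b) B = \<one>\<^bsub>G\<^esub> \<longrightarrow> (\<forall>b\<in>B. k b = 0))}"

definition negative_euler_characteristic :: "'a topology \<Rightarrow> bool" where
  "negative_euler_characteristic X \<longleftrightarrow>
     (\<forall>i\<le>2. bdd_above (independent_sizes (homology_group (int i) X))) \<and>
     (\<Sum>i\<le>2. (-1) ^ i * int (Sup (independent_sizes (homology_group (int i) X)))) < 0"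

section \<open>Geodesics, collars, funnels\<close>

text \<open>The imaginary axis covers the simple closed curve \<open>c\<close>, which has length \<open>len\<close>.\<close>

definition axis_is_lift :: "(complex \<Rightarrow> 'm) \<Rightarrow> real \<Rightarrow> 'm set \<Rightarrow> bool" where
  "axis_is_lift p len c \<longleftrightarrow> c = p ` {z \<in> hplane. Re z = 0} \<and>
     (\<forall>z\<in>hplane. \<forall>w\<in>hplane. Re z = 0 \<and> Re w = 0 \<longrightarrow>
        (p z = p w \<longleftrightarrow> (\<exists>n::int. w = of_real (exp (of_int n * len)) * z)))"

text \<open>There is no loss in asking for the imaginary axis as a lift, because the uniformization
  can be composed with any element of \<open>PSL(2, \<real>)\<close>.\<close>

definition simple_closed_geodesic ::
    "('m::topological_space) surface_chart set \<Rightarrow> 'm metric_field \<Rightarrow> real \<Rightarrow> 'm set \<Rightarrow> bool" where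
  "simple_closed_geodesic atl g len c \<longleftrightarrow>
     (\<exists>\<Gamma> p. uniformization atl UNIV g \<Gamma> p \<and> axis_is_lift p len c)"

definition collar_metric :: "real \<Rightarrow> complex \<Rightarrow> complex \<Rightarrow> complex \<Rightarrow> real" where
  "collar_metric len q u v =
     (len\<^sup>2 + (Im q)\<^sup>2) * (Re u * Re v) + (Im u * Im v) / (len\<^sup>2 + (Im q)\<^sup>2)"

definition collar_cover :: "real \<Rightarrow> complex set" where
  "collar_cover l = {of_real r * cis \<theta> | r \<theta>. 1 \<le> r \<and> r \<le> exp l \<and> l < \<theta> \<and> \<theta> < pi - l}"

definition right_collar_cover :: "real \<Rightarrow> complex set" where
  "right_collar_cover l = {of_real r * cis \<theta> | r \<theta>. 1 \<le> r \<and> r \<le> exp l \<and> l < \<theta> \<and> \<theta> < pi / 2}"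

text \<open>\<open>F\<close> is a funnel bounded by \<open>c\<close>: for a suitable \<open>A\<close>, the local isometry \<open>p \<circ> A\<close> induces an
  isometry from the quotient of the right half-plane \<open>{z \<in> H. Re z > 0}\<close> by \<open>z \<mapsto> e\<^sup>m z\<close> onto \<open>F\<close>,
  and it identifies the boundary geodesic of that half-cylinder with \<open>c\<close>.\<close>

definition funnel :: "(complex \<Rightarrow> 'm) \<Rightarrow> 'm set \<Rightarrow> 'm set \<Rightarrow> bool" where
  "funnel p F c \<longleftrightarrow> (\<exists>A\<in>PSL2R. \<exists>m>0.
     F = (p \<circ> A) ` {z \<in> hplane. Re z > 0} \<and> c = (p \<circ> A) ` {z \<in> hplane. Re z = 0} \<and>
     (\<forall>z\<in>hplane. \<forall>w\<in>hplane. Re z \<ge> 0 \<and> Re w \<ge> 0 \<longrightarrow>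
        (p (A z) = p (A w) \<longleftrightarrow> (\<exists>n::int. w = of_real (exp (of_int n * m)) * z))))"

section \<open>Degenerating families\<close>

text \<open>The parameter \<open>l\<close> ranges over \<open>(0, l0)\<close>.  There are \<open>n\<close> pinched curves \<open>c\<^sub>i\<close>, of \<open>g l\<close>-length
  \<open>len i l\<close>.  The open set \<open>C\<^sub>i\<close> is parametrized by \<open>\<psi> i\<close>, which maps \<open>x + \<i> a\<close> to the point with
  coordinates \<open>(x mod 1, a)\<close>, for \<open>a \<in> J i\<close>: the circle \<open>F\<^sub>i\<close> is \<open>\<real>/\<int>\<close>, as it must be for
  \<open>len i l\<close> to be the length of \<open>c\<^sub>i\<close>.\<close>

definition pinched_curve :: "(complex \<Rightarrow> 'm) \<Rightarrow> 'm set" where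
  "pinched_curve \<psi> = \<psi> ` {q. Im q = 0}"

definition degenerating_family ::
    "('m::{t2_space, second_countable_topology}) surface_chart set \<Rightarrow> real \<Rightarrow> nat
     \<Rightarrow> (nat \<Rightarrow> real \<Rightarrow> real) \<Rightarrow> (nat \<Rightarrow> real set) \<Rightarrow> (nat \<Rightarrow> complex \<Rightarrow> 'm)
     \<Rightarrow> (real \<Rightarrow> 'm metric_field) \<Rightarrow> 'm metric_field \<Rightarrow> bool" where
  "degenerating_family atl l0 n len J \<psi> g g0 \<longleftrightarrow>
     oriented_surface atl \<and>
     negative_euler_characteristic (euclidean :: 'm topology) \<and>
     (\<forall>l\<in>{0<..<l0}. complete_hyperbolic_metric atl UNIV (g l)) \<and>
     (\<forall>i<n. (\<forall>l\<in>{0<..<l0}. len i l > 0 \<and>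
               simple_closed_geodesic atl (g l) (len i l) (pinched_curve (\<psi> i))) \<and>
            (len i \<longlongrightarrow> 0) (at_right 0)) \<and>
     (\<forall>i<n. open (J i) \<and> 0 \<in> J i \<and>
            (\<forall>q q'. Im q \<in> J i \<and> Im q' \<in> J i \<longrightarrow>
               (\<psi> i q = \<psi> i q' \<longleftrightarrow> (\<exists>k::int. q' = q + of_int k))) \<and>
            (\<forall>l\<in>{0<..<l0}.
               local_isometry atl {q. Im q \<in> J i} (collar_metric (len i l)) UNIV (g l) (\<psi> i))) \<and>
     disjoint_family_on (\<lambda>i. \<psi> i ` {q. Im q \<in> J i}) {..<n} \<and>
     compact (closure (- (\<Union>i<n. \<psi> i ` {q. Im q \<in> J i}))) \<and>
     complete_hyperbolic_metric atl (- (\<Union>i<n. pinched_curve (\<psi> i))) g0 \<and>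
     (\<forall>\<kappa>\<in>atl. \<forall>K u v. compact K \<and> K \<subseteq> fst \<kappa> - (\<Union>i<n. pinched_curve (\<psi> i)) \<longrightarrow>
        uniform_limit K (\<lambda>l x. g l \<kappa> x u v) (\<lambda>x. g0 \<kappa> x u v) (at_right 0))"

text \<open>The map \<open>f\<close> from \<open>(S, g)\<close> to \<open>(S', g')\<close> is \<open>\<epsilon>\<close>-close to an isometry at \<open>x\<close>, to second order:
  with respect to suitable isometric parametrizations around \<open>x\<close> and \<open>f x\<close> by neighbourhoods
  of \<open>\<i>\<close> in the hyperbolic plane, the derivatives of order at most \<open>2\<close> of \<open>f\<close> at \<open>\<i>\<close> differ by
  less than \<open>\<epsilon>\<close> from those of the identity.\<close>

definition C2_near_isometry_at ::
    "('m::topological_space) surface_chart set \<Rightarrow> 'm set \<Rightarrow> 'm metric_field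
     \<Rightarrow> 'm set \<Rightarrow> 'm metric_field \<Rightarrow> real \<Rightarrow> ('m \<Rightarrow> 'm) \<Rightarrow> 'm \<Rightarrow> bool" where
  "C2_near_isometry_at atl S g S' g' \<epsilon> f x \<longleftrightarrow>
     (\<exists>V W h h' \<phi>. \<i> \<in> V \<and> V \<subseteq> hplane \<and> W \<subseteq> hplane \<and>
        local_isometry atl V hyp_metric S g h \<and> h \<i> = x \<and>
        local_isometry atl W hyp_metric S' g' h' \<and>
        \<phi> ` V \<subseteq> W \<and> Ck_on 2 V \<phi> \<and> (\<forall>z\<in>V. f (h z) = h' (\<phi> z)) \<and>
        \<phi> \<i> = \<i> \<and>
        (\<forall>u\<in>{1, \<i>}. cmod (dderiv \<phi> u \<i> - u) < \<epsilon>) \<and>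
        (\<forall>u\<in>{1, \<i>}. \<forall>v\<in>{1, \<i>}. cmod (dderiv (dderiv \<phi> u) v \<i>) < \<epsilon>))"

definition tends_to_isometries_C2 ::
    "('m::topological_space) surface_chart set \<Rightarrow> 'm set \<Rightarrow> (real \<Rightarrow> 'm metric_field)
     \<Rightarrow> 'm metric_field \<Rightarrow> (real \<Rightarrow> 'm \<Rightarrow> 'm) \<Rightarrow> (real \<Rightarrow> 'm set) \<Rightarrow> bool" where
  "tends_to_isometries_C2 atl S g g0 f X \<longleftrightarrow>
     (\<forall>\<epsilon>>0. \<forall>\<^sub>F l in at_right 0. \<forall>x \<in> X l. C2_near_isometry_at atl S (g l) S g0 \<epsilon> (f l) x)"

section \<open>Eisenstein series\<close>

text \<open>A \<open>1\<close>-form is a function of a point and a tangent vector, real linear in the latter.\<close>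

type_synonym one_form = "complex \<Rightarrow> complex \<Rightarrow> complex"

definition pull_back :: "(complex \<Rightarrow> complex) \<Rightarrow> one_form \<Rightarrow> one_form" where
  "pull_back h \<omega> z v = \<omega> (h z) (deriv h z * v)"

text \<open>The sum of \<open>\<gamma>\<^sup>* \<omega>\<close> over \<open>\<gamma>\<close> modulo \<open>\<Delta>\<close> on the left, for a form \<open>\<omega>\<close> invariant under the subgroup \<open>\<Delta>\<close>.
  The elements of the index set are the cosets \<open>\<Delta> \<gamma>\<close>; by invariance the choice of the
  representative does not matter.\<close>

definition coset_sum ::
    "(complex \<Rightarrow> complex) set \<Rightarrow> (complex \<Rightarrow> complex) set \<Rightarrow> one_form \<Rightarrow> one_form" where
  "coset_sum \<Delta> \<Gamma> \<omega> z v =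
     (\<Sum>\<^sub>\<infinity> X \<in> rcosets\<^bsub>(BijGroup hplane)\<lparr>carrier := \<Gamma>\<rparr>\<^esub> \<Delta>. pull_back (SOME \<gamma>. \<gamma> \<in> X) \<omega> z v)"

definition alpha_form :: "(complex \<Rightarrow> complex) set \<Rightarrow> real \<Rightarrow> complex \<Rightarrow> one_form" where
  "alpha_form \<Gamma> l s = coset_sum (group_generated_by (dilation l)) \<Gamma>
     (\<lambda>z v. complex_of_real (Im z / cmod z) powr (s - 1) * complex_of_real (Im (inverse z * v)))"

text \<open>The imaginary part of the horocyclic Eisenstein series is the one of differential forms:
  it applies to \<open>d(\<gamma>w)\<close> and not to the complex power in front of it.\<close>

definition Im_horocyclic_eisenstein :: "(complex \<Rightarrow> complex) set \<Rightarrow> complex \<Rightarrow> one_form" where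
  "Im_horocyclic_eisenstein \<Gamma> s = coset_sum (stabilizer_infinity \<Gamma>) \<Gamma>
     (\<lambda>w v. complex_of_real (Im w) powr (s - 1) * complex_of_real (Im v))"

text \<open>The coordinate \<open>w = (log z) / l\<close> and its inverse.\<close>

definition w_coord :: "real \<Rightarrow> complex \<Rightarrow> complex" where
  "w_coord l z = Ln z / of_real l"

definition w_coord_inv :: "real \<Rightarrow> complex \<Rightarrow> complex" where
  "w_coord_inv l w = exp (of_real l * w)"

end

theory Submission
  imports Defs "HOL-Complex_Analysis.Complex_Analysis" "HOL-Real_Asymp.Real_Asymp"
begin

text \<open>Since \<open>c\<^sub>l\<close> bounds the funnel, the component \<open>\<A>\<^sub>l\<close> is the intersection of the complements of
  the half-planes covering the funnel.  It is therefore invariant under all of \<open>\<Gamma>\<^sub>l\<close>, and the lift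
  \<open>F\<^sub>l\<close> conjugates \<open>\<Gamma>\<^sub>l\<close> to \<open>\<Gamma>\<close> and the dilation \<open>\<sigma>\<^sub>l\<close> to the translation \<open>w \<mapsto> w + 1\<close>; so both series run
  over the cosets \<open>\<Gamma>\<^sub>\<infinity>\<setminus>\<Gamma>\<close>.

  On compact sets \<open>F\<^sub>l\<close> is bi-Lipschitz for the hyperbolic distance, with constants tending to \<open>1\<close>.  In
  the coordinate \<open>w\<close> it fixes the points \<open>\<i> - 1, \<i>, \<i> + 1\<close>, which do not lie on one geodesic, so it
  converges to the identity; the conjugated group elements then converge to those of \<open>\<Gamma>\<close>, with
  their derivatives by Weierstrass' theorem.  This gives the convergence of each term.

  For the tails, let \<open>\<eta> = sin \<theta> / l\<close> be the scaled height of a point \<open>r e\<^bsup>\<i>\<theta>\<^esup>\<close>.  A term is bounded by a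
  constant times \<open>\<eta>\<^bsup>Re s\<^esup>\<close>, the points of an orbit are uniformly separated in the hyperbolic distance,
  and a packing argument in dyadic strips of the collar bounds the sum of the terms of height at
  most \<open>\<delta>\<close> by a constant times \<open>\<delta>\<^bsup>Re s - 1\<^esup>\<close>, uniformly in \<open>l\<close>; only finitely many cosets ever exceed height \<open>\<delta>\<close>.\<close>

section \<open>The hyperbolic distance\<close>

text \<open>The lifts are controlled only over bounded balls, for l small depending on the ball,
  whereas an orbit leaves every ball; so the limit cannot be taken in all terms at once. Two facts
  bridge the gap. Group elements are isometries, so a separation obtained at one controlled point
  holds along its whole orbit, and the tail estimate rests on this separation and the geometry of
  the collar. And a point of a fundamental annulus with scaled height between \<delta> and C lies at
  bounded distance from \<open>exp (l * \<i>)\<close>, where the lift is controlled again; this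
  gives one finite exceptional set of cosets for all small l.

  The factor l^(-s) splits: dz/z = l dw takes one power of l, the exponent s - 1 turns sin \<theta>
  into \<eta>. In the coordinate w a group element has derivative of modulus \<eta>(\<gamma> z) /
  \<eta>(z), which supplies one more power of \<eta>; the resulting exponent Re s > 1 beats the
  number of cells, of order 2^k, at height 2^(-k).

  Limits of single terms are proved along arbitrary filters with moving points; taken along pairs
  (l, w), they give uniformity on compact sets.\<close>

definition chd :: "complex \<Rightarrow> complex \<Rightarrow> real" where
  "chd z w = 1 + (cmod (z - w))\<^sup>2 / (2 * Im z * Im w)"

text \<open>\<open>chd\<close> is the hyperbolic cosine of the distance. Being rational in the
  coordinates, it is what gets computed; monotonicity of cosh carries the results over to the
  distance.\<close>

definition hdist :: "complex \<Rightarrow> complex \<Rightarrow> real" where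
  "hdist z w = arcosh (chd z w)"

lemma hplane_Im: "z \<in> hplane \<longleftrightarrow> Im z > 0"
  by (simp add: hplane_def)

lemma open_hplane: "open hplane"
  unfolding hplane_def by (simp add: open_halfspace_Im_gt)

lemma connected_hplane: "connected hplane"
  unfolding hplane_def by (simp add: convex_connected convex_halfspace_Im_gt)

lemma chd_ge_1: "z \<in> hplane \<Longrightarrow> w \<in> hplane \<Longrightarrow> 1 \<le> chd z w"
  by (simp add: chd_def hplane_Im)

lemma chd_eq_1_iff: "z \<in> hplane \<Longrightarrow> w \<in> hplane \<Longrightarrow> chd z w = 1 \<longleftrightarrow> z = w"
  by (auto simp: chd_def hplane_Im)

lemma chd_commute: "chd z w = chd w z"
  by (simp add: chd_def norm_minus_commute mult_ac)

lemma hdist_commute: "hdist z w = hdist w z"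
  by (simp add: hdist_def chd_commute)

lemma hdist_nonneg: "z \<in> hplane \<Longrightarrow> w \<in> hplane \<Longrightarrow> 0 \<le> hdist z w"
  by (simp add: hdist_def chd_ge_1)

lemma hdist_self [simp]: "hdist z z = 0"
  by (simp add: hdist_def chd_def)

lemma hdist_eq_0_iff: "z \<in> hplane \<Longrightarrow> w \<in> hplane \<Longrightarrow> hdist z w = 0 \<longleftrightarrow> z = w"
  by (simp add: hdist_def chd_ge_1 chd_eq_1_iff)

lemma cosh_hdist: "z \<in> hplane \<Longrightarrow> w \<in> hplane \<Longrightarrow> cosh (hdist z w) = chd z w"
  by (simp add: hdist_def chd_ge_1)

lemma hdist_le_iff:
  assumes "z \<in> hplane" "w \<in> hplane" "0 \<le> r"
  shows "hdist z w \<le> r \<longleftrightarrow> chd z w \<le> cosh r"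
  using assms by (metis cosh_hdist cosh_real_nonneg_le_iff hdist_nonneg)

lemma hdist_less_iff:
  assumes "z \<in> hplane" "w \<in> hplane" "0 \<le> r"
  shows "hdist z w < r \<longleftrightarrow> chd z w < cosh r"
  using assms by (metis cosh_hdist cosh_real_nonneg_less_iff hdist_nonneg)

text \<open>In the hyperboloid model based at \<open>y\<close> this is the Cauchy--Schwarz inequality for the spatial
  parts of \<open>x\<close> and \<open>z\<close>.\<close>

lemma chd_triangle:
  assumes "x \<in> hplane" "y \<in> hplane" "z \<in> hplane"
  shows "(chd x z - chd x y * chd y z)\<^sup>2 \<le> ((chd x y)\<^sup>2 - 1) * ((chd y z)\<^sup>2 - 1)"
proof -
  \<comment> \<open>The affine isometry w \<mapsto> (w - Re y) / q takes y to \<i>; the images of x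
    and z are X + \<i> a and Z + \<i> b.\<close>
  define q where "q = Im y"
  define X where "X = (Re x - Re y) / q"
  define a where "a = Im x / q"
  define Z where "Z = (Re z - Re y) / q"
  define b where "b = Im z / q"
  have q: "q > 0" and a: "a > 0" and b: "b > 0"
    using assms by (auto simp: q_def a_def b_def hplane_Im)
  have x: "x = Complex (Re y + q * X) (q * a)" and z: "z = Complex (Re y + q * Z) (q * b)"
    and y: "y = Complex (Re y) q"
    using q by (auto simp: complex_eq_iff q_def X_def Z_def a_def b_def)
  have Imx: "Im x = q * a" and Imz: "Im z = q * b"
    using q by (auto simp: a_def b_def)
  \<comment> \<open>(u1, u2) and (v1, v2) are the spatial coordinates of x and z; the time
    coordinates are \<open>chd x y\<close> and \<open>chd y z\<close>, so the squared lengths are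
    the squares of these minus 1.\<close>
  define u1 where "u1 = (X\<^sup>2 + a\<^sup>2 - 1) / (2 * a)"
  define u2 where "u2 = X / a"
  define v1 where "v1 = (Z\<^sup>2 + b\<^sup>2 - 1) / (2 * b)"
  define v2 where "v2 = Z / b"
  have "(cmod (x - y))\<^sup>2 = q\<^sup>2 * (X\<^sup>2 + (a - 1)\<^sup>2)"
    by (subst x, subst y, subst cmod_power2) (simp add: power2_eq_square algebra_simps)
  then have "chd x y = 1 + q\<^sup>2 * (X\<^sup>2 + (a - 1)\<^sup>2) / (2 * (q * a) * q)"
    by (simp add: chd_def Imx flip: q_def)
  also have "\<dots> = (X\<^sup>2 + a\<^sup>2 + 1) / (2 * a)"
    using q a by (simp add: field_simps power2_eq_square)
  finally have Cxy: "chd x y = (X\<^sup>2 + a\<^sup>2 + 1) / (2 * a)" .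
  have "(cmod (y - z))\<^sup>2 = q\<^sup>2 * (Z\<^sup>2 + (b - 1)\<^sup>2)"
    by (subst z, subst y, subst cmod_power2) (simp add: power2_eq_square algebra_simps)
  then have "chd y z = 1 + q\<^sup>2 * (Z\<^sup>2 + (b - 1)\<^sup>2) / (2 * q * (q * b))"
    by (simp add: chd_def Imz flip: q_def)
  also have "\<dots> = (Z\<^sup>2 + b\<^sup>2 + 1) / (2 * b)"
    using q b by (simp add: field_simps power2_eq_square)
  finally have Cyz: "chd y z = (Z\<^sup>2 + b\<^sup>2 + 1) / (2 * b)" .
  have "(cmod (x - z))\<^sup>2 = q\<^sup>2 * ((X - Z)\<^sup>2 + (a - b)\<^sup>2)"
    by (subst z, subst x, subst cmod_power2) (simp add: power2_eq_square algebra_simps)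
  then have "chd x z = 1 + q\<^sup>2 * ((X - Z)\<^sup>2 + (a - b)\<^sup>2) / (2 * (q * a) * (q * b))"
    by (simp add: chd_def Imx Imz)
  also have "\<dots> = ((X - Z)\<^sup>2 + a\<^sup>2 + b\<^sup>2) / (2 * a * b)"
    using q a b by (simp add: field_simps power2_eq_square)
  finally have Cxz: "chd x z = ((X - Z)\<^sup>2 + a\<^sup>2 + b\<^sup>2) / (2 * a * b)" .
  have 1: "(chd x y)\<^sup>2 - 1 = u1\<^sup>2 + u2\<^sup>2"
    unfolding Cxy u1_def u2_def using a by (simp add: field_simps power2_eq_square)
  have 2: "(chd y z)\<^sup>2 - 1 = v1\<^sup>2 + v2\<^sup>2"
    unfolding Cyz v1_def v2_def using b by (simp add: field_simps power2_eq_square)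
  have 3: "chd x z - chd x y * chd y z = - (u1 * v1 + u2 * v2)"
    unfolding Cxy Cyz Cxz u1_def u2_def v1_def v2_def using a b
    by (simp add: field_simps power2_eq_square)
  have "(u1\<^sup>2 + u2\<^sup>2) * (v1\<^sup>2 + v2\<^sup>2) - (u1 * v1 + u2 * v2)\<^sup>2 = (u1 * v2 - u2 * v1)\<^sup>2"
    by (simp add: power2_eq_square algebra_simps)
  then have "(u1 * v1 + u2 * v2)\<^sup>2 \<le> (u1\<^sup>2 + u2\<^sup>2) * (v1\<^sup>2 + v2\<^sup>2)"
    by (metis diff_ge_0_iff_ge zero_le_power2)
  then show ?thesis unfolding 1 2 3 power2_minus .
qed

text \<open>The square root of the right side of \<open>chd_triangle\<close> is the product of the
  two hyperbolic sines, so the addition formula of cosh finishes the proof.\<close>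

lemma hdist_triangle:
  assumes "x \<in> hplane" "y \<in> hplane" "z \<in> hplane"
  shows "hdist x z \<le> hdist x y + hdist y z"
proof -
  have ge: "chd x y \<ge> 1" "chd y z \<ge> 1" using assms by (auto simp: chd_ge_1)
  have "\<bar>chd x z - chd x y * chd y z\<bar> \<le> sqrt (((chd x y)\<^sup>2 - 1) * ((chd y z)\<^sup>2 - 1))"
    by (rule real_le_rsqrt) (use chd_triangle[OF assms] in simp)
  also have "\<dots> = sinh (hdist x y) * sinh (hdist y z)"
    using ge by (simp add: hdist_def sinh_arcosh_real real_sqrt_mult)
  finally have "chd x z \<le> cosh (hdist x y + hdist y z)"
    using assms by (simp add: cosh_add cosh_hdist)
  then show ?thesis
    using assms by (simp add: hdist_le_iff hdist_nonneg)
qed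

lemma continuous_on_chd [continuous_intros]:
  assumes "continuous_on S f" "continuous_on S g" "f ` S \<subseteq> hplane" "g ` S \<subseteq> hplane"
  shows "continuous_on S (\<lambda>x. chd (f x) (g x))"
  unfolding chd_def using assms
  by (intro continuous_intros) (auto simp: image_subset_iff hplane_Im)

lemma tendsto_chd:
  assumes "(f \<longlongrightarrow> a) F" "(g \<longlongrightarrow> b) F" "a \<in> hplane" "b \<in> hplane"
  shows "((\<lambda>x. chd (f x) (g x)) \<longlongrightarrow> chd a b) F"
  unfolding chd_def using assms
  by (intro tendsto_intros) (auto simp: hplane_Im)

section \<open>Closed balls around \<i> and their compactness\<close>

definition hball :: "real \<Rightarrow> complex set" where
  "hball R = {w \<in> hplane. hdist \<i> w \<le> R}"

lemma ii_hplane [simp]: "\<i> \<in> hplane"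
  by (simp add: hplane_Im)

lemma hball_subset: "hball R \<subseteq> hplane"
  by (auto simp: hball_def)

lemma hball_mono: "R \<le> R' \<Longrightarrow> hball R \<subseteq> hball R'"
  by (auto simp: hball_def)

text \<open>For Im w \<le> 0 the right side of the inequality is nonpositive and the left side
  positive, so the inequality itself forces w into the half-plane. The ball is thus closed in the
  whole plane, which is what compactness needs.\<close>

lemma hball_eq:
  assumes "0 \<le> R"
  shows "hball R = {w. (cmod (w - \<i>))\<^sup>2 \<le> 2 * (cosh R - 1) * Im w}"
proof -
  have "w \<in> hball R \<longleftrightarrow> (cmod (w - \<i>))\<^sup>2 \<le> 2 * (cosh R - 1) * Im w" for w
  proof (cases "w \<in> hplane")
    case True
    then show ?thesis
      using assms by (simp add: hball_def hdist_le_iff chd_commute[of \<i>])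
        (simp add: chd_def hplane_Im field_simps)
  next
    case False
    then have "Im w \<le> 0" by (simp add: hplane_Im)
    then have "w \<noteq> \<i>" by auto
    then have "(cmod (w - \<i>))\<^sup>2 > 0" by simp
    moreover have "2 * (cosh R - 1) * Im w \<le> 0"
      using \<open>Im w \<le> 0\<close> by (intro mult_nonneg_nonpos) (auto simp: cosh_real_ge_1)
    ultimately have "\<not> (cmod (w - \<i>))\<^sup>2 \<le> 2 * (cosh R - 1) * Im w" by linarith
    then show ?thesis using False by (simp add: hball_def)
  qed
  then show ?thesis by auto
qed

lemma compact_hball: "compact (hball R)"
proof (cases "0 \<le> R")
  case True
  define M where "M = 2 * (cosh R - 1)"
  have eq: "hball R = {w. (cmod (w - \<i>))\<^sup>2 \<le> M * Im w}"
    using hball_eq[OF True] M_def by simp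
  have M: "M \<ge> 0" by (simp add: M_def cosh_real_ge_1)
  have "closed (hball R)"
    unfolding eq by (intro closed_Collect_le continuous_intros)
  moreover have "hball R \<subseteq> cball \<i> (M + 1)"
  proof
    fix w assume "w \<in> hball R"
    then have 1: "(cmod (w - \<i>))\<^sup>2 \<le> M * Im w" by (simp add: eq)
    define t where "t = cmod (w - \<i>)"
    have "Im w \<le> 1 + t" using abs_Im_le_cmod[of "w - \<i>"] by (simp add: t_def)
    then have "t\<^sup>2 \<le> M * (1 + t)" using 1 M t_def by (smt (verit) mult_left_mono)
    then have "t \<le> M + 1"
    proof (rule contrapos_pp)
      assume "\<not> t \<le> M + 1"
      then have t: "t > M + 1" by simp
      then have "t * t > (M + 1) * t" using M by (intro mult_strict_right_mono) auto
      then show "\<not> t\<^sup>2 \<le> M * (1 + t)" using t by (simp add: power2_eq_square algebra_simps)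
    qed
    then show "w \<in> cball \<i> (M + 1)" by (simp add: t_def dist_norm norm_minus_commute)
  qed
  ultimately show ?thesis
    using bounded_subset[OF bounded_cball] compact_eq_bounded_closed by blast
next
  case False
  then have "hball R = {}" using hdist_nonneg[OF ii_hplane] by (force simp: hball_def)
  then show ?thesis by simp
qed

lemma continuous_on_hdist:
  assumes "a \<in> hplane" shows "continuous_on hplane (hdist a)"
  unfolding hdist_def[abs_def]
proof (rule continuous_on_compose2[OF continuous_on_arcosh[OF order_refl]])
  show "continuous_on hplane (\<lambda>w. chd a w)"
    using assms by (intro continuous_intros) auto
qed (use assms chd_ge_1 in auto)

lemma compact_subset_hball:
  assumes "compact K" "K \<subseteq> hplane"
  obtains R where "0 \<le> R" "K \<subseteq> hball R"
proof -
  have "compact (hdist \<i> ` K)"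
    by (rule compact_continuous_image[OF continuous_on_subset[OF continuous_on_hdist[OF ii_hplane] assms(2)] assms(1)])
  then have "bdd_above (hdist \<i> ` K)"
    by (intro bounded_imp_bdd_above compact_imp_bounded)
  then obtain R where "\<And>x. x \<in> hdist \<i> ` K \<Longrightarrow> x \<le> R"
    unfolding bdd_above_def by auto
  then have "K \<subseteq> hball (max 0 R)" using assms(2) by (force simp: hball_def)
  then show ?thesis using that[of "max 0 R"] by auto
qed

text \<open>Adding \<open>\<eta> > 0\<close> to the argument avoids the singularity of \<^const>\<open>arcosh\<close> at the starting point.\<close>

lemma hdist_path_le:
  assumes "0 \<le> T" "0 \<le> L"
    and der: "\<And>t. t \<in> {0..T} \<Longrightarrow> (\<sigma> has_vector_derivative \<sigma>' t) (at t within {0..T})"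
    and hp: "\<And>t. t \<in> {0..T} \<Longrightarrow> \<sigma> t \<in> hplane"
    and speed: "\<And>t. t \<in> {0..T} \<Longrightarrow> cmod (\<sigma>' t) \<le> L * Im (\<sigma> t)"
  shows "hdist (\<sigma> 0) (\<sigma> T) \<le> L * T"
proof (cases "T = 0")
  case True
  then show ?thesis by simp
next
  case False
  then have T: "0 < T" using assms by simp
  define a where "a = \<sigma> 0"
  define p q where "p = Re a" "q = Im a"
  have q: "q > 0" using hp[of 0] T by (simp add: p_q_def a_def hplane_Im)
  have a: "a \<in> hplane" using hp[of 0] T by (simp add: a_def)
  define x y where "x = (\<lambda>t. Re (\<sigma> t))" "y = (\<lambda>t. Im (\<sigma> t))"
  define x' y' where "x' = (\<lambda>t. Re (\<sigma>' t))" "y' = (\<lambda>t. Im (\<sigma>' t))"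
  have dx: "(x has_real_derivative x' t) (at t within {0..T})"
    and dy: "(y has_real_derivative y' t) (at t within {0..T})" if "t \<in> {0..T}" for t
    using der[OF that] unfolding x_y_def x'_y'_def has_real_derivative_iff_has_vector_derivative
    by (auto intro: bounded_linear.has_vector_derivative[OF bounded_linear_Re]
        bounded_linear.has_vector_derivative[OF bounded_linear_Im])
  have ypos: "y t > 0" if "t \<in> {0..T}" for t using hp[OF that] by (simp add: x_y_def hplane_Im)
  define c where "c = (\<lambda>t. chd a (\<sigma> t))"
  have c_eq: "c = (\<lambda>t. 1 + ((x t - p)\<^sup>2 + (y t - q)\<^sup>2) / (2 * q * y t))"
    by (auto simp: c_def chd_def x_y_def p_q_def cmod_power2 power2_commute)
  have c1: "c t \<ge> 1" if "t \<in> {0..T}" for t using chd_ge_1[OF a hp[OF that]] by (simp add: c_def)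
  \<comment> \<open>\<open>g1\<close> and \<open>g2\<close> are the two partial derivatives of
    \<open>chd a\<close> along the path, in the real and the imaginary direction.\<close>
  define g1 where "g1 = (\<lambda>t. (x t - p) / (y t * q))"
  define g2 where "g2 = (\<lambda>t. (y t - q) / (y t * q) - ((x t - p)\<^sup>2 + (y t - q)\<^sup>2) / (2 * (y t)\<^sup>2 * q))"
  have dc: "(c has_real_derivative g1 t * x' t + g2 t * y' t) (at t within {0..T})"
    if "t \<in> {0..T}" for t
    unfolding c_eq g1_def g2_def using ypos[OF that] q dx[OF that] dy[OF that]
    by (auto intro!: derivative_eq_intros simp: field_simps power2_eq_square)
  \<comment> \<open>Eikonal equation: the hyperbolic gradient of cosh d has length sinh d, in other
    words the gradient of the distance d has length 1.\<close>
  have grad: "(y t)\<^sup>2 * ((g1 t)\<^sup>2 + (g2 t)\<^sup>2) = (c t)\<^sup>2 - 1" if "t \<in> {0..T}" for t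
  proof -
    define N where "N = (x t - p)\<^sup>2 + (y t - q)\<^sup>2"
    define r where "r = N / (2 * q * y t)"
    note pos = ypos[OF that] q
    have "y t * g1 t = (x t - p) / q" "y t * g2 t = (y t - q) / q - r"
      unfolding g1_def g2_def N_def[symmetric] r_def using pos
      by (simp_all add: field_simps power2_eq_square)
    then have "(y t)\<^sup>2 * ((g1 t)\<^sup>2 + (g2 t)\<^sup>2) = ((x t - p) / q)\<^sup>2 + ((y t - q) / q - r)\<^sup>2"
      by (metis distrib_left power_mult_distrib)
    also have "\<dots> = N / q\<^sup>2 - 2 * r * ((y t - q) / q) + r\<^sup>2"
      unfolding power2_diff[of _ r] N_def by (simp add: power_divide add_divide_distrib)
    also have "N / q\<^sup>2 = 2 * r * (y t / q)"
      unfolding r_def using pos by (simp add: power2_eq_square)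
    also have "(y t - q) / q = y t / q - 1" using pos by (simp add: diff_divide_distrib)
    also have "2 * r * (y t / q) - 2 * r * (y t / q - 1) + r\<^sup>2 = (1 + r)\<^sup>2 - 1"
      by (simp add: power2_eq_square algebra_simps)
    finally show ?thesis by (simp add: c_eq N_def r_def)
  qed
  have dc_bound: "g1 t * x' t + g2 t * y' t \<le> L * sqrt ((c t)\<^sup>2 - 1)" if "t \<in> {0..T}" for t
  proof -
    have "g1 t * x' t + g2 t * y' t = Complex (g1 t) (g2 t) \<bullet> \<sigma>' t"
      by (simp add: inner_complex_def x'_y'_def)
    also have "\<dots> \<le> cmod (Complex (g1 t) (g2 t)) * cmod (\<sigma>' t)"
      by (rule norm_cauchy_schwarz)
    also have "\<dots> \<le> cmod (Complex (g1 t) (g2 t)) * (L * y t)"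
      using speed[OF that] by (intro mult_left_mono) (auto simp: x_y_def)
    also have "\<dots> = L * sqrt ((y t)\<^sup>2 * ((g1 t)\<^sup>2 + (g2 t)\<^sup>2))"
      using ypos[OF that] by (simp add: cmod_def real_sqrt_mult)
    finally show ?thesis using grad[OF that] by simp
  qed
  have le: "arcosh (c T + \<eta>) \<le> arcosh (1 + \<eta>) + L * T" if \<eta>: "\<eta> > 0" for \<eta>
  proof -
    define \<phi>' where "\<phi>' = (\<lambda>t. (g1 t * x' t + g2 t * y' t) / sqrt ((c t + \<eta>)\<^sup>2 - 1))"
    have gt: "c t + \<eta> > 1" if "t \<in> {0..T}" for t using c1[OF that] \<eta> by simp
    have "((\<lambda>t. arcosh (c t + \<eta>)) has_real_derivative \<phi>' t) (at t within {0..T})"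
      if "t \<in> {0..T}" for t
    proof -
      have "((\<lambda>t. c t + \<eta>) has_real_derivative g1 t * x' t + g2 t * y' t) (at t within {0..T})"
        using DERIV_add[OF dc[OF that] DERIV_const[of \<eta>]] by simp
      from DERIV_chain[OF arcosh_real_has_field_derivative this, OF gt[OF that]]
      show ?thesis by (simp add: \<phi>'_def o_def)
    qed
    then have "\<forall>t\<in>{0..T}. ((\<lambda>t. arcosh (c t + \<eta>)) has_derivative (\<lambda>h. \<phi>' t * h)) (at t within {0..T})"
      unfolding has_field_derivative_def by blast
    then obtain t where t: "t \<in> {0<..<T}"
      and eq: "arcosh (c T + \<eta>) - arcosh (c 0 + \<eta>) = \<phi>' t * (T - 0)"
      using mvt_simple[OF T, of "\<lambda>t. arcosh (c t + \<eta>)" "\<lambda>t h. \<phi>' t * h"] by auto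
    have t': "t \<in> {0..T}" using t by auto
    have sq: "sqrt ((c t)\<^sup>2 - 1) \<le> sqrt ((c t + \<eta>)\<^sup>2 - 1)"
      using c1[OF t'] \<eta> by (simp add: power_mono)
    have "(c t + \<eta>)\<^sup>2 > 1" using gt[OF t'] by (simp add: one_less_power)
    then have pos: "sqrt ((c t + \<eta>)\<^sup>2 - 1) > 0" by simp
    have "\<phi>' t \<le> L"
      unfolding \<phi>'_def using dc_bound[OF t'] mult_left_mono[OF sq \<open>0 \<le> L\<close>] pos
      by (simp add: divide_le_eq)
    moreover have "c 0 = 1" by (simp add: c_def a_def chd_def)
    moreover have "\<phi>' t * T \<le> L * T" using \<open>\<phi>' t \<le> L\<close> T by (simp add: mult_right_mono)
    ultimately show ?thesis using eq by simp
  qed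
  have cT: "c T \<ge> 1" using c1[of T] T by simp
  have pos: "\<forall>\<^sub>F \<eta> in at_right 0. \<eta> > (0::real)"
    by (rule eventually_at_right_less)
  have lim: "((\<lambda>\<eta>. arcosh (b + \<eta>)) \<longlongrightarrow> arcosh b) (at_right 0)" if "b \<ge> 1" for b :: real
  proof (rule tendsto_arcosh_strong)
    have "((\<lambda>\<eta>. b + \<eta>) \<longlongrightarrow> b + 0) (at_right 0)" by (intro tendsto_intros)
    then show "((\<lambda>\<eta>. b + \<eta>) \<longlongrightarrow> b) (at_right 0)" by simp
    show "\<forall>\<^sub>F \<eta> in at_right 0. 1 \<le> b + \<eta>"
      using pos by eventually_elim (use that in simp)
  qed (rule that)
  have "arcosh (c T) \<le> arcosh 1 + L * T"
  proof (rule tendsto_le[OF trivial_limit_at_right_real tendsto_add[OF lim[OF order_refl] tendsto_const] lim[OF cT]])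
    show "\<forall>\<^sub>F \<eta> in at_right 0. arcosh (c T + \<eta>) \<le> arcosh (1 + \<eta>) + L * T"
      using pos by eventually_elim (rule le)
  qed
  then show ?thesis by (simp add: c_def a_def hdist_def)
qed

section \<open>The Cayley transform and geodesics of unit speed\<close>

lemma hplane_normal_form:
  assumes "b \<in> hplane"
  obtains \<xi> where "cmod \<xi> < 1" "b = \<i> * (1 + \<xi>) / (1 - \<xi>)"
proof
  have ne: "b + \<i> \<noteq> 0" using assms by (auto simp: complex_eq_iff hplane_Im)
  show "cmod ((b - \<i>) / (b + \<i>)) < 1"
  proof -
    have "(cmod (b - \<i>))\<^sup>2 < (cmod (b + \<i>))\<^sup>2"
      using assms unfolding cmod_power2 by (simp add: hplane_Im power2_eq_square algebra_simps)
    then have "cmod (b - \<i>) < cmod (b + \<i>)" by (rule power2_less_imp_less) simp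
    then show ?thesis using ne by (simp add: norm_divide divide_less_eq)
  qed
  have "1 - (b - \<i>) / (b + \<i>) = 2 * \<i> / (b + \<i>)" "1 + (b - \<i>) / (b + \<i>) = 2 * b / (b + \<i>)"
    using ne by (simp_all add: field_simps)
  then show "b = \<i> * (1 + (b - \<i>) / (b + \<i>)) / (1 - (b - \<i>) / (b + \<i>))"
    using ne by simp
qed

lemma cayley_Im:
  assumes "cmod \<xi> < 1"
  shows "Im (\<i> * (1 + \<xi>) / (1 - \<xi>)) = (1 - (cmod \<xi>)\<^sup>2) / (cmod (1 - \<xi>))\<^sup>2"
proof -
  have "Im (\<i> * (1 + \<xi>) / (1 - \<xi>)) = Re ((1 + \<xi>) / (1 - \<xi>))"
    by (metis Im_i_times times_divide_eq_right)
  also have "\<dots> = Re ((1 + \<xi>) * cnj (1 - \<xi>)) / (cmod (1 - \<xi>))\<^sup>2"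
    by (subst complex_div_cnj) simp
  also have "Re ((1 + \<xi>) * cnj (1 - \<xi>)) = 1 - (cmod \<xi>)\<^sup>2"
    unfolding cmod_power2 by (simp add: power2_eq_square algebra_simps)
  finally show ?thesis .
qed

lemma chd_cayley:
  assumes "cmod \<xi> < 1"
  shows "chd \<i> (\<i> * (1 + \<xi>) / (1 - \<xi>)) = (1 + (cmod \<xi>)\<^sup>2) / (1 - (cmod \<xi>)\<^sup>2)"
proof -
  have ne: "1 - \<xi> \<noteq> 0" using assms by auto
  have p: "1 - (cmod \<xi>)\<^sup>2 > 0" using assms by (simp add: power_less_one_iff abs_square_less_1)
  have "\<i> - \<i> * (1 + \<xi>) / (1 - \<xi>) = - 2 * \<i> * \<xi> / (1 - \<xi>)"
    using ne by (simp add: field_simps)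
  then have "cmod (\<i> - \<i> * (1 + \<xi>) / (1 - \<xi>)) = 2 * cmod \<xi> / cmod (1 - \<xi>)"
    by (simp add: norm_mult norm_divide)
  then have "chd \<i> (\<i> * (1 + \<xi>) / (1 - \<xi>)) =
      1 + (2 * cmod \<xi> / cmod (1 - \<xi>))\<^sup>2 / (2 * ((1 - (cmod \<xi>)\<^sup>2) / (cmod (1 - \<xi>))\<^sup>2))"
    unfolding chd_def cayley_Im[OF assms] by simp
  also have "\<dots> = 1 + 2 * (cmod \<xi>)\<^sup>2 / (1 - (cmod \<xi>)\<^sup>2)"
    using ne p by (simp add: power_divide power_mult_distrib field_simps)
  also have "\<dots> = (1 + (cmod \<xi>)\<^sup>2) / (1 - (cmod \<xi>)\<^sup>2)"
    using p by (simp add: field_simps)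
  finally show ?thesis .
qed

text \<open>Together with \<open>chd_cayley\<close> this says that hyperbolic distance t from the
  centre of the disc is Euclidean radius tanh (t / 2).\<close>

lemma tanh_half_power2:
  fixes t :: real
  shows "(1 + (tanh (t / 2))\<^sup>2) / (1 - (tanh (t / 2))\<^sup>2) = cosh t"
proof -
  define C S where "C = (cosh (t / 2))\<^sup>2" "S = (sinh (t / 2))\<^sup>2"
  have C: "C = S + 1" and S: "S \<ge> 0" unfolding C_S_def by (auto simp: cosh_square_eq)
  have "(tanh (t / 2))\<^sup>2 = S / C" by (simp add: tanh_def C_S_def power_divide)
  then have "(1 + (tanh (t / 2))\<^sup>2) / (1 - (tanh (t / 2))\<^sup>2) = (1 + S / C) / (1 - S / C)"
    by simp
  also have "\<dots> = C + S"
    using S by (simp add: C divide_simps)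
  finally have "(1 + (tanh (t / 2))\<^sup>2) / (1 - (tanh (t / 2))\<^sup>2) = C + S" .
  moreover have "cosh t = C + S"
    using cosh_double[of "t / 2"] by (simp add: C_S_def)
  ultimately show ?thesis by simp
qed

lemma hdist_affine:
  assumes "q > 0" "z \<in> hplane" "w \<in> hplane"
  shows "hdist (of_real p + of_real q * z) (of_real p + of_real q * w) = hdist z w"
proof -
  have "of_real p + of_real q * z - (of_real p + of_real q * w) = of_real q * (z - w)"
    by (simp add: algebra_simps)
  then have "cmod (of_real p + of_real q * z - (of_real p + of_real q * w)) = q * cmod (z - w)"
    using assms by (simp add: norm_mult)
  then show ?thesis using assms
    by (simp add: hdist_def chd_def hplane_Im power_mult_distrib power2_eq_square mult.assoc)
qed

text \<open>In the disc the geodesic from the centre is the radius towards \<xi>, and Euclidean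
  radius tanh (t / 2) parametrizes it by arc length. Unit hyperbolic speed reads
  \<open>cmod (\<sigma>' t) = Im (\<sigma> t)\<close>.\<close>

lemma geodesic_from_ii:
  assumes b: "b \<in> hplane"
  obtains \<sigma> \<sigma>' where "\<sigma> 0 = \<i>" "\<sigma> (hdist \<i> b) = b"
    "\<And>t. \<sigma> t \<in> hplane" "\<And>t. (\<sigma> has_vector_derivative \<sigma>' t) (at t)" "\<And>t. cmod (\<sigma>' t) = Im (\<sigma> t)"
proof -
  obtain \<xi> where \<xi>: "cmod \<xi> < 1" "b = \<i> * (1 + \<xi>) / (1 - \<xi>)"
    using hplane_normal_form[OF b] .
  \<comment> \<open>For \<xi> = 0 any unit vector serves as direction; the geodesic segment then has
    length 0.\<close>
  define u where "u = (if \<xi> = 0 then 1 else \<xi> / cmod \<xi>)"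
  have u: "cmod u = 1" by (simp add: u_def norm_divide)
  have u\<xi>: "u * cmod \<xi> = \<xi>" by (simp add: u_def)
  define T where "T = 2 * artanh (cmod \<xi>)"
  have tanhT: "tanh (T / 2) = cmod \<xi>"
  proof -
    have "exp (- 2 * (T / 2)) = (1 - cmod \<xi>) / (1 + cmod \<xi>)"
      using \<xi>(1) by (simp add: T_def artanh_def exp_minus)
        (metis add_pos_nonneg exp_ln divide_pos_pos diff_gt_0_iff_gt inverse_divide norm_ge_zero zero_less_one)
    moreover have "1 + cmod \<xi> > 0" by (simp add: add_pos_nonneg)
    then have "1 - (1 - cmod \<xi>) / (1 + cmod \<xi>) = 2 * cmod \<xi> / (1 + cmod \<xi>)"
      and "1 + (1 - cmod \<xi>) / (1 + cmod \<xi>) = 2 / (1 + cmod \<xi>)"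
      and "1 + cmod \<xi> \<noteq> 0"
      by (simp_all add: field_simps)
    ultimately show ?thesis
      by (simp only: tanh_real_altdef) simp
  qed
  have "chd \<i> b = cosh T"
    using chd_cayley[OF \<xi>(1)] tanh_half_power2[of T] by (simp add: \<xi>(2) tanhT)
  moreover have "T \<ge> 0" using tanhT tanh_real_nonneg_iff[of "T / 2"] by simp
  ultimately have T: "hdist \<i> b = T" by (simp add: hdist_def arcosh_cosh_real)
  define \<tau> where "\<tau> = (\<lambda>t::real. complex_of_real (tanh (t / 2)))"
  define \<sigma> where "\<sigma> = (\<lambda>t. \<i> * (1 + u * \<tau> t) / (1 - u * \<tau> t))"
  define \<sigma>' where "\<sigma>' = (\<lambda>t. \<i> * u * of_real (1 - (tanh (t / 2))\<^sup>2) / (1 - u * \<tau> t)\<^sup>2)"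
  have lt: "cmod (u * \<tau> t) < 1" and cm: "cmod (u * \<tau> t) = \<bar>tanh (t / 2)\<bar>" for t
    using tanh_real_lt_1[of "t / 2"] tanh_real_gt_neg1[of "t / 2"] u
    by (simp_all add: \<tau>_def norm_mult abs_if)
  have ne: "1 - u * \<tau> t \<noteq> 0" for t using lt[of t] by auto
  have Im\<sigma>: "Im (\<sigma> t) = (1 - (tanh (t / 2))\<^sup>2) / (cmod (1 - u * \<tau> t))\<^sup>2" for t
    using cayley_Im[OF lt[of t]] by (simp add: \<sigma>_def cm)
  have p: "1 - (tanh (t / 2))\<^sup>2 > 0" for t :: real
    using lt[of t] cm[of t] by (simp add: abs_square_less_1)
  show ?thesis
  proof
    show "\<sigma> 0 = \<i>" by (simp add: \<sigma>_def \<tau>_def)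
    show "\<sigma> (hdist \<i> b) = b" unfolding T \<sigma>_def \<tau>_def tanhT u\<xi> by (rule \<xi>(2)[symmetric])
    show "\<sigma> t \<in> hplane" for t
      using Im\<sigma>[of t] p[of t] ne[of t] by (simp add: hplane_Im)
    show "cmod (\<sigma>' t) = Im (\<sigma> t)" for t
    proof -
      have "\<bar>1 - (tanh (t / 2))\<^sup>2\<bar> = 1 - (tanh (t / 2))\<^sup>2" using p[of t] by simp
      then show ?thesis
        unfolding Im\<sigma> \<sigma>'_def norm_divide norm_mult norm_power norm_of_real u by simp
    qed
    show "(\<sigma> has_vector_derivative \<sigma>' t) (at t)" for t
    proof -
      have 1: "((\<lambda>t. tanh (t / 2)) has_real_derivative (1 - (tanh (t / 2))\<^sup>2) / 2) (at t)"
        by (auto intro!: derivative_eq_intros)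
      have 2: "((\<lambda>t. complex_of_real (tanh (t / 2))) has_vector_derivative of_real ((1 - (tanh (t / 2))\<^sup>2) / 2)) (at t)"
        using has_vector_derivative_of_real[OF 1] .
      have 3: "((\<lambda>x. \<i> * (1 + u * x) / (1 - u * x)) has_field_derivative
          2 * \<i> * u / (1 - u * \<tau> t)\<^sup>2) (at (complex_of_real (tanh (t / 2))))"
        using ne[of t] unfolding \<tau>_def
        by (auto intro!: derivative_eq_intros simp: power2_eq_square field_simps)
      have 4: "complex_of_real ((1 - (tanh (t / 2))\<^sup>2) / 2) * (2 * \<i> * u / (1 - u * \<tau> t)\<^sup>2) = \<sigma>' t"
        by (simp add: \<sigma>'_def)
      from field_vector_diff_chain_at[OF 2 3, unfolded 4] show ?thesis
        by (simp add: \<sigma>_def \<tau>_def o_def)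
    qed
  qed
qed

lemma geodesic:
  assumes a: "a \<in> hplane" and b: "b \<in> hplane"
  obtains \<sigma> \<sigma>' where "\<sigma> 0 = a" "\<sigma> (hdist a b) = b"
    "\<And>t. \<sigma> t \<in> hplane" "\<And>t. (\<sigma> has_vector_derivative \<sigma>' t) (at t)" "\<And>t. cmod (\<sigma>' t) = Im (\<sigma> t)"
proof -
  define p q where "p = Re a" "q = Im a"
  have q: "q > 0" using a by (simp add: p_q_def hplane_Im)
  define b0 where "b0 = (b - of_real p) / of_real q"
  have b0: "b0 \<in> hplane" using b q by (simp add: b0_def hplane_Im)
  have eqb: "b = of_real p + of_real q * b0" using q by (simp add: b0_def)
  have eqa: "a = of_real p + of_real q * \<i>" by (simp add: p_q_def complex_eq_iff)
  have d: "hdist a b = hdist \<i> b0" unfolding eqa eqb by (rule hdist_affine) (use q b0 in auto)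
  obtain \<sigma> \<sigma>' where \<sigma>: "\<sigma> 0 = \<i>" "\<sigma> (hdist \<i> b0) = b0"
    "\<And>t. \<sigma> t \<in> hplane" "\<And>t. (\<sigma> has_vector_derivative \<sigma>' t) (at t)" "\<And>t. cmod (\<sigma>' t) = Im (\<sigma> t)"
    using geodesic_from_ii[OF b0] by blast
  show ?thesis
  proof
    show "of_real p + of_real q * \<sigma> 0 = a" by (simp add: \<sigma> eqa)
    show "of_real p + of_real q * \<sigma> (hdist a b) = b" unfolding d \<sigma> by (rule eqb[symmetric])
    show "of_real p + of_real q * \<sigma> t \<in> hplane" for t
      using \<sigma>(3)[of t] q by (simp add: hplane_Im)
    show "((\<lambda>t. of_real p + of_real q * \<sigma> t) has_vector_derivative of_real q * \<sigma>' t) (at t)" for t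
      using \<sigma>(4)[of t] by (auto intro!: derivative_eq_intros)
    show "cmod (of_real q * \<sigma>' t) = Im (of_real p + of_real q * \<sigma> t)" for t
      using \<sigma>(5)[of t] q by (simp add: norm_mult)
  qed
qed

section \<open>Elements of PSL(2, R)\<close>

lemma PSL2R_cases:
  assumes "\<gamma> \<in> PSL2R"
  obtains a b c d :: real where "a * d - b * c = 1"
    "\<gamma> = (\<lambda>z\<in>hplane. (complex_of_real a * z + of_real b) / (of_real c * z + of_real d))"
  using assms unfolding PSL2R_def by blast

lemma moebius_denominator_nz:
  fixes a b c d :: real
  assumes "a * d - b * c = 1" "z \<in> hplane"
  shows "complex_of_real c * z + of_real d \<noteq> 0"
proof
  assume *: "complex_of_real c * z + of_real d = 0"
  then have "c * Im z = 0" by (simp add: complex_eq_iff)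
  then have "c = 0" using assms by (simp add: hplane_Im)
  with * assms(1) show False by simp
qed

lemma moebius_Im:
  fixes a b c d :: real
  assumes "a * d - b * c = 1" "z \<in> hplane"
  shows "Im ((complex_of_real a * z + of_real b) / (of_real c * z + of_real d))
       = Im z / (cmod (of_real c * z + of_real d))\<^sup>2"
proof -
  have "Im ((of_real a * z + of_real b) * cnj (of_real c * z + of_real d)) = (a * d - b * c) * Im z"
    by (simp add: algebra_simps)
  then show ?thesis using assms(1) by (subst complex_div_cnj) simp
qed

lemma moebius_Re:
  fixes a b c d :: real
  shows "Re ((complex_of_real a * z + of_real b) / (of_real c * z + of_real d))
       = (a * c * (cmod z)\<^sup>2 + (a * d + b * c) * Re z + b * d) / (cmod (of_real c * z + of_real d))\<^sup>2"
proof -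
  have "Re ((of_real a * z + of_real b) * cnj (of_real c * z + of_real d))
      = a * c * (cmod z)\<^sup>2 + (a * d + b * c) * Re z + b * d"
    unfolding cmod_power2 by (simp add: power2_eq_square algebra_simps)
  then show ?thesis by (subst complex_div_cnj) simp
qed

lemma PSL2R_hplane: "\<gamma> \<in> PSL2R \<Longrightarrow> z \<in> hplane \<Longrightarrow> \<gamma> z \<in> hplane"
  by (erule PSL2R_cases) (use moebius_Im moebius_denominator_nz in \<open>force simp: hplane_Im\<close>)

lemma PSL2R_chd:
  assumes "\<gamma> \<in> PSL2R" "z \<in> hplane" "w \<in> hplane"
  shows "chd (\<gamma> z) (\<gamma> w) = chd z w"
proof -
  obtain a b c d :: real where det: "a * d - b * c = 1"
    and \<gamma>: "\<gamma> = (\<lambda>z\<in>hplane. (complex_of_real a * z + of_real b) / (of_real c * z + of_real d))"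
    using PSL2R_cases[OF assms(1)] .
  define Z W where "Z = complex_of_real c * z + of_real d" "W = complex_of_real c * w + of_real d"
  have nz: "Z \<noteq> 0" "W \<noteq> 0" using moebius_denominator_nz[OF det] assms by (auto simp: Z_W_def)
  have Im: "Im (\<gamma> z) = Im z / (cmod Z)\<^sup>2" "Im (\<gamma> w) = Im w / (cmod W)\<^sup>2"
    using moebius_Im[OF det] assms by (auto simp: Z_W_def \<gamma>)
  have "\<gamma> z - \<gamma> w = ((of_real a * z + of_real b) * W - (of_real a * w + of_real b) * Z) / (Z * W)"
    using assms nz by (simp add: \<gamma> Z_W_def[symmetric] diff_frac_eq)
  also have "(of_real a * z + of_real b) * W - (of_real a * w + of_real b) * Z
      = complex_of_real (a * d - b * c) * (z - w)"
    by (simp add: Z_W_def algebra_simps)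
  finally have "cmod (\<gamma> z - \<gamma> w) = cmod (z - w) / (cmod Z * cmod W)"
    by (simp add: det norm_divide norm_mult)
  then show ?thesis unfolding chd_def Im using nz
    by (simp add: power_divide power_mult_distrib)
qed

lemma PSL2R_hdist:
  assumes "\<gamma> \<in> PSL2R" "z \<in> hplane" "w \<in> hplane"
  shows "hdist (\<gamma> z) (\<gamma> w) = hdist z w"
  using PSL2R_chd[OF assms] by (simp add: hdist_def)

lemma PSL2R_has_field_derivative:
  assumes "\<gamma> \<in> PSL2R" "z \<in> hplane"
  shows "\<exists>D. (\<gamma> has_field_derivative D) (at z) \<and> cmod D = Im (\<gamma> z) / Im z"
proof -
  obtain a b c d :: real where det: "a * d - b * c = 1"
    and \<gamma>: "\<gamma> = (\<lambda>z\<in>hplane. (complex_of_real a * z + of_real b) / (of_real c * z + of_real d))"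
    using PSL2R_cases[OF assms(1)] .
  define Z where "Z = complex_of_real c * z + of_real d"
  have nz: "Z \<noteq> 0" using moebius_denominator_nz[OF det assms(2)] by (simp add: Z_def)
  have det': "complex_of_real a * of_real d - of_real b * of_real c = 1"
    using det by (metis of_real_1 of_real_diff of_real_mult)
  have "((\<lambda>z. (complex_of_real a * z + of_real b) / (of_real c * z + of_real d)) has_field_derivative
      (complex_of_real a * Z - (of_real a * z + of_real b) * of_real c) / (Z * Z)) (at z)"
    using nz unfolding Z_def by (auto intro!: derivative_eq_intros)
  also have "of_real a * Z - (of_real a * z + of_real b) * of_real c = 1"
    using det' by (simp add: Z_def algebra_simps)
  finally have "(\<gamma> has_field_derivative 1 / (Z * Z)) (at z)"
    by (rule has_field_derivative_transform_within_open[OF _ open_hplane assms(2)]) (simp add: \<gamma>)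
  moreover have "cmod (1 / (Z * Z)) = Im (\<gamma> z) / Im z"
    using moebius_Im[OF det assms(2)] assms(2) by (simp add: \<gamma> Z_def norm_divide norm_mult power2_eq_square hplane_Im)
  ultimately show ?thesis by blast
qed

lemma PSL2R_deriv:
  assumes "\<gamma> \<in> PSL2R" "z \<in> hplane"
  shows "(\<gamma> has_field_derivative deriv \<gamma> z) (at z)" "cmod (deriv \<gamma> z) = Im (\<gamma> z) / Im z"
  using PSL2R_has_field_derivative[OF assms] DERIV_imp_deriv by blast+

lemma PSL2R_holomorphic: "\<gamma> \<in> PSL2R \<Longrightarrow> \<gamma> holomorphic_on hplane"
  using PSL2R_deriv(1) holomorphic_onI field_differentiable_def field_differentiable_at_within by metis

lemma PSL2R_continuous_on: "\<gamma> \<in> PSL2R \<Longrightarrow> continuous_on hplane \<gamma>"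
  by (simp add: PSL2R_holomorphic holomorphic_on_imp_continuous_on)

text \<open>The denominator in \<open>moebius_Re\<close> is positive, so the sign is that of the
  numerator, an affine function of Re z and |z|^2. This linearity is what makes intersections of
  hyperbolic half-planes convex in Klein coordinates.\<close>

lemma PSL2R_halfplane:
  assumes "\<gamma> \<in> PSL2R"
  obtains \<alpha> \<beta> \<delta> where "\<And>z. z \<in> hplane \<Longrightarrow> Re (\<gamma> z) < 0 \<longleftrightarrow> \<alpha> * (cmod z)\<^sup>2 + \<beta> * Re z + \<delta> < 0"
proof -
  obtain a b c d :: real where det: "a * d - b * c = 1"
    and \<gamma>: "\<gamma> = (\<lambda>z\<in>hplane. (complex_of_real a * z + of_real b) / (of_real c * z + of_real d))"
    using PSL2R_cases[OF assms(1)] .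
  have "Re (\<gamma> z) < 0 \<longleftrightarrow> (a * c) * (cmod z)\<^sup>2 + (a * d + b * c) * Re z + b * d < 0" if "z \<in> hplane" for z
    using that moebius_denominator_nz[OF det that] by (simp add: \<gamma> moebius_Re divide_less_0_iff)
  then show ?thesis using that by blast
qed

lemma PSL2R_inverse:
  assumes "\<gamma> \<in> PSL2R"
  obtains \<delta> where "\<delta> \<in> PSL2R" "\<And>z. z \<in> hplane \<Longrightarrow> \<delta> (\<gamma> z) = z" "\<And>z. z \<in> hplane \<Longrightarrow> \<gamma> (\<delta> z) = z"
proof -
  obtain a b c d :: real where det: "a * d - b * c = 1"
    and \<gamma>: "\<gamma> = (\<lambda>z\<in>hplane. (complex_of_real a * z + of_real b) / (of_real c * z + of_real d))"
    using PSL2R_cases[OF assms(1)] .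
  \<comment> \<open>Stated for arbitrary coefficients, because it serves both the given matrix and
    its adjugate.\<close>
  have inv: "(complex_of_real d' * ((of_real a' * z + of_real b') / (of_real c' * z + of_real d')) + of_real (-b'))
       / (of_real (-c') * ((of_real a' * z + of_real b') / (of_real c' * z + of_real d')) + of_real a') = z"
    if det: "a' * d' - b' * c' = 1" and z: "z \<in> hplane" for a' b' c' d' :: real and z
  proof -
    have nz: "of_real c' * z + of_real d' \<noteq> 0" using moebius_denominator_nz[OF det z] .
    have det': "complex_of_real a' * of_real d' - of_real b' * of_real c' = 1"
      using det by (metis of_real_1 of_real_diff of_real_mult)
    define N where "N = of_real c' * z + of_real d'"
    have N: "N \<noteq> 0" using nz by (simp add: N_def)
    have 1: "complex_of_real d' * ((of_real a' * z + of_real b') / N) + of_real (-b') = z / N"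
    proof -
      have "complex_of_real d' * (of_real a' * z + of_real b') - of_real b' * N
        = (complex_of_real a' * of_real d' - of_real b' * of_real c') * z"
        by (simp add: N_def algebra_simps)
      then have "complex_of_real d' * (of_real a' * z + of_real b') - of_real b' * N = z"
        by (simp only: det') simp
      then show ?thesis using N by (simp add: field_simps)
    qed
    have 2: "of_real (-c') * ((of_real a' * z + of_real b') / N) + of_real a' = 1 / N"
    proof -
      have "of_real a' * N - complex_of_real c' * (of_real a' * z + of_real b')
        = complex_of_real a' * of_real d' - of_real b' * of_real c'"
        by (simp add: N_def algebra_simps)
      then have "of_real a' * N - complex_of_real c' * (of_real a' * z + of_real b') = 1"
        by (simp only: det')
      then show ?thesis using N by (simp add: field_simps)
    qed
    show ?thesis unfolding N_def[symmetric] 1 2 using N by simp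
  qed
  define \<delta> where "\<delta> = (\<lambda>z\<in>hplane. (complex_of_real d * z + of_real (-b)) / (of_real (-c) * z + of_real a))"
  have det2: "d * a - (-b) * (-c) = 1" using det by (simp add: algebra_simps)
  have "\<delta> \<in> PSL2R" unfolding PSL2R_def \<delta>_def using det2 by blast
  moreover have "\<delta> (\<gamma> z) = z" if "z \<in> hplane" for z
  proof -
    have "\<delta> (\<gamma> z) = (complex_of_real d * \<gamma> z + of_real (-b)) / (of_real (-c) * \<gamma> z + of_real a)"
      using PSL2R_hplane[OF assms that] by (simp add: \<delta>_def)
    moreover have "\<gamma> z = (complex_of_real a * z + of_real b) / (of_real c * z + of_real d)"
      using that by (simp add: \<gamma>)
    ultimately show ?thesis using inv[OF det that] by metis
  qed
  moreover have "\<gamma> (\<delta> z) = z" if "z \<in> hplane" for z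
  proof -
    have "\<gamma> (\<delta> z) = (complex_of_real a * \<delta> z + of_real (-(-b))) / (of_real (-(-c)) * \<delta> z + of_real d)"
      using PSL2R_hplane[OF \<open>\<delta> \<in> PSL2R\<close> that] by (simp add: \<gamma>)
    moreover have "\<delta> z = (complex_of_real d * z + of_real (-b)) / (of_real (-c) * z + of_real a)"
      using that by (simp add: \<delta>_def)
    ultimately show ?thesis using inv[OF det2 that] by metis
  qed
  ultimately show ?thesis using that by blast
qed

section \<open>Derivatives of lifts of near isometries\<close>

lemma has_derivative_dderiv:
  assumes "f differentiable_on U" "open U" "q \<in> U"
  shows "(f has_derivative (\<lambda>u. dderiv f u q)) (at q)"
  using assms unfolding dderiv_def
  by (simp add: differentiable_on_eq_differentiable_at frechet_derivative_works[symmetric])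

lemma isCont_eventually_nhds:
  assumes "isCont f a" "open V" "f a \<in> V"
  shows "\<forall>\<^sub>F x in nhds a. f x \<in> V"
  using assms(1) unfolding isCont_def tendsto_at_iff_tendsto_nhds
  by (rule topological_tendstoD) (use assms in auto)

lemma dderiv_decompose:
  assumes "f differentiable_on U" "open U" "q \<in> U"
  shows "dderiv f u q = Re u *\<^sub>R dderiv f 1 q + Im u *\<^sub>R dderiv f \<i> q"
proof -
  have lin: "linear (\<lambda>u. dderiv f u q)"
    using has_derivative_linear[OF has_derivative_dderiv[OF assms]] .
  have "u = Re u *\<^sub>R 1 + Im u *\<^sub>R \<i>" by (simp add: complex_eq_iff)
  then have "dderiv f u q = dderiv f (Re u *\<^sub>R 1 + Im u *\<^sub>R \<i>) q" by metis
  also have "\<dots> = Re u *\<^sub>R dderiv f 1 q + Im u *\<^sub>R dderiv f \<i> q"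
    using linear_add[OF lin, of "Re u *\<^sub>R 1" "Im u *\<^sub>R \<i>"]
      linear_scale[OF lin, of "Re u" 1] linear_scale[OF lin, of "Im u" \<i>] by simp
  finally show ?thesis .
qed

text \<open>An injective derivative that is continuous in operator norm gives local injectivity. The
  two partial derivatives control the operator norm, each with an error e / 3, so that the sum stays
  strictly below e.\<close>

lemma C1_locally_injective:
  fixes f :: "complex \<Rightarrow> complex"
  assumes "open U" "a \<in> U" and df: "f differentiable_on U"
    and cont: "continuous_on U (dderiv f 1)" "continuous_on U (dderiv f \<i>)"
    and inj: "\<And>u. dderiv f u a = 0 \<Longrightarrow> u = 0"
  obtains r where "r > 0" "ball a r \<subseteq> U" "inj_on f (ball a r)"
proof -
  define f' where "f' = (\<lambda>q u. dderiv f u q)"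
  have der: "(f has_derivative f' q) (at q)" if "q \<in> U" for q
    unfolding f'_def by (rule has_derivative_dderiv[OF df \<open>open U\<close> that])
  have lin: "linear (f' a)" using der[OF \<open>a \<in> U\<close>] has_derivative_linear by blast
  have "inj (f' a)" using lin inj by (simp add: linear_injective_0 f'_def)
  then obtain g' where g': "linear g'" "g' \<circ> f' a = id"
    using linear_injective_left_inverse[OF lin] by blast
  have small: "\<exists>d>0. \<forall>x. dist a x < d \<longrightarrow> onorm (\<lambda>v. f' x v - f' a v) < e" if "e > 0" for e
  proof -
    have "\<forall>\<^sub>F x in nhds a. x \<in> U" using \<open>open U\<close> \<open>a \<in> U\<close> by (rule eventually_nhds_in_open)
    moreover have "\<forall>\<^sub>F x in nhds a. dist (dderiv f v x) (dderiv f v a) < e / 3" if "v \<in> {1, \<i>}" for v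
    proof -
      have "isCont (dderiv f v) a"
        using cont \<open>open U\<close> \<open>a \<in> U\<close> that continuous_on_eq_continuous_at by blast
      then have "filterlim (dderiv f v) (nhds (dderiv f v a)) (nhds a)"
        by (simp add: isCont_def tendsto_at_iff_tendsto_nhds)
      then show ?thesis by (rule tendstoD) (use \<open>e > 0\<close> in simp)
    qed
    ultimately have "\<forall>\<^sub>F x in nhds a. x \<in> U \<and> dist (dderiv f 1 x) (dderiv f 1 a) < e / 3
        \<and> dist (dderiv f \<i> x) (dderiv f \<i> a) < e / 3"
      by (simp add: eventually_conj_iff)
    then obtain d where d: "d > 0" "\<And>x. dist x a < d \<Longrightarrow> x \<in> U \<and> dist (dderiv f 1 x) (dderiv f 1 a) < e / 3
        \<and> dist (dderiv f \<i> x) (dderiv f \<i> a) < e / 3"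
      unfolding eventually_nhds_metric by blast
    have "onorm (\<lambda>v. f' x v - f' a v) < e" if "dist a x < d" for x
    proof -
      have x: "x \<in> U" "cmod (dderiv f 1 x - dderiv f 1 a) < e / 3"
        "cmod (dderiv f \<i> x - dderiv f \<i> a) < e / 3"
        using d(2)[of x] that by (auto simp: dist_norm norm_minus_commute)
      have "onorm (\<lambda>v. f' x v - f' a v) \<le> 2 * e / 3"
      proof (rule onorm_le)
        fix v
        have "f' x v - f' a v = Re v *\<^sub>R (dderiv f 1 x - dderiv f 1 a) + Im v *\<^sub>R (dderiv f \<i> x - dderiv f \<i> a)"
          unfolding f'_def dderiv_decompose[OF df \<open>open U\<close> x(1), of v] dderiv_decompose[OF df \<open>open U\<close> \<open>a \<in> U\<close>, of v]
          by (simp add: algebra_simps)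
        then have "cmod (f' x v - f' a v) \<le> \<bar>Re v\<bar> * cmod (dderiv f 1 x - dderiv f 1 a) + \<bar>Im v\<bar> * cmod (dderiv f \<i> x - dderiv f \<i> a)"
          by (metis norm_triangle_ineq norm_scaleR)
        also have "\<dots> \<le> cmod v * (e / 3) + cmod v * (e / 3)"
          using x by (intro add_mono mult_mono) (auto simp: abs_Re_le_cmod abs_Im_le_cmod)
        finally show "cmod (f' x v - f' a v) \<le> 2 * e / 3 * cmod v" by simp
      qed
      then show ?thesis using \<open>e > 0\<close> by simp
    qed
    then show ?thesis using d(1) by blast
  qed
  have bl: "bounded_linear g'" using g'(1) by (simp add: linear_conv_bounded_linear)
  from has_derivative_locally_injective[where f = f and f' = f' and g' = g', OF \<open>a \<in> U\<close> \<open>open U\<close> bl g'(2) der small]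
  show ?thesis using that by blast
qed

text \<open>The pulled back metric is positive definite, so in a chart the derivative of a local
  isometry has no kernel and \<open>C1_locally_injective\<close> applies.\<close>

lemma local_isometry_chart:
  assumes iso: "local_isometry atl W hyp_metric S g h" and "W \<subseteq> hplane"
    and \<kappa>: "\<kappa> \<in> atl" "open (fst \<kappa>)" and q: "q \<in> W" "h q \<in> fst \<kappa>"
  obtains D r where "r > 0" "ball q r \<subseteq> W \<inter> h -` fst \<kappa>" "inj_on (snd \<kappa> \<circ> h) (ball q r)"
    "continuous_on (ball q r) (snd \<kappa> \<circ> h)" "((snd \<kappa> \<circ> h) has_derivative D) (at q)"
    "\<And>u. g \<kappa> (h q) (D u) (D u) = (cmod u / Im q)\<^sup>2" "\<And>u. D u = 0 \<Longrightarrow> u = 0"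
proof -
  define U where "U = W \<inter> h -` fst \<kappa>"
  define P where "P = snd \<kappa> \<circ> h"
  have "open W" "continuous_on W h" using iso by (auto simp: local_isometry_def)
  then have U: "open U" using \<kappa>(2) by (auto simp: U_def intro: continuous_open_preimage)
  have qU: "q \<in> U" using q by (simp add: U_def)
  have smooth: "Ck_on (Suc 0) U P"
    using iso \<kappa>(1) unfolding local_isometry_def smooth_fun_on_def U_def P_def by blast
  then have df: "P differentiable_on U" by simp
  have cont: "continuous_on U (dderiv P 1)" "continuous_on U (dderiv P \<i>)" using smooth by auto
  have metric: "g \<kappa> (h q) (dderiv P u q) (dderiv P u q) = (cmod u / Im q)\<^sup>2" for u
    using iso \<kappa>(1) qU
    by (auto simp: local_isometry_def U_def P_def hyp_metric_def power2_norm_eq_inner power_divide)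
  have inj: "u = 0" if "dderiv P u q = 0" for u
  proof -
    have "dderiv P 0 q = 0" using dderiv_decompose[OF df U qU, of 0] by simp
    then have "(cmod u / Im q)\<^sup>2 = (cmod 0 / Im q)\<^sup>2"
      using metric[of u] metric[of 0] that by simp
    then show ?thesis using q assms(2) by (auto simp: hplane_Im)
  qed
  obtain r where r: "r > 0" "ball q r \<subseteq> U" "inj_on P (ball q r)"
    using C1_locally_injective[OF U qU df cont inj] by blast
  show ?thesis
  proof (rule that)
    show "continuous_on (ball q r) (snd \<kappa> \<circ> h)"
      using differentiable_imp_continuous_on[OF df] r(2) continuous_on_subset by (auto simp: P_def)
    show "((snd \<kappa> \<circ> h) has_derivative (\<lambda>u. dderiv P u q)) (at q)"
      using has_derivative_dderiv[OF df U qU] by (simp add: P_def)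
  qed (use r inj metric in \<open>auto simp: U_def P_def\<close>)
qed

text \<open>Two isometric parametrizations of the same point differ by a change of variables \<tau>,
  a local inverse of \<open>h2\<close> after \<open>h1\<close>, and \<tau> is an infinitesimal
  isometry at a. Applied to a single map in both roles, it also supplies a neighbourhood on which
  this map is injective.\<close>

lemma local_isometries_transition:
  assumes atl: "oriented_surface atl"
    and h1: "local_isometry atl W1 hyp_metric S1 g h1" "W1 \<subseteq> hplane" "a \<in> W1"
    and h2: "local_isometry atl W2 hyp_metric S2 g h2" "W2 \<subseteq> hplane" "b \<in> W2"
    and eq: "h1 a = h2 b"
  obtains \<tau> T V where "open V" "b \<in> V" "V \<subseteq> W2" "inj_on h2 V" "\<tau> a = b"
    "\<forall>\<^sub>F z in nhds a. h2 (\<tau> z) = h1 z \<and> \<tau> z \<in> V"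
    "(\<tau> has_derivative T) (at a)" "\<And>u. cmod (T u) / Im b = cmod u / Im a"
proof -
  have "h1 a \<in> (\<Union>\<kappa>\<in>atl. fst \<kappa>)" using atl by (simp add: oriented_surface_def)
  then obtain \<kappa> where \<kappa>: "\<kappa> \<in> atl" "h1 a \<in> fst \<kappa>" by blast
  have op: "open (fst \<kappa>)" and "homeomorphism (fst \<kappa>) (snd \<kappa> ` fst \<kappa>) (snd \<kappa>) (chart_inv \<kappa>)"
    using atl \<kappa>(1) unfolding oriented_surface_def by blast+
  then have inj\<kappa>: "inj_on (snd \<kappa>) (fst \<kappa>)"
    by (intro inj_on_inverseI[where g = "chart_inv \<kappa>"]) (rule homeomorphism_apply1)
  define P Q where "P = snd \<kappa> \<circ> h1" "Q = snd \<kappa> \<circ> h2"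
  obtain D r where D: "r > 0" "ball a r \<subseteq> W1 \<inter> h1 -` fst \<kappa>" "inj_on P (ball a r)"
    "continuous_on (ball a r) P" "(P has_derivative D) (at a)"
    "\<And>u. g \<kappa> (h1 a) (D u) (D u) = (cmod u / Im a)\<^sup>2" "\<And>u. D u = 0 \<Longrightarrow> u = 0"
    by (rule local_isometry_chart[OF h1(1,2) \<kappa>(1) op h1(3) \<kappa>(2), folded P_Q_def]) (rule that; assumption)
  have \<kappa>2: "h2 b \<in> fst \<kappa>" using \<kappa>(2) eq by simp
  obtain E s where E: "s > 0" "ball b s \<subseteq> W2 \<inter> h2 -` fst \<kappa>" "inj_on Q (ball b s)"
    "continuous_on (ball b s) Q" "(Q has_derivative E) (at b)"
    "\<And>u. g \<kappa> (h2 b) (E u) (E u) = (cmod u / Im b)\<^sup>2" "\<And>u. E u = 0 \<Longrightarrow> u = 0"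
    by (rule local_isometry_chart[OF h2(1,2) \<kappa>(1) op h2(3) \<kappa>2, folded P_Q_def]) (rule that; assumption)
  define N where "N = Q ` ball b s"
  \<comment> \<open>Invariance of domain makes the image a neighbourhood of Q b, so that P takes
    values in the domain of the inverse of Q near a.\<close>
  have N: "open N" unfolding N_def using E(3,4) by (intro invariance_of_domain) auto
  have PQ: "P a = Q b" by (simp add: P_Q_def eq)
  define \<iota> where "\<iota> = inv_into (ball b s) Q"
  define \<tau> where "\<tau> = \<iota> \<circ> P"
  have linE: "linear E" using E(5) has_derivative_linear by blast
  have "inj E" using linE E(7) by (simp add: linear_injective_0)
  then obtain E' where E': "linear E'" "E \<circ> E' = id"
    using linear_injective_isomorphism[OF linE] by (auto simp: fun_eq_iff)
  have d\<iota>: "(\<iota> has_derivative E') (at (Q b))"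
    by (rule has_derivative_inverse_strong[where S = "ball b s" and f = Q and f' = E])
      (use E E'(2) in \<open>auto simp: \<iota>_def\<close>)
  show ?thesis
  proof (rule that[of "ball b s" \<tau> "E' \<circ> D"])
    show "inj_on h2 (ball b s)"
      using E(3) unfolding P_Q_def by (rule inj_on_imageI2)
    have \<iota>Qb: "\<iota> (Q b) = b" using E(1,3) by (simp add: \<iota>_def)
    then show "\<tau> a = b" by (simp add: \<tau>_def PQ)
    have "isCont P a" using D(5) has_derivative_continuous by blast
    then have "\<forall>\<^sub>F z in nhds a. P z \<in> N"
      by (rule isCont_eventually_nhds) (use N E(1) PQ in \<open>auto simp: N_def\<close>)
    moreover have "\<forall>\<^sub>F z in nhds a. z \<in> ball a r"
      using D(1) by (intro eventually_nhds_in_open) auto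
    ultimately show "\<forall>\<^sub>F z in nhds a. h2 (\<tau> z) = h1 z \<and> \<tau> z \<in> ball b s"
    proof eventually_elim
      case (elim z)
      then have *: "\<tau> z \<in> ball b s" "Q (\<tau> z) = P z"
        unfolding \<tau>_def \<iota>_def N_def o_apply by (metis inv_into_into, metis f_inv_into_f)
      then have "h2 (\<tau> z) \<in> fst \<kappa>" "h1 z \<in> fst \<kappa>" using E(2) D(2) elim by auto
      then show ?case using * inj\<kappa> by (auto simp: P_Q_def dest: inj_onD)
    qed
    show "(\<tau> has_derivative E' \<circ> D) (at a)"
      unfolding \<tau>_def using diff_chain_at[OF D(5)] d\<iota> PQ by simp
    show "cmod ((E' \<circ> D) u) / Im b = cmod u / Im a" for u
    proof -
      have "E (E' (D u)) = D u" using E'(2) by (auto simp: fun_eq_iff)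
      then have "(cmod (E' (D u)) / Im b)\<^sup>2 = (cmod u / Im a)\<^sup>2"
        using E(6)[of "E' (D u)"] D(6)[of u] eq by simp
      moreover have "Im a > 0" "Im b > 0" using h1 h2 by (auto simp: hplane_Im)
      ultimately show ?thesis by (simp add: power2_eq_iff_nonneg)
    qed
  qed (use E in auto)
qed

text \<open>A near isometry comes with some isometric parametrizations \<open>h\<close> and
  \<open>h'\<close>, whereas \<open>F\<close> is a lift with respect to \<open>p\<close> and
  \<open>p0\<close>. The transitions from \<open>p\<close> to \<open>h\<close> and from
  \<open>h'\<close> to \<open>p0\<close> are infinitesimal isometries, so the derivative of
  \<open>F\<close> at z is as close to an isometry as that of \<phi> at \<i>.\<close>

lemma lift_near_isometry_derivative:
  assumes atl: "oriented_surface atl"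
    and p: "local_isometry atl hplane hyp_metric S1 g p"
    and p0: "local_isometry atl hplane hyp_metric S2 g0 p0"
    and A: "open A" "A \<subseteq> hplane" "z \<in> A"
    and F: "continuous_on A F" "F ` A \<subseteq> hplane" "\<And>x. x \<in> A \<Longrightarrow> p0 (F x) = f (p x)"
    and near: "C2_near_isometry_at atl S g S' g0 \<epsilon> f (p z)" and \<epsilon>: "\<epsilon> > 0"
  obtains D where "(F has_derivative D) (at z)"
    "\<And>u. (1 - 2 * \<epsilon>) * (cmod u / Im z) \<le> cmod (D u) / Im (F z)"
    "\<And>u. cmod (D u) / Im (F z) \<le> (1 + 2 * \<epsilon>) * (cmod u / Im z)"
proof -
  obtain V W h h' \<phi> where C: "\<i> \<in> V \<and> V \<subseteq> hplane \<and> W \<subseteq> hplane \<and>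
        local_isometry atl V hyp_metric S g h \<and> h \<i> = p z \<and>
        local_isometry atl W hyp_metric S' g0 h' \<and>
        \<phi> ` V \<subseteq> W \<and> Ck_on 2 V \<phi> \<and> (\<forall>z\<in>V. f (h z) = h' (\<phi> z)) \<and>
        \<phi> \<i> = \<i> \<and>
        (\<forall>u\<in>{1, \<i>}. cmod (dderiv \<phi> u \<i> - u) < \<epsilon>) \<and>
        (\<forall>u\<in>{1, \<i>}. \<forall>v\<in>{1, \<i>}. cmod (dderiv (dderiv \<phi> u) v \<i>) < \<epsilon>)"
    using near unfolding C2_near_isometry_at_def by (elim exE) (rule that)
  then have VW: "\<i> \<in> V" "V \<subseteq> hplane" "W \<subseteq> hplane"
    and h: "local_isometry atl V hyp_metric S g h" "h \<i> = p z"
    and h': "local_isometry atl W hyp_metric S' g0 h'"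
    and \<phi>: "\<phi> ` V \<subseteq> W" "Ck_on 2 V \<phi>" "\<And>x. x \<in> V \<Longrightarrow> f (h x) = h' (\<phi> x)" "\<phi> \<i> = \<i>"
    and d\<phi>: "\<And>u. u \<in> {1, \<i>} \<Longrightarrow> cmod (dderiv \<phi> u \<i> - u) < \<epsilon>"
    by blast+
  have iW: "\<i> \<in> W" using VW(1) \<phi>(1,4) by force
  have h'i: "h' \<i> = p0 (F z)"
    using \<phi>(3)[OF VW(1)] \<phi>(4) h(2) F(3)[OF A(3)] by simp
  have Fz: "F z \<in> hplane" using F(2) A(3) by blast
  have zH: "z \<in> hplane" using A by blast
  obtain \<tau>1 T1 V1 where \<tau>1: "open V1" "\<i> \<in> V1" "V1 \<subseteq> V" "inj_on h V1" "\<tau>1 z = \<i>"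
    "\<forall>\<^sub>F x in nhds z. h (\<tau>1 x) = p x \<and> \<tau>1 x \<in> V1"
    "(\<tau>1 has_derivative T1) (at z)" "\<And>u. cmod (T1 u) / Im \<i> = cmod u / Im z"
    by (rule local_isometries_transition[OF atl p subset_refl zH h(1) VW(2,1) h(2)[symmetric]]) (rule that; assumption)
  obtain \<tau>2 T2 V2 where \<tau>2: "open V2" "F z \<in> V2" "V2 \<subseteq> hplane" "inj_on p0 V2" "\<tau>2 \<i> = F z"
    "\<forall>\<^sub>F x in nhds \<i>. p0 (\<tau>2 x) = h' x \<and> \<tau>2 x \<in> V2"
    "(\<tau>2 has_derivative T2) (at \<i>)" "\<And>u. cmod (T2 u) / Im (F z) = cmod u / Im \<i>"
    by (rule local_isometries_transition[OF atl h' VW(3) iW p0 subset_refl Fz h'i]) (rule that; assumption)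
  have openV: "open V" using h(1) by (simp add: local_isometry_def)
  have dif: "\<phi> differentiable_on V" using \<phi>(2) by (simp add: numeral_2_eq_2)
  define D\<phi> where "D\<phi> = (\<lambda>u. dderiv \<phi> u \<i>)"
  have der\<phi>: "(\<phi> has_derivative D\<phi>) (at \<i>)"
    unfolding D\<phi>_def by (rule has_derivative_dderiv[OF dif openV VW(1)])
  \<comment> \<open>Each of the directions 1 and \<i> contributes at most \<epsilon> |u|; this is
    the origin of the factor 2 in the statement.\<close>
  have near_id: "cmod (D\<phi> u - u) \<le> 2 * \<epsilon> * cmod u" for u
  proof -
    have "D\<phi> u - u = Re u *\<^sub>R (D\<phi> 1 - 1) + Im u *\<^sub>R (D\<phi> \<i> - \<i>)"
      unfolding D\<phi>_def dderiv_decompose[OF dif openV VW(1), of u]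
      by (simp add: complex_eq_iff algebra_simps)
    then have "cmod (D\<phi> u - u) \<le> \<bar>Re u\<bar> * cmod (D\<phi> 1 - 1) + \<bar>Im u\<bar> * cmod (D\<phi> \<i> - \<i>)"
      by (metis norm_triangle_ineq norm_scaleR)
    also have "\<dots> \<le> cmod u * \<epsilon> + cmod u * \<epsilon>"
      using d\<phi>[of 1] d\<phi>[of \<i>] \<epsilon> unfolding D\<phi>_def
      by (intro add_mono mult_mono) (auto simp: abs_Re_le_cmod abs_Im_le_cmod)
    finally show ?thesis by simp
  qed
  have dG: "((\<tau>2 \<circ> (\<phi> \<circ> \<tau>1)) has_derivative T2 \<circ> (D\<phi> \<circ> T1)) (at z)"
    using \<tau>1(5,7) der\<phi> \<tau>2(7) \<phi>(4) by (intro diff_chain_at) (simp_all add: o_def)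
  have isC: "((\<phi> \<circ> \<tau>1) \<longlongrightarrow> \<i>) (nhds z)"
  proof -
    have "((\<phi> \<circ> \<tau>1) has_derivative D\<phi> \<circ> T1) (at z)"
      using \<tau>1(5,7) der\<phi> by (intro diff_chain_at) simp_all
    then have "isCont (\<phi> \<circ> \<tau>1) z" by (rule has_derivative_continuous)
    then have "((\<phi> \<circ> \<tau>1) \<longlongrightarrow> (\<phi> \<circ> \<tau>1) z) (nhds z)"
      unfolding isCont_def tendsto_at_iff_tendsto_nhds .
    then show ?thesis using \<tau>1(5) \<phi>(4) by simp
  qed
  have "\<forall>\<^sub>F x in nhds z. F x \<in> V2"
  proof -
    have "isCont F z" using F(1) A continuous_on_eq_continuous_at by blast
    then show ?thesis by (rule isCont_eventually_nhds) (use \<tau>2 in auto)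
  qed
  moreover have "\<forall>\<^sub>F x in nhds z. x \<in> A" using A by (intro eventually_nhds_in_open)
  moreover have "\<forall>\<^sub>F x in nhds z. p0 (\<tau>2 ((\<phi> \<circ> \<tau>1) x)) = h' ((\<phi> \<circ> \<tau>1) x) \<and> \<tau>2 ((\<phi> \<circ> \<tau>1) x) \<in> V2"
    using \<tau>2(6) isC by (rule eventually_compose_filterlim)
  \<comment> \<open>Both sides lift the same map through \<open>p0\<close>, and near z their values
    lie in \<open>V2\<close>, where \<open>p0\<close> is injective.\<close>
  ultimately have ev: "\<forall>\<^sub>F x in nhds z. (\<tau>2 \<circ> (\<phi> \<circ> \<tau>1)) x = F x"
    using \<tau>1(6)
  proof eventually_elim
    case (elim x)
    then have "p0 (F x) = p0 (\<tau>2 ((\<phi> \<circ> \<tau>1) x))"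
      using F(3)[of x] \<phi>(3)[of "\<tau>1 x"] \<tau>1(3) by auto
    then have "F x = \<tau>2 ((\<phi> \<circ> \<tau>1) x)" using elim by (intro inj_onD[OF \<tau>2(4)]) auto
    then show ?case by simp
  qed
  have dF: "(F has_derivative T2 \<circ> (D\<phi> \<circ> T1)) (at z)"
    by (rule has_derivative_transform_eventually[OF dG])
      (use ev eventually_nhds_x_imp_x[OF ev] in \<open>auto simp: eventually_at_filter elim: eventually_mono\<close>)
  show ?thesis
  proof (rule that[OF dF])
    fix u
    define v where "v = T1 u"
    have v: "cmod v = cmod u / Im z" using \<tau>1(8)[of u] by (simp add: v_def)
    have e: "cmod ((T2 \<circ> (D\<phi> \<circ> T1)) u) / Im (F z) = cmod (D\<phi> v)"
      using \<tau>2(8)[of "D\<phi> v"] by (simp add: v_def)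
    show "(1 - 2 * \<epsilon>) * (cmod u / Im z) \<le> cmod ((T2 \<circ> (D\<phi> \<circ> T1)) u) / Im (F z)"
      unfolding e v[symmetric] using near_id[of v] norm_triangle_ineq2[of v "D\<phi> v"]
      by (simp add: norm_minus_commute algebra_simps)
    show "cmod ((T2 \<circ> (D\<phi> \<circ> T1)) u) / Im (F z) \<le> (1 + 2 * \<epsilon>) * (cmod u / Im z)"
      unfolding e v[symmetric] using near_id[of v] norm_triangle_ineq2[of "D\<phi> v" v]
      by (simp add: algebra_simps)
  qed
qed

section \<open>Asymptotic isometry of the lifts\<close>

text \<open>The Caratheodory form \<phi> x = q x * x, with q continuous at 0 and q 0 = 1, avoids
  dividing by t, which may vanish. It is applied to \<open>artanh\<close>, \<open>arcsin\<close> and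
  exp - 1.\<close>

lemma tendsto_deriv_ratio:
  fixes \<phi> :: "'a \<Rightarrow> 'a::real_normed_field"
  assumes d: "(\<phi> has_field_derivative 1) (at 0)" and "\<phi> 0 = 0"
    and lim: "((\<lambda>i. t i / L i) \<longlongrightarrow> c) G" and L: "(L \<longlongrightarrow> 0) G" "\<forall>\<^sub>F i in G. L i \<noteq> 0"
  shows "((\<lambda>i. \<phi> (t i) / L i) \<longlongrightarrow> c) G"
proof -
  obtain q where q: "\<And>x. \<phi> x - \<phi> 0 = q x * (x - 0)" "isCont q 0" "q 0 = 1"
    using d unfolding CARAT_DERIV by blast
  have "((\<lambda>i. t i / L i * L i) \<longlongrightarrow> c * 0) G" by (intro tendsto_intros lim L)
  then have "(t \<longlongrightarrow> 0) G"
    unfolding mult_zero_right by (rule Lim_transform_eventually)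
      (use L(2) in \<open>auto elim: eventually_mono\<close>)
  then have "((\<lambda>i. q (t i)) \<longlongrightarrow> q 0) G" by (rule isCont_tendsto_compose[OF q(2)])
  then have "((\<lambda>i. q (t i) * (t i / L i)) \<longlongrightarrow> 1 * c) G"
    unfolding q(3) by (intro tendsto_mult lim)
  then show ?thesis using q(1) \<open>\<phi> 0 = 0\<close> by simp
qed

text \<open>With log z = t + \<i> \<theta> the half-plane becomes a strip of height pi, in which
  cosh d - 1 = (cosh (t - t') - cos (\<theta> - \<theta>')) / (sin \<theta> sin \<theta>'). The
  second point has logarithm l k + \<i> l, that is, coordinate w = \<i> + k.\<close>

lemma chd_polar:
  assumes z: "Re z > 0" "Im z > 0" and l: "0 < l" "l < pi"
  shows "chd z (exp (of_real l * (\<i> + of_real k))) - 1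
    = (cosh (ln (cmod z) - l * k) - cos (Arg z - l)) / (Im z / cmod z * sin l)"
proof -
  define t \<theta> where "t = ln (cmod z)" "\<theta> = Arg z"
  have nz: "z \<noteq> 0" using z by auto
  then have r: "cmod z = exp t" by (simp add: t_\<theta>_def)
  have z_eq: "z = of_real (exp t) * cis \<theta>"
    using rcis_cmod_Arg[of z] unfolding rcis_def r t_\<theta>_def(2) by (rule sym)
  have w_eq: "exp (of_real l * (\<i> + of_real k)) = of_real (exp (l * k)) * cis l"
    by (simp add: cis_conv_exp distrib_left exp_add exp_of_real mult_ac flip: of_real_mult)
  have s: "Im z / cmod z = sin \<theta>"
    using arg_cong[OF z_eq, of Im] by (simp add: r)
  have s0: "sin \<theta> > 0" using s z nz by (metis divide_pos_pos zero_less_norm_iff)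
  have l0: "sin l > 0" using l by (simp add: sin_gt_zero)
  have "(cmod (z - exp (of_real l * (\<i> + of_real k))))\<^sup>2
      = (exp t * cos \<theta> - exp (l * k) * cos l)\<^sup>2 + (exp t * sin \<theta> - exp (l * k) * sin l)\<^sup>2"
    unfolding w_eq by (subst z_eq) (simp add: cmod_power2)
  also have "\<dots> = (exp t)\<^sup>2 * ((sin \<theta>)\<^sup>2 + (cos \<theta>)\<^sup>2) + (exp (l * k))\<^sup>2 * ((sin l)\<^sup>2 + (cos l)\<^sup>2)
       - 2 * exp t * exp (l * k) * (cos \<theta> * cos l + sin \<theta> * sin l)"
    unfolding power2_eq_square by (simp only: algebra_simps)
  also have "\<dots> = (exp t)\<^sup>2 + (exp (l * k))\<^sup>2 - 2 * exp t * exp (l * k) * (cos \<theta> * cos l + sin \<theta> * sin l)"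
    by simp
  also have "\<dots> = 2 * exp t * exp (l * k) * (cosh (t - l * k) - cos (\<theta> - l))"
    by (simp add: cosh_field_def cos_diff exp_diff power2_eq_square field_simps exp_minus)
  finally have "(cmod (z - exp (of_real l * (\<i> + of_real k))))\<^sup>2
      = 2 * exp t * exp (l * k) * (cosh (t - l * k) - cos (\<theta> - l))" .
  moreover have "Im z = exp t * sin \<theta>" by (subst z_eq) simp
  moreover have "Im (exp (of_real l * (\<i> + of_real k))) = exp (l * k) * sin l"
    unfolding w_eq by simp
  ultimately have "chd z (exp (of_real l * (\<i> + of_real k))) - 1
      = (cosh (t - l * k) - cos (\<theta> - l)) / (sin \<theta> * sin l)"
    using s0 l0 by (simp add: chd_def)
  then show ?thesis unfolding s t_\<theta>_def .
qed

lemma open_hdist_ball: "open {w \<in> hplane. hdist \<i> w < r}"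
proof -
  have "open (hplane \<inter> hdist \<i> -` {..<r})"
    by (rule continuous_open_preimage[OF continuous_on_hdist[OF ii_hplane] open_hplane open_lessThan])
  moreover have "hplane \<inter> hdist \<i> -` {..<r} = {w \<in> hplane. hdist \<i> w < r}" by auto
  ultimately show ?thesis by simp
qed

text \<open>The lifts, detached from the surfaces. \<open>near_isometric\<close> is indexed by
  points of the target half-plane, since the compact sets with uniform control are those of the
  limit surface; how small l must be depends on R and \<epsilon>.\<close>

locale near_isometric_lifts =
  fixes l0 :: real and \<A> :: "real \<Rightarrow> complex set" and F Finv :: "real \<Rightarrow> complex \<Rightarrow> complex"
  assumes l0_pos: "0 < l0" and l0_le: "l0 \<le> pi / 2"
    and \<A>_open: "l \<in> {0<..<l0} \<Longrightarrow> open (\<A> l)"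
    and \<A>_quadrant: "l \<in> {0<..<l0} \<Longrightarrow> z \<in> \<A> l \<Longrightarrow> Re z > 0 \<and> Im z > 0"
    and homeo: "l \<in> {0<..<l0} \<Longrightarrow> homeomorphism (\<A> l) hplane (F l) (Finv l)"
    and near_isometric: "\<epsilon> > 0 \<Longrightarrow> \<forall>\<^sub>F l in at_right 0. \<forall>w \<in> hball R. \<exists>D.
          (F l has_derivative D) (at (Finv l w)) \<and>
          (\<forall>u. (1 - \<epsilon>) * (cmod u / Im (Finv l w)) \<le> cmod (D u) / Im w \<and>
               cmod (D u) / Im w \<le> (1 + \<epsilon>) * (cmod u / Im (Finv l w)))"
    and base_point: "l \<in> {0<..<l0} \<Longrightarrow> exp (of_real l * \<i>) \<in> \<A> l \<and> F l (exp (of_real l * \<i>)) = \<i>"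
    and dilate: "l \<in> {0<..<l0} \<Longrightarrow> z \<in> \<A> l \<Longrightarrow>
          of_real (exp l) * z \<in> \<A> l \<and> of_real (exp (- l)) * z \<in> \<A> l \<and> F l (of_real (exp l) * z) = F l z + 1"
begin

lemma small_l: "\<forall>\<^sub>F l in at_right 0. l \<in> {0<..<l0}"
  using eventually_at_right_real[OF l0_pos] .

lemma \<A>_hplane: "l \<in> {0<..<l0} \<Longrightarrow> \<A> l \<subseteq> hplane"
  using \<A>_quadrant by (auto simp: hplane_Im)

lemma Finv_F: "l \<in> {0<..<l0} \<Longrightarrow> z \<in> \<A> l \<Longrightarrow> Finv l (F l z) = z"
  using homeo homeomorphism_apply1 by metis

lemma F_Finv: "l \<in> {0<..<l0} \<Longrightarrow> w \<in> hplane \<Longrightarrow> F l (Finv l w) = w"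
  using homeo homeomorphism_apply2 by metis

lemma F_hplane: "l \<in> {0<..<l0} \<Longrightarrow> z \<in> \<A> l \<Longrightarrow> F l z \<in> hplane"
  using homeo homeomorphism_image1 by blast

lemma Finv_\<A>: "l \<in> {0<..<l0} \<Longrightarrow> w \<in> hplane \<Longrightarrow> Finv l w \<in> \<A> l"
  using homeo homeomorphism_image2 by blast

lemma Finv_hplane: "l \<in> {0<..<l0} \<Longrightarrow> w \<in> hplane \<Longrightarrow> Finv l w \<in> hplane"
  using Finv_\<A> \<A>_hplane by blast

text \<open>The lower bound makes D invertible and turns into the reciprocal upper bound for the
  inverse; as \<open>Finv l\<close> is continuous, this inverse is its derivative.\<close>

lemma Finv_has_derivative:
  assumes l: "l \<in> {0<..<l0}" and w: "w \<in> hplane" and e: "0 < e" "e < 1"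
    and D: "(F l has_derivative D) (at (Finv l w))"
      "\<And>u. (1 - e) * (cmod u / Im (Finv l w)) \<le> cmod (D u) / Im w"
  obtains D' where "(Finv l has_derivative D') (at w)"
    "\<And>v. cmod (D' v) / Im (Finv l w) \<le> (cmod v / Im w) / (1 - e)"
proof -
  have Imz: "Im (Finv l w) > 0" using Finv_hplane[OF l w] by (simp add: hplane_Im)
  have lin: "linear D" using D(1) has_derivative_linear by blast
  have "u = 0" if "D u = 0" for u
  proof -
    have "(1 - e) * (cmod u / Im (Finv l w)) \<le> 0" using D(2)[of u] that by simp
    then show ?thesis using e Imz by (simp add: mult_le_0_iff divide_le_0_iff)
  qed
  then have "inj D" using lin by (simp add: linear_injective_0)
  then obtain D' where D': "linear D'" "\<And>x. D' (D x) = x" "\<And>x. D (D' x) = x"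
    using linear_injective_isomorphism[OF lin] by blast
  show ?thesis
  proof (rule that[of D'])
    show "(Finv l has_derivative D') (at w)"
    proof (rule has_derivative_inverse_basic[where f = "F l" and f' = D and T = hplane])
      show "(F l has_derivative D) (at (Finv l w))" by (rule D(1))
      show "open hplane" "w \<in> hplane" by (rule open_hplane, rule w)
      show "bounded_linear D'" using D'(1) by (simp add: linear_conv_bounded_linear)
      show "D' \<circ> D = id" using D'(2) by auto
      have "continuous_on hplane (Finv l)" using homeo[OF l] by (simp add: homeomorphism_def)
      then show "isCont (Finv l) w"
        using open_hplane w continuous_on_eq_continuous_at by blast
      show "F l (Finv l z) = z" if "z \<in> hplane" for z using F_Finv[OF l that] .
    qed
    show "cmod (D' v) / Im (Finv l w) \<le> (cmod v / Im w) / (1 - e)" for v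
    proof -
      have "(1 - e) * (cmod (D' v) / Im (Finv l w)) \<le> cmod v / Im w" using D(2)[of "D' v"] by (simp add: D'(3))
      moreover have "1 - e > 0" using e by simp
      ultimately show ?thesis by (metis mult.commute pos_le_divide_eq)
    qed
  qed
qed

text \<open>\<open>Finv l\<close> takes the geodesic from w1 to w2 to a path of speed at most 1 +
  \<epsilon>. The geodesic has length at most 2 R and starts in the ball of radius R, hence it stays
  in the ball of radius 3 R.\<close>

lemma Finv_lipschitz:
  assumes \<epsilon>: "\<epsilon> > 0"
  shows "\<forall>\<^sub>F l in at_right 0. \<forall>w1 \<in> hball R. \<forall>w2 \<in> hball R.
      hdist (Finv l w1) (Finv l w2) \<le> (1 + \<epsilon>) * hdist w1 w2"
proof -
  \<comment> \<open>Chosen so that 1 / (1 - e) = 1 + \<epsilon>: passing to the inverse turns the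
    lower bound 1 - e into this upper bound.\<close>
  define e where "e = \<epsilon> / (1 + \<epsilon>)"
  have e: "0 < e" "e < 1" "1 / (1 - e) = 1 + \<epsilon>" using \<epsilon> by (auto simp: e_def field_simps)
  show ?thesis
    using near_isometric[OF e(1), of "3 * R"] small_l
  proof eventually_elim
    case (elim l)
    note l = elim(2)
    show ?case
    proof (intro ballI)
      fix w1 w2 assume w: "w1 \<in> hball R" "w2 \<in> hball R"
      then have wH: "w1 \<in> hplane" "w2 \<in> hplane" "hdist \<i> w1 \<le> R" "hdist \<i> w2 \<le> R"
        by (auto simp: hball_def)
      define T where "T = hdist w1 w2"
      have T0: "T \<ge> 0" using wH by (simp add: T_def hdist_nonneg)
      have T: "T \<le> 2 * R"
        using hdist_triangle[of w1 \<i> w2] wH by (simp add: T_def hdist_commute[of w1])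
      obtain \<sigma> \<sigma>' where \<sigma>: "\<sigma> 0 = w1" "\<sigma> (hdist w1 w2) = w2" "\<And>t. \<sigma> t \<in> hplane"
        "\<And>t. (\<sigma> has_vector_derivative \<sigma>' t) (at t)" "\<And>t. cmod (\<sigma>' t) = Im (\<sigma> t)"
        using geodesic[OF wH(1,2)] by blast
      have in_ball: "\<sigma> t \<in> hball (3 * R)" if "t \<in> {0..T}" for t
      proof -
        have "hdist (\<sigma> 0) (\<sigma> t) \<le> 1 * t"
          using that \<sigma>(3,4,5) by (intro hdist_path_le[where \<sigma>' = \<sigma>'])
            (auto intro: has_vector_derivative_at_within)
        then show ?thesis
          using hdist_triangle[of \<i> w1 "\<sigma> t"] wH \<sigma>(1,3) that T by (auto simp: hball_def)
      qed
      have "\<exists>D'. (Finv l has_derivative D') (at (\<sigma> t)) \<and>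
          (\<forall>v. cmod (D' v) / Im (Finv l (\<sigma> t)) \<le> (cmod v / Im (\<sigma> t)) / (1 - e))" if t: "t \<in> {0..T}" for t
      proof -
        obtain D where "(F l has_derivative D) (at (Finv l (\<sigma> t)))"
          "\<And>u. (1 - e) * (cmod u / Im (Finv l (\<sigma> t))) \<le> cmod (D u) / Im (\<sigma> t)"
          using elim(1) in_ball[OF t] by blast
        then show ?thesis
          using Finv_has_derivative[OF l \<sigma>(3) e(1,2)] by blast
      qed
      then obtain D' where D': "\<And>t. t \<in> {0..T} \<Longrightarrow> (Finv l has_derivative D' t) (at (\<sigma> t))"
        "\<And>t v. t \<in> {0..T} \<Longrightarrow> cmod (D' t v) / Im (Finv l (\<sigma> t)) \<le> (cmod v / Im (\<sigma> t)) / (1 - e)"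
        by metis
      have "hdist ((Finv l \<circ> \<sigma>) 0) ((Finv l \<circ> \<sigma>) T) \<le> (1 + \<epsilon>) * T"
      proof (rule hdist_path_le[where \<sigma>' = "\<lambda>t. D' t (\<sigma>' t)"])
        fix t assume t: "t \<in> {0..T}"
        show "(Finv l \<circ> \<sigma> has_vector_derivative D' t (\<sigma>' t)) (at t within {0..T})"
          using \<sigma>(4) D'(1)[OF t]
          by (intro vector_derivative_diff_chain_within)
            (auto intro: has_vector_derivative_at_within has_derivative_at_withinI)
        show "(Finv l \<circ> \<sigma>) t \<in> hplane" using Finv_hplane[OF l \<sigma>(3)] by simp
        then have "Im (Finv l (\<sigma> t)) > 0" by (simp add: hplane_Im)
        moreover have "Im (\<sigma> t) > 0" using \<sigma>(3) by (simp add: hplane_Im)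
        ultimately show "cmod (D' t (\<sigma>' t)) \<le> (1 + \<epsilon>) * Im ((Finv l \<circ> \<sigma>) t)"
          using D'(2)[OF t, of "\<sigma>' t"] e(3) by (simp add: \<sigma>(5) divide_le_eq)
      qed (use T0 \<epsilon> in auto)
      then show "hdist (Finv l w1) (Finv l w2) \<le> (1 + \<epsilon>) * hdist w1 w2"
        using \<sigma>(1,2) by (simp add: T_def)
    qed
  qed
qed

text \<open>A geodesic starting in the image of a ball cannot leave the image of a larger ball: up to the
  first exit time its pull-back has speed at most \<open>1 + \<epsilon>\<close>.\<close>

lemma F_lipschitz:
  assumes \<epsilon>: "0 < \<epsilon>" "\<epsilon> \<le> 1"
  shows "\<forall>\<^sub>F l in at_right 0. \<forall>w1 \<in> hball R. \<forall>z \<in> hplane. hdist (Finv l w1) z \<le> R \<longrightarrow>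
      z \<in> \<A> l \<and> hdist w1 (F l z) \<le> (1 + \<epsilon>) * hdist (Finv l w1) z"
  \<comment> \<open>A path of length at most R whose image has speed at most 1 + \<epsilon> \<le> 2
    ends within 2 R of w1, hence within 3 R of \<i>. The additional 1 leaves room for an open ball
    around the closed one.\<close>
  using near_isometric[OF \<epsilon>(1), of "3 * R + 1"] small_l
proof eventually_elim
  case (elim l)
  note l = elim(2)
  show ?case
  proof (intro ballI impI)
    fix w1 z assume w1: "w1 \<in> hball R" and z: "z \<in> hplane" and dz: "hdist (Finv l w1) z \<le> R"
    have w1H: "w1 \<in> hplane" "hdist \<i> w1 \<le> R" using w1 by (auto simp: hball_def)
    have R: "R \<ge> 0" using w1H hdist_nonneg[of \<i> w1] by simp
    define T where "T = hdist (Finv l w1) z"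
    note z1H = Finv_hplane[OF l w1H(1)]
    have T: "0 \<le> T" "T \<le> R" using hdist_nonneg[OF z1H z] dz by (auto simp: T_def)
    obtain \<sigma> \<sigma>' where \<sigma>: "\<sigma> 0 = Finv l w1" "\<sigma> (hdist (Finv l w1) z) = z" "\<And>t. \<sigma> t \<in> hplane"
        "\<And>t. (\<sigma> has_vector_derivative \<sigma>' t) (at t)" "\<And>t. cmod (\<sigma>' t) = Im (\<sigma> t)"
      using geodesic[OF z1H z] by blast
    define B where "B = {w \<in> hplane. hdist \<i> w < 3 * R + 1}"
    have B: "B \<subseteq> hball (3 * R + 1)" "B \<subseteq> hplane" by (auto simp: B_def hball_def)
    have part: "hdist w1 (F l (\<sigma> s)) \<le> (1 + \<epsilon>) * s"
      if s: "0 \<le> s" and in_B: "\<And>t. t \<in> {0..s} \<Longrightarrow> \<sigma> t \<in> Finv l ` B" for s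
    proof -
      have "\<exists>D. (F l has_derivative D) (at (\<sigma> t)) \<and>
          (\<forall>u. cmod (D u) / Im (F l (\<sigma> t)) \<le> (1 + \<epsilon>) * (cmod u / Im (\<sigma> t)))" if t: "t \<in> {0..s}" for t
      proof -
        obtain w where w: "w \<in> B" "\<sigma> t = Finv l w" using in_B[OF t] by blast
        then have "F l (\<sigma> t) = w" using F_Finv[OF l] B by auto
        then show ?thesis using elim(1) w B by fastforce
      qed
      then obtain D where D: "\<And>t. t \<in> {0..s} \<Longrightarrow> (F l has_derivative D t) (at (\<sigma> t))"
        "\<And>t u. t \<in> {0..s} \<Longrightarrow> cmod (D t u) / Im (F l (\<sigma> t)) \<le> (1 + \<epsilon>) * (cmod u / Im (\<sigma> t))"
        by metis
      have "hdist ((F l \<circ> \<sigma>) 0) ((F l \<circ> \<sigma>) s) \<le> (1 + \<epsilon>) * s"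
      proof (rule hdist_path_le[where \<sigma>' = "\<lambda>t. D t (\<sigma>' t)"])
        fix t assume t: "t \<in> {0..s}"
        show "(F l \<circ> \<sigma> has_vector_derivative D t (\<sigma>' t)) (at t within {0..s})"
          using \<sigma>(4) D(1)[OF t]
          by (intro vector_derivative_diff_chain_within)
            (auto intro: has_vector_derivative_at_within has_derivative_at_withinI)
        have "\<sigma> t \<in> \<A> l" using in_B[OF t] Finv_\<A>[OF l] B by auto
        then show H: "(F l \<circ> \<sigma>) t \<in> hplane" using F_hplane[OF l] by simp
        then have "Im (F l (\<sigma> t)) > 0" by (simp add: hplane_Im)
        moreover have "Im (\<sigma> t) > 0" using \<sigma>(3) by (simp add: hplane_Im)
        ultimately show "cmod (D t (\<sigma>' t)) \<le> (1 + \<epsilon>) * Im ((F l \<circ> \<sigma>) t)"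
          using D(2)[OF t, of "\<sigma>' t"] by (simp add: \<sigma>(5) divide_le_eq)
      qed (use s \<epsilon> in auto)
      then show ?thesis using \<sigma>(1) F_Finv[OF l w1H(1)] by simp
    qed
    have openB: "open (Finv l ` B)"
    proof -
      have "openin (top_of_set (\<A> l)) (Finv l ` B)"
        by (rule homeomorphism_imp_open_map[OF homeo[OF l, THEN homeomorphism_symD]])
          (simp add: B_def open_hdist_ball open_subset[OF B(2)[unfolded B_def]])
      then show ?thesis using \<A>_open[OF l] openin_open_trans by blast
    qed
    have compB: "compact (Finv l ` hball (3 * R))"
      using homeo[OF l] hball_subset compact_hball
      by (intro compact_continuous_image) (auto simp: homeomorphism_def intro: continuous_on_subset)
    have cont\<sigma>: "continuous_on S \<sigma>" for S
      by (intro continuous_at_imp_continuous_on ballI has_vector_derivative_continuous[OF \<sigma>(4)])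
    have all_in: "\<sigma> t \<in> Finv l ` B" if "t \<in> {0..T}" for t
    proof (rule ccontr)
      \<comment> \<open>The times at which \<sigma> is outside the image of \<open>B\<close> form a
        compact set; its minimum t0 is the first exit time. Before t0 the path stays in the image of
        the closed ball of radius 3 R, which is compact, so it is there at t0 as well: a
        contradiction.\<close>
      define X where "X = {0..T} \<inter> \<sigma> -` (- (Finv l ` B))"
      assume "\<sigma> t \<notin> Finv l ` B"
      then have "X \<noteq> {}" using that by (auto simp: X_def)
      moreover have "compact X"
      proof -
        have "closed X" unfolding X_def
          using openB by (intro continuous_closed_preimage cont\<sigma>) auto
        moreover have "X = {0..T} \<inter> X" by (auto simp: X_def)
        ultimately show ?thesis using compact_Int_closed[of "{0..T}" X] by simp
      qed
      ultimately have "\<exists>t0\<in>X. \<forall>t\<in>X. t0 \<le> t" by (intro compact_attains_inf)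
      then obtain t0 where t0: "t0 \<in> X" "\<And>t. t \<in> X \<Longrightarrow> t0 \<le> t" by blast
      have before: "\<sigma> t \<in> Finv l ` B" if "0 \<le> t" "t < t0" for t
        using t0 that by (force simp: X_def)
      have "Finv l w1 \<in> Finv l ` B" using w1H R by (auto simp: B_def)
      then have "t0 > 0" using t0(1) \<sigma>(1) by (cases "t0 = 0") (auto simp: X_def)
      have "\<sigma> s \<in> Finv l ` hball (3 * R)" if s: "s \<in> {0<..<t0}" for s
      proof -
        have *: "hdist w1 (F l (\<sigma> s)) \<le> (1 + \<epsilon>) * s" using part[of s] before s by auto
        obtain w where w: "w \<in> B" "\<sigma> s = Finv l w" using before[of s] s by auto
        then have Fw: "F l (\<sigma> s) = w" using F_Finv[OF l] B by auto
        have "(1 + \<epsilon>) * s \<le> 2 * R"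
          using \<epsilon> s t0(1) T by (intro mult_mono) (auto simp: X_def)
        then have "hdist \<i> w \<le> 3 * R"
          using hdist_triangle[of \<i> w1 w] w w1H B * Fw by fastforce
        then show ?thesis using w B by (auto simp: hball_def)
      qed
      moreover have "\<forall>\<^sub>F s in at_left t0. s \<in> {0<..<t0}"
        using \<open>t0 > 0\<close> by (rule eventually_at_left_real)
      ultimately have ev: "\<forall>\<^sub>F s in at_left t0. \<sigma> s \<in> Finv l ` hball (3 * R)"
        by (auto elim: eventually_mono)
      have "isCont \<sigma> t0" by (rule has_vector_derivative_continuous[OF \<sigma>(4)])
      then have "(\<sigma> \<longlongrightarrow> \<sigma> t0) (at_left t0)"
        by (simp add: isCont_def filterlim_at_split)
      then have "\<sigma> t0 \<in> Finv l ` hball (3 * R)"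
        by (rule Lim_in_closed_set[OF compact_imp_closed[OF compB] ev trivial_limit_at_left_real])
      moreover have "hball (3 * R) \<subseteq> B" by (auto simp: hball_def B_def)
      ultimately show False using t0(1) by (auto simp: X_def)
    qed
    have "z \<in> Finv l ` B" using all_in[of T] T \<sigma>(2) by (simp add: T_def)
    then have "z \<in> \<A> l" using Finv_\<A>[OF l] B by auto
    moreover have "hdist w1 (F l z) \<le> (1 + \<epsilon>) * T" using part[of T] all_in T \<sigma>(2) by (simp add: T_def)
    ultimately show "z \<in> \<A> l \<and> hdist w1 (F l z) \<le> (1 + \<epsilon>) * hdist (Finv l w1) z"
      by (simp add: T_def)
  qed
qed

text \<open>Three points at which the lift is known exactly, by the normalization at \<i> and
  equivariance under the dilation. Their distances to any other point will locate it.\<close>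

lemma Finv_lattice:
  assumes l: "l \<in> {0<..<l0}" and k: "k \<in> {-1, 0, 1}"
  shows "Finv l (\<i> + of_real k) = exp (of_real l * (\<i> + of_real k))"
proof -
  have b: "exp (of_real l * \<i>) \<in> \<A> l" "F l (exp (of_real l * \<i>)) = \<i>" using base_point[OF l] by auto
  define z where "z = exp (of_real l * (\<i> + of_real k))"
  have z_eq: "z = of_real (exp (l * k)) * exp (of_real l * \<i>)"
    by (simp add: z_def distrib_left exp_add exp_of_real mult_ac flip: of_real_mult)
  have "z \<in> \<A> l \<and> F l z = \<i> + of_real k"
  proof -
    consider "k = 0" | "k = 1" | "k = -1" using k by auto
    then show ?thesis
    proof cases
      case 3
      then have z: "z \<in> \<A> l" using dilate[OF l b(1)] by (simp add: z_eq)
      have "of_real (exp l) * z = exp (of_real l * \<i>)"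
        by (simp add: z_eq 3 exp_minus exp_of_real)
      then have "F l z + 1 = \<i>" using dilate[OF l z] b(2) by simp
      then have "F l z = \<i> + of_real k" using 3 by (simp add: algebra_simps)
      then show ?thesis using z by simp
    qed (use dilate[OF l b(1)] b in \<open>auto simp: z_eq\<close>)
  qed
  then show ?thesis using Finv_F[OF l] z_def by metis
qed

text \<open>The Lipschitz bounds for \<open>Finv\<close> and for \<open>F\<close> squeeze the
  distance of two images against that of the points themselves. The filter is arbitrary and the
  point moves, so that limits along pairs (l, w) are covered.\<close>

lemma hdist_lattice_limit:
  fixes L :: "'i \<Rightarrow> real" and W :: "'i \<Rightarrow> complex"
  assumes L: "filterlim L (at_right 0) G" and W: "(W \<longlongrightarrow> w0) G" and w0: "w0 \<in> hplane"
    and k: "k \<in> {-1, 0, 1}"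
  shows "((\<lambda>i. chd (Finv (L i) (W i)) (exp (of_real (L i) * (\<i> + of_real k)))) \<longlongrightarrow>
      chd w0 (\<i> + of_real k)) G"
proof -
  define a where "a = \<i> + complex_of_real k"
  have a: "a \<in> hplane" by (simp add: a_def hplane_Im)
  define R where "R = hdist \<i> w0 + 1 + hdist \<i> a"
  have R: "hdist \<i> a \<le> R" "hdist \<i> w0 + 1 \<le> R" "0 \<le> R"
    using hdist_nonneg[OF ii_hplane w0] hdist_nonneg[OF ii_hplane a] by (auto simp: R_def)
  have aR: "a \<in> hball R" using a R by (simp add: hball_def)
  have W_ball: "\<forall>\<^sub>F i in G. W i \<in> hball R"
  proof -
    have "\<forall>\<^sub>F i in G. W i \<in> {w \<in> hplane. hdist \<i> w < hdist \<i> w0 + 1}"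
      using W open_hdist_ball by (rule topological_tendstoD) (use w0 in simp)
    then show ?thesis by eventually_elim (use R in \<open>auto simp: hball_def\<close>)
  qed
  define d where "d = (\<lambda>i. hdist a (W i))"
  define e where "e = (\<lambda>i. hdist (Finv (L i) a) (Finv (L i) (W i)))"
  have d_lim: "(d \<longlongrightarrow> hdist a w0) G"
  proof -
    have "isCont (hdist a) w0"
      using continuous_on_hdist[OF a] open_hplane w0 continuous_on_eq_continuous_at by blast
    then show ?thesis unfolding d_def using W by (rule isCont_tendsto_compose)
  qed
  have bounds: "\<forall>\<^sub>F i in G. \<bar>e i - d i\<bar> \<le> \<epsilon> * (2 * R)" if \<epsilon>: "0 < \<epsilon>" "\<epsilon> \<le> 1" for \<epsilon>
  proof -
    have "\<forall>\<^sub>F i in G. \<forall>w1 \<in> hball R. \<forall>w2 \<in> hball R.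
      hdist (Finv (L i) w1) (Finv (L i) w2) \<le> (1 + \<epsilon>) * hdist w1 w2"
      using Finv_lipschitz[OF \<epsilon>(1)] L by (rule eventually_compose_filterlim)
    \<comment> \<open>The radius 4 R admits the distance e i, which is at most (1 + \<epsilon>) * d
      i \<le> 2 * (2 * R).\<close>
    moreover have "\<forall>\<^sub>F i in G. \<forall>w1 \<in> hball (4 * R). \<forall>z \<in> hplane. hdist (Finv (L i) w1) z \<le> 4 * R \<longrightarrow>
      z \<in> \<A> (L i) \<and> hdist w1 (F (L i) z) \<le> (1 + \<epsilon>) * hdist (Finv (L i) w1) z"
      using F_lipschitz[OF \<epsilon>] L by (rule eventually_compose_filterlim)
    moreover have "\<forall>\<^sub>F i in G. L i \<in> {0<..<l0}"
      using small_l L by (rule eventually_compose_filterlim)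
    ultimately show ?thesis using W_ball
    proof eventually_elim
      case (elim i)
      have WH: "W i \<in> hplane" using elim(4) by (simp add: hball_def)
      have zH: "Finv (L i) (W i) \<in> hplane" using Finv_hplane[OF elim(3) WH] .
      have up: "e i \<le> (1 + \<epsilon>) * d i" unfolding e_def d_def using elim(1,4) aR by blast
      have "d i \<le> hdist \<i> a + hdist \<i> (W i)"
        unfolding d_def using hdist_triangle[OF a ii_hplane WH] by (simp add: hdist_commute)
      then have d: "d i \<le> 2 * R" using elim(4) R by (auto simp: hball_def)
      have d0: "0 \<le> d i" unfolding d_def using a WH by (rule hdist_nonneg)
      have "(1 + \<epsilon>) * d i \<le> 2 * (2 * R)" using \<epsilon> d d0 by (intro mult_mono) auto
      then have "e i \<le> 4 * R" using up by simp
      moreover have "a \<in> hball (4 * R)" using aR hball_mono[of R "4 * R"] R by auto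
      ultimately have "hdist a (F (L i) (Finv (L i) (W i))) \<le> (1 + \<epsilon>) * e i"
        unfolding e_def using elim(2) zH by blast
      then have low: "d i \<le> (1 + \<epsilon>) * e i" using F_Finv[OF elim(3) WH] by (simp add: d_def)
      have "d i * (1 - \<epsilon>) \<le> e i"
      proof -
        have "d i * (1 - \<epsilon>) * (1 + \<epsilon>) = d i - d i * (\<epsilon> * \<epsilon>)" by (simp add: algebra_simps)
        also have "\<dots> \<le> d i" using d0 by simp
        also have "d i \<le> e i * (1 + \<epsilon>)" using low by (simp add: mult.commute)
        finally show ?thesis using \<epsilon> by simp
      qed
      moreover have "\<epsilon> * d i \<le> \<epsilon> * (2 * R)" using \<epsilon> d by simp
      ultimately show ?case using up by (simp add: abs_le_iff algebra_simps)
    qed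
  qed
  have "((\<lambda>i. e i - d i) \<longlongrightarrow> 0) G"
  proof (rule tendstoI)
    fix r :: real assume r: "r > 0"
    define \<epsilon> where "\<epsilon> = min 1 (r / (2 * R + 1) / 2)"
    have \<epsilon>: "0 < \<epsilon>" "\<epsilon> \<le> 1" using r R by (auto simp: \<epsilon>_def)
    have "\<epsilon> * (2 * R) \<le> (r / (2 * R + 1) / 2) * (2 * R + 1)"
      using R \<epsilon> by (intro mult_mono) (auto simp: \<epsilon>_def)
    also have "\<dots> = r / 2"
    proof -
      have "x / y / 2 * y = x / 2" if "y \<noteq> 0" for x y :: real using that by simp
      then show ?thesis using R by (metis add_nonneg_pos less_numeral_extra(1) less_numeral_extra(3) mult_nonneg_nonneg zero_le_numeral)
    qed
    also have "\<dots> < r" using r by simp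
    finally show "\<forall>\<^sub>F i in G. dist (e i - d i) 0 < r"
      using bounds[OF \<epsilon>] by (auto simp: dist_real_def elim: eventually_mono)
  qed
  then have "((\<lambda>i. (e i - d i) + d i) \<longlongrightarrow> 0 + hdist a w0) G"
    using d_lim by (rule tendsto_add)
  then have "(e \<longlongrightarrow> hdist a w0) G" by simp
  then have "((\<lambda>i. cosh (e i)) \<longlongrightarrow> cosh (hdist a w0)) G" by (rule tendsto_cosh)
  moreover have "\<forall>\<^sub>F i in G. cosh (e i) = chd (Finv (L i) (W i)) (exp (of_real (L i) * (\<i> + of_real k)))"
    using eventually_compose_filterlim[OF small_l L] W_ball
  proof eventually_elim
    case (elim i)
    then have "W i \<in> hplane" by (simp add: hball_def)
    then have "cosh (e i) = chd (Finv (L i) a) (Finv (L i) (W i))"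
      unfolding e_def using Finv_hplane[OF elim(1)] a by (intro cosh_hdist) auto
    then show ?case using Finv_lattice[OF elim(1) k] by (simp add: a_def chd_commute)
  qed
  ultimately have "((\<lambda>i. chd (Finv (L i) (W i)) (exp (of_real (L i) * (\<i> + of_real k)))) \<longlongrightarrow> cosh (hdist a w0)) G"
    by (rule Lim_transform_eventually)
  then show ?thesis by (simp add: cosh_hdist a w0 chd_commute flip: a_def)
qed

text \<open>Trilateration in the strip. In the difference D and the second difference S of the cosh
  distances to \<i> - 1, \<i>, \<i> + 1 the term cos (\<theta> - l) of \<open>chd_polar\<close>
  cancels. Hence D / S determines tanh t, and S then determines sin \<theta>; the limits of D and S
  are the same differences of \<open>chd w0\<close>, which contain Re w0 and Im w0.\<close>

lemma Finv_asymptotics: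
  fixes L :: "'i \<Rightarrow> real" and W :: "'i \<Rightarrow> complex"
  assumes L: "filterlim L (at_right 0) G" and W: "(W \<longlongrightarrow> w0) G" and w0: "w0 \<in> hplane"
  shows "((\<lambda>i. w_coord (L i) (Finv (L i) (W i))) \<longlongrightarrow> w0) G"
    and "((\<lambda>i. Im (Finv (L i) (W i)) / cmod (Finv (L i) (W i)) / L i) \<longlongrightarrow> Im w0) G"
proof -
  define z where "z = (\<lambda>i. Finv (L i) (W i))"
  define t where "t = (\<lambda>i. ln (cmod (z i)))"
  define \<theta> where "\<theta> = (\<lambda>i. Arg (z i))"
  define sn where "sn = (\<lambda>i. Im (z i) / cmod (z i))"
  define Q where "Q = (\<lambda>k i. chd (z i) (exp (of_real (L i) * (\<i> + of_real k))))"
  have Imw0: "Im w0 > 0" using w0 by (simp add: hplane_Im)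
  have L0: "(L \<longlongrightarrow> 0) G" and Lpos: "\<forall>\<^sub>F i in G. L i > 0"
    using L by (auto simp: filterlim_at elim: eventually_mono)
  have Lne: "\<forall>\<^sub>F i in G. L i \<noteq> 0" using Lpos by (auto elim: eventually_mono)
  have lims: "(Q k \<longlongrightarrow> chd w0 (\<i> + of_real k)) G" if "k \<in> {-1, 0, 1}" for k
    unfolding Q_def z_def using hdist_lattice_limit[OF L W w0 that] .
  have chdw0: "chd w0 (\<i> + of_real k) = 1 + ((Re w0 - k)\<^sup>2 + (Im w0 - 1)\<^sup>2) / (2 * Im w0)" for k
    by (simp add: chd_def cmod_power2)
  define S where "S = (\<lambda>i. Q 1 i + Q (-1) i - 2 * Q 0 i)"
  define D where "D = (\<lambda>i. Q (-1) i - Q 1 i)"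
  have "(S \<longlongrightarrow> chd w0 (\<i> + of_real 1) + chd w0 (\<i> + of_real (-1)) - 2 * chd w0 (\<i> + of_real 0)) G"
    unfolding S_def by (intro tendsto_intros lims) auto
  also have "chd w0 (\<i> + of_real 1) + chd w0 (\<i> + of_real (-1)) - 2 * chd w0 (\<i> + of_real 0) = 1 / Im w0"
    unfolding chdw0 using Imw0 by (simp add: field_simps power2_eq_square)
  finally have S_lim: "(S \<longlongrightarrow> 1 / Im w0) G" .
  have "(D \<longlongrightarrow> chd w0 (\<i> + of_real (-1)) - chd w0 (\<i> + of_real 1)) G"
    unfolding D_def by (intro tendsto_intros lims) auto
  also have "chd w0 (\<i> + of_real (-1)) - chd w0 (\<i> + of_real 1) = 2 * Re w0 / Im w0"
    unfolding chdw0 using Imw0 by (simp add: field_simps power2_eq_square)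
  finally have D_lim: "(D \<longlongrightarrow> 2 * Re w0 / Im w0) G" .
  have ok: "\<forall>\<^sub>F i in G. Re (z i) > 0 \<and> Im (z i) > 0 \<and> 0 < L i \<and> L i < pi / 2"
  proof -
    have "\<forall>\<^sub>F i in G. W i \<in> hplane"
      using W open_hplane w0 by (rule topological_tendstoD)
    then show ?thesis using eventually_compose_filterlim[OF small_l L]
    proof eventually_elim
      case (elim i)
      then show ?case using \<A>_quadrant[OF elim(2) Finv_\<A>[OF elim(2,1)]] l0_le by (auto simp: z_def)
    qed
  qed
  have formulas: "S i = 2 * cosh (t i) * (cosh (L i) - 1) / (sn i * sin (L i))"
    "D i = 2 * sinh (t i) * sinh (L i) / (sn i * sin (L i))"
    "sn i = sin (\<theta> i)" "0 < sn i" "0 < sin (L i)" "0 < \<theta> i" "\<theta> i < pi / 2"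
    "w_coord (L i) (z i) = Complex (t i / L i) (\<theta> i / L i)"
    if ok: "Re (z i) > 0 \<and> Im (z i) > 0 \<and> 0 < L i \<and> L i < pi / 2" for i
  proof -
    have nz: "z i \<noteq> 0" using ok by auto
    show s: "sn i = sin (\<theta> i)" using sin_Arg[OF nz] by (simp add: sn_def \<theta>_def)
    show s0: "0 < sn i" using ok nz by (simp add: sn_def)
    show l0: "0 < sin (L i)" using ok by (intro sin_gt_zero) auto
    have Q: "Q k i = 1 + (cosh (t i - L i * k) - cos (\<theta> i - L i)) / (sn i * sin (L i))" for k
      using chd_polar[of "z i" "L i" k] ok pi_gt_zero unfolding Q_def t_def \<theta>_def sn_def by simp
    show "S i = 2 * cosh (t i) * (cosh (L i) - 1) / (sn i * sin (L i))"
      unfolding S_def Q by (simp add: cosh_diff cosh_add diff_divide_distrib add_divide_distrib algebra_simps)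
    show "D i = 2 * sinh (t i) * sinh (L i) / (sn i * sin (L i))"
      unfolding D_def Q by (simp add: cosh_diff cosh_add diff_divide_distrib add_divide_distrib algebra_simps)
    show "0 < \<theta> i" "\<theta> i < pi / 2"
      using ok Arg_lt_pi[of "z i"] Arg_Re_pos[of "z i"] by (auto simp: \<theta>_def)
    show "w_coord (L i) (z i) = Complex (t i / L i) (\<theta> i / L i)"
      using nz by (simp add: w_coord_def complex_eq_iff t_def \<theta>_def Arg_eq_Im_Ln)
  qed
  have S_ne: "1 / Im w0 \<noteq> 0" using Imw0 by simp
  have "((\<lambda>l::real. (cosh l - 1) / (l * sinh l)) \<longlongrightarrow> 1 / 2) (at_right 0)"
    unfolding cosh_field_def sinh_field_def by real_asymp
  then have "((\<lambda>i. (cosh (L i) - 1) / (L i * sinh (L i))) \<longlongrightarrow> 1 / 2) G"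
    using L by (rule filterlim_compose)
  then have "((\<lambda>i. D i / S i * ((cosh (L i) - 1) / (L i * sinh (L i)))) \<longlongrightarrow> (2 * Re w0 / Im w0) / (1 / Im w0) * (1 / 2)) G"
    by (intro tendsto_mult[OF tendsto_divide[OF D_lim S_lim S_ne]])
  moreover have "\<forall>\<^sub>F i in G. D i / S i * ((cosh (L i) - 1) / (L i * sinh (L i))) = tanh (t i) / L i"
    using ok
  proof eventually_elim
    case (elim i)
    have "cosh (L i) - 1 \<noteq> 0" "sinh (L i) \<noteq> 0"
      using elim cosh_real_one_iff[of "L i"] by auto
    then show ?case
      using formulas(4,5)[OF elim] elim unfolding formulas(1,2)[OF elim] tanh_def
      by (simp add: divide_simps)
  qed
  ultimately have "((\<lambda>i. tanh (t i) / L i) \<longlongrightarrow> (2 * Re w0 / Im w0) / (1 / Im w0) * (1 / 2)) G"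
    by (rule Lim_transform_eventually)
  then have tanh_lim: "((\<lambda>i. tanh (t i) / L i) \<longlongrightarrow> Re w0) G" using Imw0 by simp
  have "((\<lambda>i. artanh (tanh (t i)) / L i) \<longlongrightarrow> Re w0) G"
    by (rule tendsto_deriv_ratio[OF _ _ tanh_lim L0 Lne]) (auto intro!: derivative_eq_intros)
  then have t_lim: "((\<lambda>i. t i / L i) \<longlongrightarrow> Re w0) G" by (simp add: artanh_tanh_real)
  have "((\<lambda>i. t i / L i * L i) \<longlongrightarrow> Re w0 * 0) G" by (intro tendsto_mult t_lim L0)
  then have t0: "(t \<longlongrightarrow> 0) G"
    unfolding mult_zero_right by (rule Lim_transform_eventually) (use Lne in \<open>auto elim: eventually_mono\<close>)
  have "((\<lambda>l::real. (cosh l - 1) / (l * sin l)) \<longlongrightarrow> 1 / 2) (at_right 0)"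
    unfolding cosh_field_def by real_asymp
  then have "((\<lambda>i. (cosh (L i) - 1) / (L i * sin (L i))) \<longlongrightarrow> 1 / 2) G"
    using L by (rule filterlim_compose)
  then have "((\<lambda>i. 2 * cosh (t i) / S i * ((cosh (L i) - 1) / (L i * sin (L i)))) \<longlongrightarrow> 2 * cosh 0 / (1 / Im w0) * (1 / 2)) G"
    by (intro tendsto_mult[OF tendsto_divide[OF tendsto_mult[OF tendsto_const tendsto_cosh[OF t0]] S_lim S_ne]])
  moreover have "\<forall>\<^sub>F i in G. 2 * cosh (t i) / S i * ((cosh (L i) - 1) / (L i * sin (L i))) = sn i / L i"
    using ok
  proof eventually_elim
    case (elim i)
    have "cosh (L i) - 1 \<noteq> 0" "cosh (t i) \<noteq> 0"
      using elim cosh_real_one_iff[of "L i"] cosh_real_pos[of "t i"] by auto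
    then show ?case
      using formulas(4,5)[OF elim] elim unfolding formulas(1)[OF elim]
      by (simp add: divide_simps)
  qed
  ultimately have "((\<lambda>i. sn i / L i) \<longlongrightarrow> 2 * cosh 0 / (1 / Im w0) * (1 / 2)) G"
    by (rule Lim_transform_eventually)
  then have sn_lim: "((\<lambda>i. sn i / L i) \<longlongrightarrow> Im w0) G" by simp
  then show "((\<lambda>i. Im (Finv (L i) (W i)) / cmod (Finv (L i) (W i)) / L i) \<longlongrightarrow> Im w0) G"
    by (simp add: sn_def z_def)
  \<comment> \<open>The sine determines \<theta> because the component lies in the open quadrant,
    where 0 < \<theta> < pi / 2.\<close>
  have "((\<lambda>i. arcsin (sn i) / L i) \<longlongrightarrow> Im w0) G"
    by (rule tendsto_deriv_ratio[OF _ _ sn_lim L0 Lne]) (auto intro!: derivative_eq_intros)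
  moreover have "\<forall>\<^sub>F i in G. arcsin (sn i) / L i = \<theta> i / L i"
    using ok
  proof eventually_elim
    case (elim i)
    then show ?case using formulas(3,6,7)[OF elim] by (simp add: arcsin_sin)
  qed
  ultimately have \<theta>_lim: "((\<lambda>i. \<theta> i / L i) \<longlongrightarrow> Im w0) G" by (rule Lim_transform_eventually)
  have "((\<lambda>i. Complex (t i / L i) (\<theta> i / L i)) \<longlongrightarrow> Complex (Re w0) (Im w0)) G"
    by (intro tendsto_Complex t_lim \<theta>_lim)
  moreover have "\<forall>\<^sub>F i in G. Complex (t i / L i) (\<theta> i / L i) = w_coord (L i) (z i)"
    using ok by eventually_elim (use formulas(8) in metis)
  ultimately have "((\<lambda>i. w_coord (L i) (z i)) \<longlongrightarrow> Complex (Re w0) (Im w0)) G"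
    by (rule Lim_transform_eventually)
  then show "((\<lambda>i. w_coord (L i) (Finv (L i) (W i))) \<longlongrightarrow> w0) G" by (simp add: z_def)
qed

end

section \<open>Uniform convergence\<close>

text \<open>Joint convergence at a point gives a neighbourhood on which one eventual condition on i
  suffices; finitely many such neighbourhoods cover K.\<close>

lemma uniform_limit_compactI:
  fixes f :: "'i \<Rightarrow> 'a::topological_space \<Rightarrow> 'b::metric_space"
  assumes K: "compact K" and g: "continuous_on K g"
    and lim: "\<And>x0. x0 \<in> K \<Longrightarrow> ((\<lambda>(i, x). f i x) \<longlongrightarrow> g x0) (G \<times>\<^sub>F inf (nhds x0) (principal K))"
  shows "uniform_limit K f g G"
proof (rule uniform_limitI)
  fix e :: real assume e: "e > 0"
  have "\<exists>U P. open U \<and> x0 \<in> U \<and> eventually P G \<and> (\<forall>i x. P i \<and> x \<in> U \<inter> K \<longrightarrow> dist (f i x) (g x) < e)"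
    if x0: "x0 \<in> K" for x0
  proof -
    have "\<forall>\<^sub>F (i, x) in G \<times>\<^sub>F inf (nhds x0) (principal K). dist (f i x) (g x0) < e / 2"
      using tendstoD[OF lim[OF x0], of "e / 2"] e by (simp add: case_prod_unfold)
    then obtain P Q where PQ: "eventually P G" "eventually Q (inf (nhds x0) (principal K))"
      "\<And>i x. P i \<Longrightarrow> Q x \<Longrightarrow> dist (f i x) (g x0) < e / 2"
      unfolding eventually_prod_filter by auto
    have "(g \<longlongrightarrow> g x0) (at x0 within K)" using g x0 by (simp add: continuous_on_def)
    then have "\<forall>\<^sub>F x in at x0 within K. dist (g x) (g x0) < e / 2"
      by (rule tendstoD) (use e in simp)
    then have "\<forall>\<^sub>F x in nhds x0. x \<noteq> x0 \<longrightarrow> x \<in> K \<longrightarrow> dist (g x) (g x0) < e / 2"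
      by (simp add: eventually_at_filter)
    moreover have "\<forall>\<^sub>F x in nhds x0. x \<in> K \<longrightarrow> Q x"
      using PQ(2) by (simp add: eventually_inf_principal)
    ultimately have "\<forall>\<^sub>F x in nhds x0. x \<in> K \<longrightarrow> Q x \<and> dist (g x) (g x0) < e / 2"
      by eventually_elim (use e in auto)
    then obtain U where U: "open U" "x0 \<in> U" "\<And>x. x \<in> U \<Longrightarrow> x \<in> K \<Longrightarrow> Q x \<and> dist (g x) (g x0) < e / 2"
      unfolding eventually_nhds by blast
    have "dist (f i x) (g x) < e" if "P i" "x \<in> U" "x \<in> K" for i x
      using PQ(3)[of i x] U(3)[of x] that dist_triangle_half_l[of "f i x" "g x0" e "g x"] by (simp add: dist_commute)
    then show ?thesis using U(1,2) PQ(1) by blast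
  qed
  then obtain U P where UP: "\<And>x0. x0 \<in> K \<Longrightarrow> open (U x0)" "\<And>x0. x0 \<in> K \<Longrightarrow> x0 \<in> U x0"
    "\<And>x0. x0 \<in> K \<Longrightarrow> eventually (P x0) G"
    "\<And>x0 i x. x0 \<in> K \<Longrightarrow> P x0 i \<Longrightarrow> x \<in> U x0 \<inter> K \<Longrightarrow> dist (f i x) (g x) < e"
    by metis
  have cover: "K \<subseteq> (\<Union>x\<in>K. U x)" using UP(2) by auto
  have "\<exists>C. C \<subseteq> K \<and> finite C \<and> K \<subseteq> (\<Union>x\<in>C. U x)"
    by (rule compactE_image[OF K UP(1) cover]) (assumption, rule exI, intro conjI)
  then obtain C where C: "C \<subseteq> K" "finite C" "K \<subseteq> (\<Union>x\<in>C. U x)" by (elim exE conjE)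
  have "\<forall>\<^sub>F i in G. \<forall>x\<in>C. P x i"
    using C UP(3) by (intro eventually_ball_finite) auto
  then show "\<forall>\<^sub>F i in G. \<forall>x\<in>K. dist (f i x) (g x) < e"
  proof eventually_elim
    case (elim i)
    show ?case
    proof
      fix x assume x: "x \<in> K"
      then obtain x0 where "x0 \<in> C" "x \<in> U x0" using C(3) by auto
      then show "dist (f i x) (g x) < e" using UP(4)[of x0 i x] elim C(1) x by auto
    qed
  qed
qed

text \<open>The bound on finite sums makes the remaining terms absolutely summable. This is what
  allows the sum to be split at E, since \<open>infsum\<close> of a family that is not summable is 0
  by default.\<close>

lemma uniformly_small_tail:
  fixes a :: "'x \<Rightarrow> complex"
  assumes E: "finite E" "E \<subseteq> R" and tail: "\<And>E'. finite E' \<Longrightarrow> E' \<subseteq> R - E \<Longrightarrow> (\<Sum>X\<in>E'. norm (a X)) \<le> e"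
  shows "norm (infsum a R - sum a E) \<le> e"
proof -
  have bdd: "bdd_above (sum (\<lambda>X. norm (a X)) ` {F. F \<subseteq> R - E \<and> finite F})"
    using tail by (intro bdd_aboveI2[where M = e]) auto
  have abs: "(\<lambda>X. norm (a X)) summable_on (R - E)"
    by (rule nonneg_bdd_above_summable_on[OF _ bdd]) simp
  have "infsum a (E \<union> (R - E)) = infsum a E + infsum a (R - E)"
    using E abs abs_summable_summable by (intro infsum_Un_disjoint) auto
  moreover have "E \<union> (R - E) = R" using E by auto
  ultimately have "norm (infsum a R - sum a E) = norm (infsum a (R - E))" using E by simp
  also have "\<dots> \<le> infsum (\<lambda>X. norm (a X)) (R - E)" using abs by (rule norm_infsum_bound)
  also have "\<dots> \<le> e" using tail by (intro infsum_le_finite_sums abs) auto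
  finally show ?thesis .
qed

text \<open>Dominated convergence with uniformly small tails instead of a majorant. Three errors of
  at most e / 4 arise: two tails and one finite sum.\<close>

lemma uniform_limit_infsum:
  fixes T :: "'l \<Rightarrow> 'x \<Rightarrow> 'w \<Rightarrow> complex"
  assumes G: "G \<noteq> bot"
    and tails: "\<And>e. e > 0 \<Longrightarrow> \<exists>E. finite E \<and> E \<subseteq> R \<and>
        (\<forall>\<^sub>F l in G. \<forall>w\<in>K. \<forall>E'. finite E' \<and> E' \<subseteq> R - E \<longrightarrow> (\<Sum>X\<in>E'. norm (T l X w)) \<le> e)"
    and conv: "\<And>X. X \<in> R \<Longrightarrow> uniform_limit K (\<lambda>l w. T l X w) (T0 X) G"
  shows "uniform_limit K (\<lambda>l w. \<Sum>\<^sub>\<infinity>X\<in>R. T l X w) (\<lambda>w. \<Sum>\<^sub>\<infinity>X\<in>R. T0 X w) G"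
proof (rule uniform_limitI)
  fix e :: real assume e: "e > 0"
  obtain E where E: "finite E" "E \<subseteq> R" and
    tail: "\<forall>\<^sub>F l in G. \<forall>w\<in>K. \<forall>E'. finite E' \<and> E' \<subseteq> R - E \<longrightarrow> (\<Sum>X\<in>E'. norm (T l X w)) \<le> e / 4"
    using tails[of "e / 4"] e by auto
  \<comment> \<open>The limit terms inherit the tail bound on each finite set E' separately, by
    passing to the limit in l.\<close>
  have tail0: "(\<Sum>X\<in>E'. norm (T0 X w)) \<le> e / 4" if "w \<in> K" "finite E'" "E' \<subseteq> R - E" for w E'
  proof (rule tendsto_upperbound[OF _ _ G])
    show "((\<lambda>l. \<Sum>X\<in>E'. norm (T l X w)) \<longlongrightarrow> (\<Sum>X\<in>E'. norm (T0 X w))) G"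
      using that by (intro tendsto_sum tendsto_norm tendsto_uniform_limitI[OF conv]) auto
    show "\<forall>\<^sub>F l in G. (\<Sum>X\<in>E'. norm (T l X w)) \<le> e / 4"
      using tail by eventually_elim (use that in auto)
  qed
  have "uniform_limit K (\<lambda>l w. \<Sum>X\<in>E. T l X w) (\<lambda>w. \<Sum>X\<in>E. T0 X w) G"
    using E(1,2)
  proof (induction E rule: finite_induct)
    case empty
    show ?case by (simp add: uniform_limit_const)
  next
    case (insert X E)
    then show ?case by (simp add: uniform_limit_add conv)
  qed
  then have "\<forall>\<^sub>F l in G. \<forall>w\<in>K. dist (\<Sum>X\<in>E. T l X w) (\<Sum>X\<in>E. T0 X w) < e / 4"
    by (rule uniform_limitD) (use e in simp)
  then show "\<forall>\<^sub>F l in G. \<forall>w\<in>K. dist (\<Sum>\<^sub>\<infinity>X\<in>R. T l X w) (\<Sum>\<^sub>\<infinity>X\<in>R. T0 X w) < e"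
    using tail
  proof eventually_elim
    case (elim l)
    show ?case
    proof
      fix w assume w: "w \<in> K"
      define x where "x = (\<Sum>\<^sub>\<infinity>X\<in>R. T l X w)"
      define y where "y = (\<Sum>\<^sub>\<infinity>X\<in>R. T0 X w)"
      define x' where "x' = (\<Sum>X\<in>E. T l X w)"
      define y' where "y' = (\<Sum>X\<in>E. T0 X w)"
      have 1: "norm (x - x') \<le> e / 4" unfolding x_def x'_def
        by (rule uniformly_small_tail[OF E]) (use elim(2) w in auto)
      have 2: "norm (y - y') \<le> e / 4" unfolding y_def y'_def
        by (rule uniformly_small_tail[OF E]) (use tail0 w in auto)
      have 3: "norm (x' - y') < e / 4" using elim(1) w by (auto simp: x'_def y'_def dist_norm)
      have "x - y = (x - x') + (x' - y') - (y - y')" by simp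
      then have "norm (x - y) \<le> norm (x - x') + norm (x' - y') + norm (y - y')"
        using norm_triangle_ineq4[of "(x - x') + (x' - y')" "y - y'"]
          norm_triangle_ineq[of "x - x'" "x' - y'"] by simp
      then show "dist (\<Sum>\<^sub>\<infinity>X\<in>R. T l X w) (\<Sum>\<^sub>\<infinity>X\<in>R. T0 X w) < e"
        unfolding dist_norm x_def[symmetric] y_def[symmetric] using 1 2 3 e by simp
    qed
  qed
qed

section \<open>A packing estimate in the collar\<close>

lemma dyadic_scale:
  fixes \<eta> :: real
  assumes "0 < \<eta>" "\<eta> \<le> (1 / 2) ^ k0"
  obtains k where "k0 \<le> k" "(1 / 2) ^ Suc k < \<eta>" "\<eta> \<le> (1 / 2) ^ k"
proof -
  have "(\<lambda>k. (1 / 2 :: real) ^ k) \<longlonglongrightarrow> 0" by (rule LIMSEQ_power_zero) simp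
  then have "\<forall>\<^sub>F k in sequentially. (1 / 2 :: real) ^ k < \<eta>" using assms(1) by (rule order_tendstoD)
  then obtain m where m: "(1 / 2 :: real) ^ m < \<eta>" by (auto simp: eventually_sequentially)
  define n where "n = (LEAST m. (1 / 2 :: real) ^ m < \<eta>)"
  have n: "(1 / 2 :: real) ^ n < \<eta>" unfolding n_def using m by (rule LeastI)
  have "n > k0"
  proof (rule ccontr)
    assume "\<not> n > k0"
    then have "(1 / 2 :: real) ^ k0 \<le> (1 / 2) ^ n" by (intro power_decreasing) auto
    then show False using n assms(2) by linarith
  qed
  then obtain k where k: "n = Suc k" by (cases n) auto
  have "\<not> (1 / 2 :: real) ^ k < \<eta>" using not_less_Least[of k "\<lambda>m. (1 / 2 :: real) ^ m < \<eta>"] k by (simp add: n_def)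
  then show ?thesis using that[of k] \<open>n > k0\<close> n k by auto
qed

lemma floor_eq_imp_close:
  fixes x y c :: real
  assumes "c > 0" "\<lfloor>x * c\<rfloor> = \<lfloor>y * c\<rfloor>"
  shows "\<bar>x - y\<bar> < 1 / c"
proof -
  have "\<bar>x * c - y * c\<bar> < 1" using assms(2) by linarith
  then have "\<bar>x - y\<bar> * c < 1" using assms(1) by (simp add: abs_mult left_diff_distrib[symmetric])
  then show ?thesis using assms(1) by (simp add: pos_less_divide_eq)
qed

text \<open>The coordinates are |z| and sin \<theta>. As the sines are at most 1 / 2, the cosines
  are at least 1 / 2, so cosines differ by no more than sines do. In 3 d^2, one summand comes from
  the moduli and two from the angles.\<close>

lemma chd_close:
  assumes z: "Re z > 0" "Im z > 0" "1 \<le> cmod z" and w: "Re w > 0" "Im w > 0" "1 \<le> cmod w"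
    and d: "\<bar>cmod z - cmod w\<bar> \<le> d" "\<bar>Im z / cmod z - Im w / cmod w\<bar> \<le> d"
    and h: "0 < h" "h \<le> Im z / cmod z" "h \<le> Im w / cmod w" "Im z / cmod z \<le> 1 / 2" "Im w / cmod w \<le> 1 / 2"
  shows "chd z w \<le> 1 + 3 * d\<^sup>2 / (2 * h\<^sup>2)"
proof -
  define r r' where "r = cmod z" "r' = cmod w"
  define s s' where "s = Im z / r" "s' = Im w / r'"
  define c c' where "c = Re z / r" "c' = Re w / r'"
  have pos: "r \<ge> 1" "r' \<ge> 1" using z w by (auto simp: r_r'_def)
  have cpos: "c > 0" "c' > 0" using z w pos by (auto simp: c_c'_def)
  have eqs: "Im z = r * s" "Im w = r' * s'" "Re z = r * c" "Re w = r' * c'"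
    using pos by (auto simp: s_s'_def c_c'_def)
  have rr: "r\<^sup>2 = (Re z)\<^sup>2 + (Im z)\<^sup>2" "r'\<^sup>2 = (Re w)\<^sup>2 + (Im w)\<^sup>2" by (auto simp: r_r'_def cmod_power2)
  have "r\<^sup>2 * (c\<^sup>2 + s\<^sup>2) = r\<^sup>2 * 1" using rr(1) unfolding eqs by (simp add: power_mult_distrib distrib_left)
  then have 1: "c\<^sup>2 + s\<^sup>2 = 1" using pos by simp
  have "r'\<^sup>2 * (c'\<^sup>2 + s'\<^sup>2) = r'\<^sup>2 * 1" using rr(2) unfolding eqs by (simp add: power_mult_distrib distrib_left)
  then have 2: "c'\<^sup>2 + s'\<^sup>2 = 1" using pos by simp
  have s: "h \<le> s" "h \<le> s'" "s \<le> 1/2" "s' \<le> 1/2" "\<bar>s - s'\<bar> \<le> d" using h d by (auto simp: s_s'_def r_r'_def)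
  have "c \<ge> 1 / 2"
  proof (rule power2_le_imp_le)
    have "s\<^sup>2 \<le> (1/2)\<^sup>2" using s h(1) by (intro power_mono) auto
    then show "(1 / 2)\<^sup>2 \<le> c\<^sup>2" using 1 by (simp add: power2_eq_square)
  qed (use cpos in simp)
  moreover have "c' \<ge> 1 / 2"
  proof (rule power2_le_imp_le)
    have "s'\<^sup>2 \<le> (1/2)\<^sup>2" using s h(1) by (intro power_mono) auto
    then show "(1 / 2)\<^sup>2 \<le> c'\<^sup>2" using 2 by (simp add: power2_eq_square)
  qed (use cpos in simp)
  ultimately have cc: "c + c' \<ge> 1" by simp
  have "(c - c') * (c + c') = - ((s - s') * (s + s'))"
    using 1 2 by (simp add: power2_eq_square algebra_simps)
  then have "\<bar>(c - c') * (c + c')\<bar> = \<bar>(s - s') * (s + s')\<bar>"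
    by (simp only: abs_minus_cancel)
  moreover have "\<bar>c + c'\<bar> = c + c'" "\<bar>s + s'\<bar> = s + s'" using cpos s h(1) by auto
  ultimately have "\<bar>c - c'\<bar> * (c + c') = \<bar>s - s'\<bar> * (s + s')"
    by (simp only: abs_mult)
  moreover have "\<bar>c - c'\<bar> * 1 \<le> \<bar>c - c'\<bar> * (c + c')" using cc by (intro mult_left_mono) auto
  moreover have "\<bar>s - s'\<bar> * (s + s') \<le> \<bar>s - s'\<bar> * 1" using s by (intro mult_left_mono) auto
  ultimately have cd: "\<bar>c - c'\<bar> \<le> d" using s by simp
  have "(cmod (z - w))\<^sup>2 = (r * c - r' * c')\<^sup>2 + (r * s - r' * s')\<^sup>2"
    by (simp add: cmod_power2 eqs)
  also have "\<dots> = r\<^sup>2 * (c\<^sup>2 + s\<^sup>2) + r'\<^sup>2 * (c'\<^sup>2 + s'\<^sup>2) - 2 * (r * r') * (c * c' + s * s')"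
    by (simp add: power2_eq_square algebra_simps)
  also have "2 * (c * c' + s * s') = (c\<^sup>2 + s\<^sup>2) + (c'\<^sup>2 + s'\<^sup>2) - (c - c')\<^sup>2 - (s - s')\<^sup>2"
    by (simp add: power2_eq_square algebra_simps)
  then have "2 * (r * r') * (c * c' + s * s') = (r * r') * (2 - (c - c')\<^sup>2 - (s - s')\<^sup>2)"
    unfolding 1 2 by (metis (no_types, opaque_lifting) mult.assoc mult.commute one_add_one)
  also have "r\<^sup>2 * (c\<^sup>2 + s\<^sup>2) + r'\<^sup>2 * (c'\<^sup>2 + s'\<^sup>2) - (r * r') * (2 - (c - c')\<^sup>2 - (s - s')\<^sup>2)
      = (r - r')\<^sup>2 + (r * r') * ((c - c')\<^sup>2 + (s - s')\<^sup>2)"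
    unfolding 1 2 by (simp add: power2_eq_square algebra_simps)
  finally have N: "(cmod (z - w))\<^sup>2 = (r - r')\<^sup>2 + (r * r') * ((c - c')\<^sup>2 + (s - s')\<^sup>2)" .
  have d0: "d \<ge> 0" using d(1) by linarith
  have sq: "(r - r')\<^sup>2 \<le> d\<^sup>2" "(c - c')\<^sup>2 \<le> d\<^sup>2" "(s - s')\<^sup>2 \<le> d\<^sup>2"
    using d(1) cd s(5) d0 by (auto simp: r_r'_def abs_le_square_iff[symmetric])
  have rr1: "1 \<le> r * r'" using pos mult_mono[of 1 r 1 r'] by simp
  have "(r - r')\<^sup>2 \<le> (r * r') * d\<^sup>2"
    using sq(1) mult_right_mono[OF rr1, of "d\<^sup>2"] by simp
  moreover have "(r * r') * ((c - c')\<^sup>2 + (s - s')\<^sup>2) \<le> (r * r') * (d\<^sup>2 + d\<^sup>2)"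
    using sq rr1 by (intro mult_left_mono add_mono) auto
  ultimately have "(cmod (z - w))\<^sup>2 \<le> (r * r') * (3 * d\<^sup>2)" unfolding N by (simp add: algebra_simps)
  then have "(cmod (z - w))\<^sup>2 / (2 * Im z * Im w) \<le> (r * r') * (3 * d\<^sup>2) / (2 * Im z * Im w)"
    using z w by (intro divide_right_mono) auto
  also have "\<dots> = 3 * d\<^sup>2 / (2 * (s * s'))"
    unfolding eqs using pos s h(1) by (simp add: field_simps)
  also have "\<dots> \<le> 3 * d\<^sup>2 / (2 * h\<^sup>2)"
    using s h(1) by (intro divide_left_mono) (auto simp: power2_eq_square intro: mult_mono)
  finally show ?thesis by (simp add: chd_def)
qed

text \<open>At scaled heights between 2^(-k-1) and 2^(-k) the annulus is cut into boxes of side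
  2^(-k) / N in the scaled modulus and height; by separation each box holds at most one point. The
  number of boxes grows like 2^k and a weight is at most 2^(-k \<sigma>), so for \<sigma> > 1 there
  remains a geometric series with ratio 2^(1 - \<sigma>), starting at k0.\<close>

lemma packing_sum:
  fixes \<sigma> r :: real
  assumes \<sigma>: "\<sigma> > 1" and r: "r > 0"
  obtains C where "0 \<le> C" "\<And>k0 l P. 0 < l \<Longrightarrow> l \<le> 1 / 2 \<Longrightarrow> finite P \<Longrightarrow>
      \<forall>z\<in>P. Re z > 0 \<and> Im z > 0 \<and> 1 \<le> cmod z \<and> cmod z < exp l \<and> Im z / cmod z / l \<le> (1 / 2) ^ k0 \<Longrightarrow>
      \<forall>z\<in>P. \<forall>z'\<in>P. z \<noteq> z' \<longrightarrow> 1 + r \<le> chd z z' \<Longrightarrow>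
      (\<Sum>z\<in>P. (Im z / cmod z / l) powr \<sigma>) \<le> C * (2 powr (1 - \<sigma>)) ^ k0"
proof -
  \<comment> \<open>Two points of one box satisfy chd \<le> 1 + 6 / N^2 by \<open>chd_close\<close>;
    N > 1 and N > 6 / r make 6 / N^2 smaller than r.\<close>
  obtain N :: nat where N: "real N > 6 / r + 1" using reals_Archimedean2 by blast
  have N1: "real N > 1" "real N > 6 / r"
  proof -
    have "6 / r > 0" using r by simp
    then show "real N > 1" "real N > 6 / r" using N by linarith+
  qed
  define x where "x = 2 powr (1 - \<sigma>)"
  have x: "0 < x" "x < 1" using \<sigma> by (auto simp: x_def powr_less_one)
  define C where "C = real (2 * N) * real (Suc N) / (1 - x)"
  show ?thesis
  proof (rule that[of C])
    show "0 \<le> C" using x by (simp add: C_def)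
    fix k0 :: nat and l :: real and P :: "complex set"
    assume l: "0 < l" "l \<le> 1 / 2" and P: "finite P"
      and "\<forall>z\<in>P. Re z > 0 \<and> Im z > 0 \<and> 1 \<le> cmod z \<and> cmod z < exp l \<and> Im z / cmod z / l \<le> (1 / 2) ^ k0"
      and "\<forall>z\<in>P. \<forall>z'\<in>P. z \<noteq> z' \<longrightarrow> 1 + r \<le> chd z z'"
    then have Pz: "\<And>z. z \<in> P \<Longrightarrow> Re z > 0 \<and> Im z > 0 \<and> 1 \<le> cmod z \<and> cmod z < exp l \<and> Im z / cmod z / l \<le> (1 / 2) ^ k0"
      and sep: "\<And>z z'. z \<in> P \<Longrightarrow> z' \<in> P \<Longrightarrow> z \<noteq> z' \<Longrightarrow> 1 + r \<le> chd z z'"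
      by blast+
    define \<eta> where "\<eta> = (\<lambda>z. Im z / cmod z / l)"
    define \<rho> where "\<rho> = (\<lambda>z. (cmod z - 1) / l)"
    have \<eta>0: "0 < \<eta> z" "\<eta> z \<le> (1 / 2) ^ k0" if "z \<in> P" for z
    proof -
      have "0 < Im z" "0 < cmod z" using Pz[OF that] by (auto intro: less_le_trans[of 0 1])
      then show "0 < \<eta> z" using l unfolding \<eta>_def by (intro divide_pos_pos)
    qed (use Pz[OF that] in \<open>simp add: \<eta>_def\<close>)
    have "\<forall>z. \<exists>k. z \<in> P \<longrightarrow> k0 \<le> k \<and> (1 / 2) ^ Suc k < \<eta> z \<and> \<eta> z \<le> (1 / 2) ^ k"
    proof
      fix z
      show "\<exists>k. z \<in> P \<longrightarrow> k0 \<le> k \<and> (1 / 2) ^ Suc k < \<eta> z \<and> \<eta> z \<le> (1 / 2) ^ k"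
      proof (cases "z \<in> P")
        case True
        show ?thesis by (rule dyadic_scale[OF \<eta>0[OF True]]) blast
      qed simp
    qed
    then obtain \<kappa> where \<kappa>: "\<And>z. z \<in> P \<Longrightarrow> k0 \<le> \<kappa> z" "\<And>z. z \<in> P \<Longrightarrow> (1 / 2) ^ Suc (\<kappa> z) < \<eta> z"
      "\<And>z. z \<in> P \<Longrightarrow> \<eta> z \<le> (1 / 2) ^ \<kappa> z" by metis
    define j where "j = (\<lambda>z. nat \<lfloor>\<rho> z * (2 ^ \<kappa> z * real N)\<rfloor>)"
    define m where "m = (\<lambda>z. nat \<lfloor>\<eta> z * (2 ^ \<kappa> z * real N)\<rfloor>)"
    define cell where "cell = (\<lambda>z. (\<kappa> z, j z, m z))"
    \<comment> \<open>For l \<le> 1 / 2 one has exp l - 1 \<le> l + l^2 \<le> 2 l, so the annulus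
      has scaled width at most 2.\<close>
    have \<rho>: "0 \<le> \<rho> z" "\<rho> z < 2" if "z \<in> P" for z
    proof -
      have "exp l \<le> 1 + l + l\<^sup>2" using l by (intro exp_bound) auto
      moreover have "l\<^sup>2 \<le> l" using l by (simp add: power2_eq_square)
      ultimately have "cmod z - 1 < 2 * l" "cmod z \<ge> 1" using Pz[OF that] by auto
      then show "0 \<le> \<rho> z" "\<rho> z < 2" using l by (auto simp: \<rho>_def pos_divide_less_eq)
    qed
    have inj: "inj_on cell P"
    proof (rule inj_onI)
      fix z w assume zw: "z \<in> P" "w \<in> P" and eq: "cell z = cell w"
      define c where "c = 2 ^ \<kappa> z * real N"
      have c: "c > 0" using N1 by (simp add: c_def)
      have \<kappa>w: "\<kappa> w = \<kappa> z" using eq by (simp add: cell_def)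
      have "\<lfloor>\<rho> z * c\<rfloor> = \<lfloor>\<rho> w * c\<rfloor>" "\<lfloor>\<eta> z * c\<rfloor> = \<lfloor>\<eta> w * c\<rfloor>"
        using eq \<rho>[OF zw(1)] \<rho>[OF zw(2)] \<eta>0[OF zw(1)] \<eta>0[OF zw(2)] c
        by (auto simp: cell_def j_def m_def c_def \<kappa>w eq_nat_nat_iff)
      then have cl: "\<bar>\<rho> z - \<rho> w\<bar> < 1 / c" "\<bar>\<eta> z - \<eta> w\<bar> < 1 / c" using floor_eq_imp_close[OF c] by auto
      define h where "h = l * (1 / 2) ^ Suc (\<kappa> z)"
      define d where "d = l / c"
      have h0: "h > 0" using l by (simp add: h_def)
      have \<eta>l: "Im u / cmod u = l * \<eta> u" for u using l by (simp add: \<eta>_def)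
      have half: "l * \<eta> u \<le> 1 / 2" if "u \<in> P" for u
      proof -
        have "\<eta> u \<le> 1" using \<eta>0[OF that] power_le_one[of "1/2::real" k0] by simp
        then have "l * \<eta> u \<le> (1/2) * 1" using l \<eta>0[OF that] by (intro mult_mono) auto
        then show ?thesis by simp
      qed
      have "chd z w \<le> 1 + 3 * d\<^sup>2 / (2 * h\<^sup>2)"
      proof (rule chd_close)
        have "\<bar>cmod z - cmod w\<bar> = l * \<bar>\<rho> z - \<rho> w\<bar>"
          using l by (simp add: \<rho>_def abs_divide diff_divide_distrib[symmetric])
        also have "\<dots> \<le> l * (1 / c)" using cl l by (intro mult_left_mono) auto
        finally show "\<bar>cmod z - cmod w\<bar> \<le> d" by (simp add: d_def)
        have "\<bar>l * \<eta> z - l * \<eta> w\<bar> = l * \<bar>\<eta> z - \<eta> w\<bar>"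
          using l by (simp add: abs_mult right_diff_distrib[symmetric])
        also have "\<dots> \<le> l * (1 / c)" using cl l by (intro mult_left_mono) auto
        finally show "\<bar>Im z / cmod z - Im w / cmod w\<bar> \<le> d" unfolding \<eta>l by (simp add: d_def)
        show "h \<le> Im z / cmod z" unfolding \<eta>l h_def using \<kappa>(2)[OF zw(1)] l by (intro mult_left_mono) auto
        show "h \<le> Im w / cmod w" unfolding \<eta>l h_def using \<kappa>(2)[OF zw(2)] l \<kappa>w by (intro mult_left_mono) auto
        show "Im z / cmod z \<le> 1 / 2" "Im w / cmod w \<le> 1 / 2" unfolding \<eta>l using half zw by auto
      qed (use Pz[OF zw(1)] Pz[OF zw(2)] h0 in auto)
      also have "3 * d\<^sup>2 / (2 * h\<^sup>2) = 6 / (real N)\<^sup>2"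
      proof -
        have "d / h = 2 / real N"
          using l N1 by (simp add: d_def h_def c_def power_one_over field_simps)
        then have "d\<^sup>2 / h\<^sup>2 = 4 / (real N)\<^sup>2" by (metis power_divide power2_eq_square num_double numeral_times_numeral semiring_norm(13))
        then show ?thesis by simp
      qed
      also have "6 / (real N)\<^sup>2 < r"
      proof -
        have "6 / r < (real N)\<^sup>2"
            unfolding power2_eq_square using N1 mult_left_mono[of 1 "real N" "real N"] by linarith
        then show ?thesis using r N1 by (simp add: pos_divide_less_eq mult.commute)
      qed
      finally have "chd z w < 1 + r" by simp
      then show "z = w" using sep[OF zw] by force
    qed
    define M where "M = Max (insert k0 (\<kappa> ` P))"
    define I where "I = (SIGMA k:{k0..M}. {..<2 * 2 ^ k * N} \<times> {..N})"
    define wt where "wt = (\<lambda>q::nat \<times> nat \<times> nat. ((1 / 2) ^ fst q :: real) powr \<sigma>)"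
    have sub: "cell ` P \<subseteq> I"
    proof
      fix q assume "q \<in> cell ` P"
      then obtain z where z: "z \<in> P" "q = cell z" by auto
      have "\<kappa> z \<le> M" using P z by (simp add: M_def)
      moreover have "j z < 2 * 2 ^ \<kappa> z * N"
      proof -
        have "\<rho> z * (2 ^ \<kappa> z * real N) < 2 * (2 ^ \<kappa> z * real N)"
          using \<rho>[OF z(1)] N1 by (intro mult_strict_right_mono) auto
        then have "\<rho> z * (2 ^ \<kappa> z * real N) < real (2 * 2 ^ \<kappa> z * N)" by simp
        then show ?thesis unfolding j_def using N1 by (simp add: nat_less_iff floor_less_iff \<rho>(1)[OF z(1)])
      qed
      moreover have "m z \<le> N"
      proof -
        have "\<eta> z * (2 ^ \<kappa> z * real N) \<le> (1 / 2) ^ \<kappa> z * (2 ^ \<kappa> z * real N)"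
          using \<kappa>(3)[OF z(1)] N1 by (intro mult_right_mono) auto
        also have "\<dots> = real N" by (simp add: power_one_over)
        finally show ?thesis unfolding m_def by linarith
      qed
      ultimately show "q \<in> I" using \<kappa>(1)[OF z(1)] by (simp add: I_def z(2) cell_def)
    qed
    have "(\<Sum>z\<in>P. \<eta> z powr \<sigma>) \<le> (\<Sum>z\<in>P. wt (cell z))"
    proof (rule sum_mono)
      fix z assume "z \<in> P"
      then show "\<eta> z powr \<sigma> \<le> wt (cell z)"
        using \<eta>0[of z] \<kappa>(3)[of z] \<sigma> unfolding wt_def cell_def by (intro powr_mono2) auto
    qed
    also have "\<dots> = sum wt (cell ` P)" using inj by (simp add: sum.reindex)
    also have "\<dots> \<le> sum wt I"
      by (rule sum_mono2[OF _ sub]) (auto simp: I_def wt_def)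
    also have "\<dots> = (\<Sum>k\<in>{k0..M}. \<Sum>q\<in>{..<2 * 2 ^ k * N} \<times> {..N}. ((1 / 2) ^ k :: real) powr \<sigma>)"
      unfolding I_def wt_def by (subst sum.Sigma) (auto simp: case_prod_unfold)
    also have "\<dots> = (\<Sum>k\<in>{k0..M}. real (2 * N) * real (Suc N) * x ^ k)"
    proof (rule sum.cong[OF refl])
      fix k
      have "x ^ k = 2 powr ((1 - \<sigma>) * real k)"
        unfolding x_def by (metis powr_powr powr_realpow powr_gt_zero zero_less_numeral)
      also have "\<dots> = 2 powr real k * 2 powr (- real k * \<sigma>)"
        by (simp add: powr_add[symmetric] algebra_simps)
      also have "2 powr real k = 2 ^ k" by (simp add: powr_realpow)
      also have "2 powr (- real k * \<sigma>) = (2 powr (- real k)) powr \<sigma>" by (simp add: powr_powr)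
      also have "2 powr (- real k) = (1 / 2) ^ k" by (simp add: powr_minus powr_realpow power_one_over field_simps)
      finally have "x ^ k = 2 ^ k * ((1 / 2) ^ k :: real) powr \<sigma>" .
      then show "(\<Sum>q\<in>{..<2 * 2 ^ k * N} \<times> {..N}. ((1 / 2) ^ k :: real) powr \<sigma>) = real (2 * N) * real (Suc N) * x ^ k"
        by (simp add: card_cartesian_product algebra_simps)
    qed
    also have "\<dots> = real (2 * N) * real (Suc N) * (\<Sum>k\<in>{k0..M}. x ^ k)" by (simp add: sum_distrib_left)
    also have "\<dots> \<le> real (2 * N) * real (Suc N) * (x ^ k0 / (1 - x))"
    proof (rule mult_left_mono)
      have "(\<Sum>k\<in>{k0..M}. x ^ k) \<le> x ^ k0 * (1 / (1 - x))"
      proof -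
        have kM: "k0 \<le> M" using P by (simp add: M_def)
        have "(1 - x) * (\<Sum>k\<in>{k0..M}. x ^ k) = x ^ k0 - x ^ Suc M"
          using sum_gp_multiplied[OF kM] by blast
        also have "\<dots> \<le> x ^ k0" using x by simp
        finally show ?thesis using x by (simp add: field_simps)
      qed
      then show "(\<Sum>k\<in>{k0..M}. x ^ k) \<le> x ^ k0 / (1 - x)" by simp
    qed simp
    also have "\<dots> = C * x ^ k0" by (simp add: C_def)
    finally show "(\<Sum>z\<in>P. (Im z / cmod z / l) powr \<sigma>) \<le> C * (2 powr (1 - \<sigma>)) ^ k0"
      unfolding \<eta>_def x_def .
  qed
qed

section \<open>Discrete groups and sums over cosets\<close>

lemma BijGroup_mult: "f \<in> Bij S \<Longrightarrow> g \<in> Bij S \<Longrightarrow> f \<otimes>\<^bsub>BijGroup S\<^esub> g = compose S f g"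
  by (simp add: BijGroup_def)

lemma BijGroup_one: "\<one>\<^bsub>BijGroup S\<^esub> = (\<lambda>x\<in>S. x)"
  by (simp add: BijGroup_def)

lemma BijGroup_carrier: "carrier (BijGroup S) = Bij S"
  by (simp add: BijGroup_def)

text \<open>One induction for both cyclic groups, the dilations by multiples of l and the integral
  translations.\<close>

lemma generate_cyclic:
  fixes t :: "int \<Rightarrow> 'a \<Rightarrow> 'a"
  assumes Bij: "\<And>n. t n \<in> Bij S" and zero: "t 0 = (\<lambda>x\<in>S. x)"
    and add: "\<And>m n. compose S (t m) (t n) = t (m + n)"
  shows "generate (BijGroup S) {t 1} = range t"
proof -
  interpret group "BijGroup S" by (rule group_BijGroup)
  have car: "t n \<in> carrier (BijGroup S)" for n using Bij by (simp add: BijGroup_carrier)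
  have mult: "t m \<otimes>\<^bsub>BijGroup S\<^esub> t n = t (m + n)" for m n
    using Bij by (simp add: BijGroup_mult add)
  have one: "\<one>\<^bsub>BijGroup S\<^esub> = t 0" by (simp add: BijGroup_one zero)
  have inv1: "inv\<^bsub>BijGroup S\<^esub> t 1 = t (-1)"
    by (rule inv_equality) (use car in \<open>auto simp: mult one\<close>)
  show ?thesis
  proof
    show "generate (BijGroup S) {t 1} \<subseteq> range t"
    proof
      fix x assume "x \<in> generate (BijGroup S) {t 1}"
      then show "x \<in> range t"
        by (induction rule: generate.induct) (auto simp: one inv1 mult)
    qed
    have "t n \<in> generate (BijGroup S) {t 1}" for n
    proof (induction n rule: int_induct[where k = 0])
      case base
      show ?case using generate.one[of "BijGroup S"] by (simp add: one)
    next
      case (step1 i)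
      have "t i \<otimes>\<^bsub>BijGroup S\<^esub> t 1 \<in> generate (BijGroup S) {t 1}"
        by (rule generate.eng[OF step1(2) generate.incl]) simp
      then show ?case by (simp add: mult)
    next
      case (step2 i)
      have "t i \<otimes>\<^bsub>BijGroup S\<^esub> inv\<^bsub>BijGroup S\<^esub> t 1 \<in> generate (BijGroup S) {t 1}"
        by (rule generate.eng[OF step2(2) generate.inv]) simp
      then show ?case by (simp add: inv1 mult)
    qed
    then show "range t \<subseteq> generate (BijGroup S) {t 1}" by auto
  qed
qed

definition translate :: "int \<Rightarrow> complex \<Rightarrow> complex" where
  "translate n = (\<lambda>z\<in>hplane. z + of_int n)"

lemma dilation_Bij: "dilation l \<in> Bij hplane"
proof -
  have "bij_betw (dilation l) hplane hplane"
    by (rule bij_betw_byWitness[where f' = "\<lambda>z. of_real (exp (- l)) * z"])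
      (auto simp: dilation_def hplane_Im exp_minus)
  then show ?thesis by (simp add: Bij_def dilation_def)
qed

lemma dilation_compose: "compose hplane (dilation a) (dilation b) = dilation (a + b)"
  by (auto simp: compose_def dilation_def hplane_Im exp_add fun_eq_iff restrict_def)

lemma translate_Bij: "translate n \<in> Bij hplane"
proof -
  have "bij_betw (translate n) hplane hplane"
    by (rule bij_betw_byWitness[where f' = "\<lambda>z. z - of_int n"])
      (auto simp: translate_def hplane_Im)
  then show ?thesis by (simp add: Bij_def translate_def)
qed

lemma translate_compose: "compose hplane (translate m) (translate n) = translate (m + n)"
  by (auto simp: compose_def translate_def hplane_Im fun_eq_iff restrict_def)

lemma group_generated_by_dilation: "group_generated_by (dilation l) = (\<lambda>n. dilation (of_int n * l)) ` UNIV"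
proof -
  have "generate (BijGroup hplane) {dilation (of_int 1 * l)} = range (\<lambda>n. dilation (of_int n * l))"
    by (rule generate_cyclic) (auto simp: dilation_Bij dilation_compose distrib_right, simp add: dilation_def restrict_def)
  then show ?thesis by (simp add: group_generated_by_def)
qed

lemma group_generated_by_translation: "group_generated_by translation = range translate"
proof -
  have "generate (BijGroup hplane) {translate 1} = range translate"
    by (rule generate_cyclic) (auto simp: translate_Bij translate_compose, simp add: translate_def restrict_def)
  moreover have "translate 1 = translation" by (simp add: translate_def translation_def)
  ultimately show ?thesis by (simp add: group_generated_by_def)
qed

text \<open>Discreteness enters as finiteness of the orbit of \<i> in balls; as the elements are
  isometries, this bounds the returns to any ball (\<open>finite_return\<close>).\<close>

locale discrete_group =
  fixes \<Gamma> :: "(complex \<Rightarrow> complex) set"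
  assumes PSL: "\<Gamma> \<subseteq> PSL2R"
    and subgroup: "subgroup \<Gamma> (BijGroup hplane)"
    and free: "A \<in> \<Gamma> \<Longrightarrow> z \<in> hplane \<Longrightarrow> A z = z \<Longrightarrow> A = (\<lambda>z\<in>hplane. z)"
    and finite_orbit: "finite {A \<in> \<Gamma>. hdist \<i> (A \<i>) \<le> R}"
begin

lemma Bij: "A \<in> \<Gamma> \<Longrightarrow> A \<in> Bij hplane"
  using subgroup.mem_carrier[OF subgroup] by (simp add: BijGroup_carrier)

lemma hplane_closed: "A \<in> \<Gamma> \<Longrightarrow> z \<in> hplane \<Longrightarrow> A z \<in> hplane"
  using PSL PSL2R_hplane by blast

lemma isometry: "A \<in> \<Gamma> \<Longrightarrow> z \<in> hplane \<Longrightarrow> w \<in> hplane \<Longrightarrow> hdist (A z) (A w) = hdist z w"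
  using PSL PSL2R_hdist by blast

lemma compose_closed: "A \<in> \<Gamma> \<Longrightarrow> B \<in> \<Gamma> \<Longrightarrow> compose hplane A B \<in> \<Gamma>"
  using subgroup.m_closed[OF subgroup] BijGroup_mult Bij by metis

lemma inverse_exists:
  assumes "A \<in> \<Gamma>"
  obtains B where "B \<in> \<Gamma>" "\<And>z. z \<in> hplane \<Longrightarrow> B (A z) = z" "\<And>z. z \<in> hplane \<Longrightarrow> A (B z) = z"
proof -
  interpret group "BijGroup hplane" by (rule group_BijGroup)
  define B where "B = inv\<^bsub>BijGroup hplane\<^esub> A"
  have B: "B \<in> \<Gamma>" unfolding B_def using subgroup.m_inv_closed[OF subgroup assms] .
  have car: "A \<in> carrier (BijGroup hplane)" using Bij[OF assms] by (simp add: BijGroup_carrier)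
  have "compose hplane B A = (\<lambda>z\<in>hplane. z)" "compose hplane A B = (\<lambda>z\<in>hplane. z)"
    using l_inv[OF car] r_inv[OF car] Bij[OF assms] Bij[OF B]
    by (simp_all add: BijGroup_mult BijGroup_one B_def[symmetric])
  then have "B (A z) = z" "A (B z) = z" if "z \<in> hplane" for z
    using that by (metis compose_eq restrict_apply')+
  then show ?thesis using that B by blast
qed

lemma ext: "A \<in> \<Gamma> \<Longrightarrow> B \<in> \<Gamma> \<Longrightarrow> (\<And>z. z \<in> hplane \<Longrightarrow> A z = B z) \<Longrightarrow> A = B"
  using Bij extensionalityI[of A hplane B] by (auto simp: Bij_def)

text \<open>Freeness applied to the quotient of the two elements. This is how identities between
  group elements obtained from lifts are checked: at one point.\<close>

lemma eq_if_eq_at: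
  assumes A: "A \<in> \<Gamma>" and B: "B \<in> \<Gamma>" and z: "z \<in> hplane" and eq: "A z = B z"
  shows "A = B"
proof -
  obtain C where C: "C \<in> \<Gamma>" "\<And>z. z \<in> hplane \<Longrightarrow> C (A z) = z" "\<And>z. z \<in> hplane \<Longrightarrow> A (C z) = z"
    by (rule inverse_exists[OF A]) blast
  have "compose hplane C B z = z" using C(2)[OF z] z eq by (simp add: compose_eq)
  then have id: "compose hplane C B = (\<lambda>z\<in>hplane. z)"
    using free[OF compose_closed[OF C(1) B] z] by simp
  show ?thesis
  proof (rule ext[OF A B])
    fix x assume x: "x \<in> hplane"
    have "C (B x) = x" using fun_cong[OF id, of x] x by (simp add: compose_eq)
    then show "A x = B x" using C(3)[OF hplane_closed[OF B x]] by simp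
  qed
qed

lemma finite_return: "finite {A \<in> \<Gamma>. \<exists>w \<in> hball R. A w \<in> hball R'}"
proof (rule finite_subset[OF _ finite_orbit[of "R' + R"]], safe)
  fix A w assume A: "A \<in> \<Gamma>" and w: "w \<in> hball R" "A w \<in> hball R'"
  have H: "w \<in> hplane" using w by (simp add: hball_def)
  have "hdist \<i> (A \<i>) \<le> hdist \<i> (A w) + hdist (A w) (A \<i>)"
    using hplane_closed[OF A] H by (intro hdist_triangle) auto
  then show "hdist \<i> (A \<i>) \<le> R' + R"
    using w isometry[OF A H ii_hplane] by (auto simp: hball_def hdist_commute[of w])
qed

text \<open>An element taking no point of the ball of radius R into that of radius R + 1 moves these
  points by more than 1. The others are finitely many, and compactness and freeness give each a
  positive minimal displacement.\<close>

lemma separated: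
  obtains r where "r > 0" "\<And>w A. w \<in> hball R \<Longrightarrow> A \<in> \<Gamma> \<Longrightarrow> A \<noteq> (\<lambda>z\<in>hplane. z) \<Longrightarrow> r \<le> hdist w (A w)"
proof -
  define N where "N = {A \<in> \<Gamma>. \<exists>w \<in> hball R. A w \<in> hball (R + 1)} - {\<lambda>z\<in>hplane. z}"
  have finN: "finite N" unfolding N_def using finite_return by blast
  have "\<exists>r>0. \<forall>w \<in> hball R. r \<le> hdist w (A w)" if A: "A \<in> N" for A
  proof (cases "hball R = {}")
    case True
    then show ?thesis using zero_less_one by blast
  next
    case False
    have A\<Gamma>: "A \<in> \<Gamma>" and neq: "A \<noteq> (\<lambda>z\<in>hplane. z)" using A by (auto simp: N_def)
    have contA: "continuous_on (hball R) A"
      by (rule continuous_on_subset[OF PSL2R_continuous_on[OF subsetD[OF PSL A\<Gamma>]] hball_subset])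
    have "continuous_on (hball R) (\<lambda>w. chd w (A w))"
      using contA hplane_closed[OF A\<Gamma>] hball_subset by (intro continuous_intros) auto
    then have "\<exists>x\<in>hball R. \<forall>y\<in>hball R. chd x (A x) \<le> chd y (A y)"
      by (rule continuous_attains_inf[OF compact_hball False])
    then obtain x where x: "x \<in> hball R" "\<And>y. y \<in> hball R \<Longrightarrow> chd x (A x) \<le> chd y (A y)" by blast
    have H: "y \<in> hplane" "A y \<in> hplane" if "y \<in> hball R" for y
      using that hball_subset hplane_closed[OF A\<Gamma>] by auto
    have "x \<noteq> A x" using free[OF A\<Gamma> H(1)[OF x(1)]] neq by metis
    then have "hdist x (A x) > 0"
      using hdist_nonneg[OF H[OF x(1)]] hdist_eq_0_iff[OF H[OF x(1)]] by simp
    moreover have "hdist x (A x) \<le> hdist y (A y)" if "y \<in> hball R" for y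
      using x(2)[OF that] cosh_hdist[OF H[OF x(1)]] cosh_hdist[OF H[OF that]]
        hdist_nonneg[OF H[OF x(1)]] hdist_nonneg[OF H[OF that]] cosh_real_nonneg_le_iff by metis
    ultimately show ?thesis by blast
  qed
  then obtain \<rho> where \<rho>: "\<And>A. A \<in> N \<Longrightarrow> \<rho> A > 0" "\<And>A w. A \<in> N \<Longrightarrow> w \<in> hball R \<Longrightarrow> \<rho> A \<le> hdist w (A w)"
    by metis
  define r where "r = Min (insert 1 (\<rho> ` N))"
  show ?thesis
  proof (rule that[of r])
    show "r > 0" unfolding r_def using finN \<rho>(1) by simp
    fix w A assume w: "w \<in> hball R" and A: "A \<in> \<Gamma>" "A \<noteq> (\<lambda>z\<in>hplane. z)"
    show "r \<le> hdist w (A w)"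
    proof (cases "A \<in> N")
      case True
      have "r \<le> \<rho> A" unfolding r_def using finN True by (intro Min_le) auto
      then show ?thesis using \<rho>(2)[OF True w] by simp
    next
      case False
      have wH: "w \<in> hplane" "hdist \<i> w \<le> R" using w by (auto simp: hball_def)
      have "A w \<notin> hball (R + 1)" using False A w by (auto simp: N_def)
      then have "hdist \<i> (A w) > R + 1" using hplane_closed[OF A(1) wH(1)] by (auto simp: hball_def)
      then have "hdist w (A w) > 1"
        using hdist_triangle[OF ii_hplane wH(1) hplane_closed[OF A(1) wH(1)]] wH(2) by simp
      moreover have "r \<le> 1" unfolding r_def using finN by (intro Min_le) auto
      ultimately show ?thesis by simp
    qed
  qed
qed

lemma rcosets_eq:
  assumes "\<Delta> \<subseteq> \<Gamma>"
  shows "rcosets\<^bsub>(BijGroup hplane)\<lparr>carrier := \<Gamma>\<rparr>\<^esub> \<Delta> = (\<lambda>A. (\<lambda>D. compose hplane D A) ` \<Delta>) ` \<Gamma>"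
proof -
  have "\<Delta> #>\<^bsub>(BijGroup hplane)\<lparr>carrier := \<Gamma>\<rparr>\<^esub> A = (\<lambda>D. compose hplane D A) ` \<Delta>" if "A \<in> \<Gamma>" for A
    using that assms Bij by (auto simp: r_coset_def BijGroup_mult subset_iff image_def)
  then show ?thesis by (auto simp: RCOSETS_def)
qed

end

text \<open>Group elements are lifts of \<open>p\<close> through itself, so uniqueness of lifts
  gives freeness and the injectivity of A \<mapsto> A \<i>. Infinitely many orbit points in a ball
  would accumulate, against the local injectivity of \<open>p\<close>.\<close>

lemma uniformization_discrete_group:
  fixes atl :: "('m::{t2_space, second_countable_topology}) surface_chart set"
  assumes atl: "oriented_surface atl" and u: "uniformization atl S g \<Gamma> p"
  shows "discrete_group \<Gamma>"
proof -
  have PSL: "\<Gamma> \<subseteq> PSL2R" and sub: "subgroup \<Gamma> (BijGroup hplane)" and cov: "covering_space hplane p S"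
    and fib: "\<And>z w. z \<in> hplane \<Longrightarrow> w \<in> hplane \<Longrightarrow> p z = p w \<longleftrightarrow> (\<exists>\<gamma>\<in>\<Gamma>. w = \<gamma> z)"
    and iso: "local_isometry atl hplane hyp_metric S g p"
    using u by (auto simp: uniformization_def)
  have contp: "continuous_on hplane p" and pS: "p \<in> hplane \<rightarrow> S"
    using cov by (auto simp: covering_space_def)
  have mapsto: "A z \<in> hplane" if "A \<in> \<Gamma>" "z \<in> hplane" for A z
    using PSL2R_hplane PSL that by blast
  have ext: "A \<in> extensional hplane" if "A \<in> \<Gamma>" for A
    using subgroup.mem_carrier[OF sub that] by (simp add: BijGroup_carrier Bij_def)
  have free: "A = (\<lambda>z\<in>hplane. z)" if A: "A \<in> \<Gamma>" and z: "z \<in> hplane" "A z = z" for A z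
  proof -
    have "A x = x" if x: "x \<in> hplane" for x
    proof (rule covering_space_lift_unique[OF cov, where ?g1.0 = A and ?g2.0 = "\<lambda>x. x" and a = z and f = p and T = hplane])
      show "p x = p (A x)" if "x \<in> hplane" for x
        using fib[OF that mapsto[OF A that]] A by blast
      show "continuous_on hplane A" by (rule PSL2R_continuous_on[OF subsetD[OF PSL A]])
    qed (use z x contp pS mapsto[OF A] connected_hplane in auto)
    then show ?thesis using ext[OF A] by (auto simp: extensional_def fun_eq_iff)
  qed
  have inj_orbit: "inj_on (\<lambda>A. A \<i>) \<Gamma>"
  proof (rule inj_onI)
    fix A B assume A: "A \<in> \<Gamma>" and B: "B \<in> \<Gamma>" and eq: "A \<i> = B \<i>"
    have "A x = B x" if x: "x \<in> hplane" for x
    proof (rule covering_space_lift_unique[OF cov, where ?g1.0 = A and ?g2.0 = B and a = \<i> and f = p and T = hplane])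
      show "p x = p (A x)" "p x = p (B x)" if "x \<in> hplane" for x
        using fib[OF that mapsto[OF A that]] fib[OF that mapsto[OF B that]] A B by blast+
      show "continuous_on hplane A" "continuous_on hplane B"
        by (rule PSL2R_continuous_on[OF subsetD[OF PSL A]], rule PSL2R_continuous_on[OF subsetD[OF PSL B]])
    qed (use x contp pS mapsto[OF A] mapsto[OF B] connected_hplane eq in auto)
    then show "A = B" using extensionalityI[OF ext[OF A] ext[OF B]] by blast
  qed
  have fin: "finite {A \<in> \<Gamma>. hdist \<i> (A \<i>) \<le> R}" for R
  proof (rule ccontr)
    define I where "I = {A \<in> \<Gamma>. hdist \<i> (A \<i>) \<le> R}"
    assume "infinite {A \<in> \<Gamma>. hdist \<i> (A \<i>) \<le> R}"
    then have "infinite I" by (simp add: I_def)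
    moreover have "inj_on (\<lambda>A. A \<i>) I" using inj_orbit by (rule inj_on_subset) (auto simp: I_def)
    ultimately have "infinite ((\<lambda>A. A \<i>) ` I)" using finite_imageD by blast
    moreover have "(\<lambda>A. A \<i>) ` I \<subseteq> hball R" using mapsto by (auto simp: I_def hball_def)
    ultimately obtain x where x: "x \<in> hball R" "x islimpt ((\<lambda>A. A \<i>) ` I)"
      using compact_hball[of R] unfolding compact_eq_Bolzano_Weierstrass by blast
    have xH: "x \<in> hplane" using x(1) by (simp add: hball_def)
    obtain V where V: "open V" "x \<in> V" "V \<subseteq> hplane" "inj_on p V"
      by (rule local_isometries_transition[OF atl iso subset_refl xH iso subset_refl xH refl])
        (rule that; assumption)
    have "infinite ((\<lambda>A. A \<i>) ` I \<inter> V)" using x(2) V(1,2) unfolding islimpt_eq_acc_point by (metis Int_commute)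
    then have "\<not> ((\<lambda>A. A \<i>) ` I \<inter> V \<subseteq> {y})" for y using finite_subset by blast
    then obtain a b where ab: "a \<in> (\<lambda>A. A \<i>) ` I \<inter> V" "b \<in> (\<lambda>A. A \<i>) ` I \<inter> V" "a \<noteq> b" by blast
    then obtain A B where AB: "A \<in> \<Gamma>" "a = A \<i>" "B \<in> \<Gamma>" "b = B \<i>" by (auto simp: I_def)
    have "p \<i> = p a" using fib[OF ii_hplane mapsto[OF AB(1) ii_hplane]] AB by blast
    moreover have "p \<i> = p b" using fib[OF ii_hplane mapsto[OF AB(3) ii_hplane]] AB by blast
    ultimately show False using V(4) ab by (auto dest: inj_onD)
  qed
  show ?thesis by (rule discrete_group.intro[OF PSL sub free fin])
qed

text \<open>The isomorphism takes cosets to cosets, but the representatives chosen on the two sides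
  are unrelated; the invariance of the form under \<Delta>1 reconciles them.\<close>

lemma coset_sum_transfer:
  assumes G1: "discrete_group \<Gamma>1" and G2: "discrete_group \<Gamma>2"
    and \<phi>: "bij_betw \<phi> \<Gamma>1 \<Gamma>2"
    and hom: "\<And>A B. A \<in> \<Gamma>1 \<Longrightarrow> B \<in> \<Gamma>1 \<Longrightarrow> \<phi> (compose hplane A B) = compose hplane (\<phi> A) (\<phi> B)"
    and \<Delta>: "\<Delta>1 \<subseteq> \<Gamma>1" "\<phi> ` \<Delta>1 = \<Delta>2" "(\<lambda>z\<in>hplane. z) \<in> \<Delta>1"
    and inv: "\<And>D A. D \<in> \<Delta>1 \<Longrightarrow> A \<in> \<Gamma>1 \<Longrightarrow> pull_back (compose hplane D A) \<omega> z v = pull_back A \<omega> z v"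
  shows "coset_sum \<Delta>1 \<Gamma>1 \<omega> z v =
    (\<Sum>\<^sub>\<infinity> X \<in> rcosets\<^bsub>(BijGroup hplane)\<lparr>carrier := \<Gamma>2\<rparr>\<^esub> \<Delta>2. pull_back (inv_into \<Gamma>1 \<phi> (SOME A. A \<in> X)) \<omega> z v)"
proof -
  interpret G1: discrete_group \<Gamma>1 by (rule G1)
  interpret G2: discrete_group \<Gamma>2 by (rule G2)
  define R1 where "R1 = rcosets\<^bsub>(BijGroup hplane)\<lparr>carrier := \<Gamma>1\<rparr>\<^esub> \<Delta>1"
  define R2 where "R2 = rcosets\<^bsub>(BijGroup hplane)\<lparr>carrier := \<Gamma>2\<rparr>\<^esub> \<Delta>2"
  have inj: "inj_on \<phi> \<Gamma>1" and surj: "\<phi> ` \<Gamma>1 = \<Gamma>2" using \<phi> by (auto simp: bij_betw_def)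
  have \<Delta>2: "\<Delta>2 \<subseteq> \<Gamma>2" using \<Delta>(1,2) surj by blast
  have R1: "R1 = (\<lambda>A. (\<lambda>D. compose hplane D A) ` \<Delta>1) ` \<Gamma>1" unfolding R1_def by (rule G1.rcosets_eq[OF \<Delta>(1)])
  have R2: "R2 = (\<lambda>A. (\<lambda>D. compose hplane D A) ` \<Delta>2) ` \<Gamma>2" unfolding R2_def by (rule G2.rcosets_eq[OF \<Delta>2])
  have img: "\<phi> ` (\<lambda>D. compose hplane D A) ` \<Delta>1 = (\<lambda>D. compose hplane D (\<phi> A)) ` \<Delta>2" if "A \<in> \<Gamma>1" for A
  proof -
    have "\<phi> ` (\<lambda>D. compose hplane D A) ` \<Delta>1 = (\<lambda>D. compose hplane (\<phi> D) (\<phi> A)) ` \<Delta>1"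
      unfolding image_image using hom that \<Delta>(1) by (intro image_cong) auto
    also have "\<dots> = (\<lambda>D. compose hplane D (\<phi> A)) ` \<Delta>2" using \<Delta>(2) by (auto simp: image_image)
    finally show ?thesis .
  qed
  have R1_sub: "X \<subseteq> \<Gamma>1" if "X \<in> R1" for X
    using that G1.compose_closed \<Delta>(1) unfolding R1 by auto
  have R1_nonempty: "X \<noteq> {}" if "X \<in> R1" for X using that \<Delta>(3) unfolding R1 by auto
  have bij: "bij_betw (\<lambda>X. \<phi> ` X) R1 R2"
  proof (rule bij_betw_imageI)
    show "inj_on ((`) \<phi>) R1"
      using inj R1_sub by (intro inj_onI) (meson inj_on_image_eq_iff)
    show "(`) \<phi> ` R1 = R2"
    proof -
      have "(`) \<phi> ` R1 = (\<lambda>A. (\<lambda>D. compose hplane D (\<phi> A)) ` \<Delta>2) ` \<Gamma>1"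
        unfolding R1 image_image[of "(`) \<phi>"] by (intro image_cong refl img)
      also have "\<dots> = R2" unfolding R2 surj[symmetric] by (simp add: image_image)
      finally show ?thesis .
    qed
  qed
  have "coset_sum \<Delta>1 \<Gamma>1 \<omega> z v = (\<Sum>\<^sub>\<infinity> X \<in> R1. pull_back (SOME \<gamma>. \<gamma> \<in> X) \<omega> z v)"
    unfolding coset_sum_def R1_def ..
  also have "\<dots> = (\<Sum>\<^sub>\<infinity> X \<in> R1. pull_back (inv_into \<Gamma>1 \<phi> (SOME A. A \<in> \<phi> ` X)) \<omega> z v)"
  proof (rule infsum_cong)
    fix X assume X: "X \<in> R1"
    have const: "pull_back A \<omega> z v = pull_back B \<omega> z v" if "A \<in> X" "B \<in> X" for A B
    proof -
      obtain C where C: "C \<in> \<Gamma>1" "X = (\<lambda>D. compose hplane D C) ` \<Delta>1" using X unfolding R1 by auto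
      then show ?thesis using that inv[OF _ C(1)] by auto
    qed
    have some1: "(SOME \<gamma>. \<gamma> \<in> X) \<in> X" using R1_nonempty[OF X] by (simp add: some_in_eq)
    have "\<phi> ` X \<noteq> {}" using R1_nonempty[OF X] by simp
    then have "(SOME A. A \<in> \<phi> ` X) \<in> \<phi> ` X" by (simp only: some_in_eq not_False_eq_True)
    then obtain B where B: "B \<in> X" "(SOME A. A \<in> \<phi> ` X) = \<phi> B" by blast
    then have "inv_into \<Gamma>1 \<phi> (SOME A. A \<in> \<phi> ` X) = B"
      using inv_into_f_f[OF inj] R1_sub[OF X] by auto
    then show "pull_back (SOME \<gamma>. \<gamma> \<in> X) \<omega> z v = pull_back (inv_into \<Gamma>1 \<phi> (SOME A. A \<in> \<phi> ` X)) \<omega> z v"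
      using const[OF some1 B(1)] by simp
  qed
  also have "\<dots> = (\<Sum>\<^sub>\<infinity> X \<in> R2. pull_back (inv_into \<Gamma>1 \<phi> (SOME A. A \<in> X)) \<omega> z v)"
    using infsum_reindex_bij_betw[OF bij] .
  finally show ?thesis unfolding R2_def .
qed

section \<open>Convergence of the series\<close>

definition hyperbolic_form :: "complex \<Rightarrow> one_form" where
  "hyperbolic_form s z v = of_real (Im z / cmod z) powr (s - 1) * of_real (Im (inverse z * v))"

definition horocyclic_form :: "complex \<Rightarrow> one_form" where
  "horocyclic_form s w v = of_real (Im w) powr (s - 1) * of_real (Im v)"

lemma normalize_modulus:
  assumes "z \<in> hplane" "l > 0"
  obtains n :: int where "1 \<le> cmod (dilation (of_int n * l) z)" "cmod (dilation (of_int n * l) z) < exp l"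
proof -
  define x where "x = ln (cmod z) / l"
  have z: "cmod z = exp (l * x)"
  proof -
    have "cmod z > 0" using assms by (auto simp: hplane_Im)
    then show ?thesis using assms by (simp add: x_def)
  qed
  have *: "cmod (dilation (of_int (- \<lfloor>x\<rfloor>) * l) z) = exp (l * (x - of_int \<lfloor>x\<rfloor>))"
    using assms by (simp add: dilation_def norm_mult z exp_add[symmetric] algebra_simps)
  have "0 \<le> l * (x - of_int \<lfloor>x\<rfloor>)" "l * (x - of_int \<lfloor>x\<rfloor>) < l * 1"
    using assms(2) by (auto intro!: mult_strict_left_mono) linarith
  then show ?thesis using that[of "- \<lfloor>x\<rfloor>"] unfolding * by simp
qed

lemma dilation_sine: "z \<in> hplane \<Longrightarrow> Im (dilation a z) / cmod (dilation a z) = Im z / cmod z"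
  by (simp add: dilation_def norm_mult)

text \<open>The displacement of the dilation depends on the angle alone. A lower bound for it
  therefore bounds the sine from above by a multiple of l.\<close>

lemma chd_dilation:
  assumes "z \<in> hplane"
  shows "chd z (dilation l z) = 1 + (exp l - 1)\<^sup>2 / (2 * exp l * (Im z / cmod z)\<^sup>2)"
proof -
  have "z - dilation l z = - of_real (exp l - 1) * z" using assms by (simp add: dilation_def algebra_simps)
  then have "cmod (z - dilation l z) = \<bar>exp l - 1\<bar> * cmod z" by (simp add: norm_mult del: of_real_diff)
  then have "(cmod (z - dilation l z))\<^sup>2 = (exp l - 1)\<^sup>2 * (cmod z)\<^sup>2" by (simp add: power_mult_distrib)
  moreover have "Im (dilation l z) = exp l * Im z" using assms by (simp add: dilation_def)
  ultimately show ?thesis using assms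
    by (simp add: chd_def hplane_Im power_divide power2_eq_square field_simps)
qed

text \<open>By \<open>chd_polar\<close> the numerator of cosh d - 1 is at most (3 + C^2) l^2, with 2
  l^2 from the modulus and (C^2 + 1) l^2 from the angles, and the denominator is at least \<delta>
  l^2 / 2.\<close>

lemma chd_base_bound:
  assumes z: "Re z > 0" "Im z > 0" "1 \<le> cmod z" "cmod z < exp l" and l: "0 < l" "l \<le> 1 / 2" "l / 2 \<le> sin l"
    and h: "\<delta> * l \<le> Im z / cmod z" "Im z / cmod z \<le> C * l" and \<delta>: "\<delta> > 0"
  shows "chd z (exp (of_real l * \<i>)) \<le> 1 + 2 * (3 + C\<^sup>2) / \<delta>"
proof -
  define t where "t = ln (cmod z)"
  define \<theta> where "\<theta> = Arg z"
  define sn where "sn = Im z / cmod z"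
  have nz: "z \<noteq> 0" using z by auto
  have sn: "sn = sin \<theta>" using sin_Arg[OF nz] by (simp add: sn_def \<theta>_def)
  have cos: "cos \<theta> \<ge> 0" using cos_Arg[OF nz] z by (simp add: \<theta>_def)
  have t: "exp t = cmod z" using nz by (simp add: t_def)
  have "l < pi" using l pi_gt3 by simp
  then have eq: "chd z (exp (of_real l * \<i>)) - 1 = (cosh t - cos (\<theta> - l)) / (sn * sin l)"
    using chd_polar[OF z(1,2) l(1), of 0] by (simp add: t_def \<theta>_def sn_def)
  have "exp l \<le> 1 + l + l\<^sup>2" using l by (intro exp_bound) auto
  moreover have "l\<^sup>2 \<le> l" using l by (simp add: power2_eq_square)
  ultimately have e: "exp l - 1 \<le> 2 * l" by simp
  have "cosh t - 1 = (exp t - 1)\<^sup>2 / (2 * exp t)"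
    by (simp add: cosh_field_def exp_minus power2_eq_square field_simps)
  also have "\<dots> \<le> (exp t - 1)\<^sup>2 / 2" using z(3) t by (intro divide_left_mono) auto
  also have "\<dots> \<le> (2 * l)\<^sup>2 / 2" using e z(3,4) t by (intro divide_right_mono power_mono) auto
  finally have c1: "cosh t \<le> 1 + 2 * l\<^sup>2" by (simp add: power_mult_distrib)
  have half: "1 - cos x \<le> (sin x)\<^sup>2" if "cos x \<ge> 0" for x :: real
  proof -
    have "(1 - cos x) * 1 \<le> (1 - cos x) * (1 + cos x)" using that by (intro mult_left_mono) auto
    also have "\<dots> = (sin x)\<^sup>2" by (simp add: sin_squared_eq power2_eq_square algebra_simps)
    finally show ?thesis by simp
  qed
  have cl: "cos l \<ge> 0" using l pi_gt3 by (intro cos_ge_zero) auto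
  have sl: "0 < sin l" "sin l \<le> l" using l abs_sin_x_le_abs_x[of l] by auto
  have "1 - cos (\<theta> - l) = 1 - cos \<theta> * cos l - sn * sin l" by (simp add: cos_diff sn)
  also have "\<dots> \<le> 1 - cos \<theta> * cos l"
    using z nz sl(1) by (simp add: sn_def)
  also have "\<dots> = (1 - cos \<theta>) + cos \<theta> * (1 - cos l)" by (simp add: algebra_simps)
  also have "\<dots> \<le> (1 - cos \<theta>) + 1 * (1 - cos l)" by (intro add_left_mono mult_right_mono) auto
  also have "\<dots> \<le> sn\<^sup>2 + (sin l)\<^sup>2" using half[OF cos] half[OF cl] by (simp add: sn)
  also have "\<dots> \<le> (C * l)\<^sup>2 + l\<^sup>2"
    using h(2) z nz sl by (intro add_mono power_mono) (auto simp: sn_def)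
  finally have "cosh t - cos (\<theta> - l) \<le> (3 + C\<^sup>2) * l\<^sup>2" using c1 by (simp add: power_mult_distrib algebra_simps)
  moreover have "\<delta> * l * (l / 2) \<le> sn * sin l"
    using h(1) l \<delta> sl z by (intro mult_mono) (auto simp: sn_def)
  ultimately have "(cosh t - cos (\<theta> - l)) / (sn * sin l) \<le> (3 + C\<^sup>2) * l\<^sup>2 / (\<delta> * l * (l / 2))"
    using l \<delta> by (intro frac_le) auto
  also have "\<dots> = 2 * (3 + C\<^sup>2) / \<delta>" using l \<delta> by (simp add: power2_eq_square field_simps)
  finally show ?thesis using eq by simp
qed

text \<open>The isomorphism of the groups is required only as an equivariant bijection; that it
  respects composition and takes dilations to translations then follows from freeness
  (\<open>\<phi>_compose\<close>, \<open>\<phi>_dilation\<close>). \<open>equivariant\<close>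
  includes the invariance of the component under the whole group.\<close>

locale degenerating_groups =
  near_isometric_lifts l0 \<A> F Finv + lim: discrete_group \<Gamma>
  for l0 \<A> F Finv \<Gamma> +
  fixes \<Gamma>l :: "real \<Rightarrow> (complex \<Rightarrow> complex) set" and \<phi> :: "real \<Rightarrow> (complex \<Rightarrow> complex) \<Rightarrow> complex \<Rightarrow> complex"
  assumes \<Gamma>l_discrete: "l \<in> {0<..<l0} \<Longrightarrow> discrete_group (\<Gamma>l l)"
    and \<phi>_bij: "l \<in> {0<..<l0} \<Longrightarrow> bij_betw (\<phi> l) (\<Gamma>l l) \<Gamma>"
    and equivariant: "l \<in> {0<..<l0} \<Longrightarrow> \<gamma> \<in> \<Gamma>l l \<Longrightarrow> z \<in> \<A> l \<Longrightarrow> \<gamma> z \<in> \<A> l \<and> F l (\<gamma> z) = \<phi> l \<gamma> (F l z)"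
    and dilation_in: "l \<in> {0<..<l0} \<Longrightarrow> dilation l \<in> \<Gamma>l l"
    and cusp: "stabilizer_infinity \<Gamma> = group_generated_by translation"
begin

text \<open>Labelling the elements of \<open>\<Gamma>l l\<close> by the fixed group \<Gamma> makes
  terms for different l comparable.\<close>

definition \<psi> :: "real \<Rightarrow> (complex \<Rightarrow> complex) \<Rightarrow> complex \<Rightarrow> complex" where
  "\<psi> l = inv_into (\<Gamma>l l) (\<phi> l)"

lemma \<phi>_in: "l \<in> {0<..<l0} \<Longrightarrow> \<gamma> \<in> \<Gamma>l l \<Longrightarrow> \<phi> l \<gamma> \<in> \<Gamma>"
  using \<phi>_bij bij_betw_apply by metis

lemma \<psi>_in: "l \<in> {0<..<l0} \<Longrightarrow> A \<in> \<Gamma> \<Longrightarrow> \<psi> l A \<in> \<Gamma>l l"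
  using \<phi>_bij unfolding \<psi>_def by (metis bij_betw_imp_surj_on inv_into_into)

lemma \<phi>_\<psi>: "l \<in> {0<..<l0} \<Longrightarrow> A \<in> \<Gamma> \<Longrightarrow> \<phi> l (\<psi> l A) = A"
  using \<phi>_bij unfolding \<psi>_def by (metis bij_betw_inv_into_right)

lemma \<phi>_Finv:
  assumes "l \<in> {0<..<l0}" "\<gamma> \<in> \<Gamma>l l" "w \<in> hplane"
  shows "\<gamma> (Finv l w) = Finv l (\<phi> l \<gamma> w)"
  using equivariant[OF assms(1,2) Finv_\<A>[OF assms(1,3)]] F_Finv[OF assms(1,3)] Finv_F[OF assms(1)]
  by metis

lemma \<psi>_Finv:
  assumes "l \<in> {0<..<l0}" "A \<in> \<Gamma>" "w \<in> hplane"
  shows "\<psi> l A (Finv l w) = Finv l (A w)"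
  using \<phi>_Finv[OF assms(1) \<psi>_in[OF assms(1,2)] assms(3)] \<phi>_\<psi>[OF assms(1,2)] by simp

lemma translate_in: "translate n \<in> \<Gamma>"
proof -
  have "translate n \<in> stabilizer_infinity \<Gamma>" unfolding cusp group_generated_by_translation by simp
  then show ?thesis by (simp add: stabilizer_infinity_def)
qed

lemma dilations_in: "l \<in> {0<..<l0} \<Longrightarrow> dilation (of_int n * l) \<in> \<Gamma>l l"
proof -
  assume l: "l \<in> {0<..<l0}"
  interpret G: discrete_group "\<Gamma>l l" by (rule \<Gamma>l_discrete[OF l])
  have "generate (BijGroup hplane) {dilation l} \<subseteq> \<Gamma>l l"
    using group.generate_subgroup_incl[OF group_BijGroup _ G.subgroup] dilation_in[OF l] by simp
  then show ?thesis using group_generated_by_dilation[of l] unfolding group_generated_by_def by blast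
qed

lemma F_dilation:
  assumes l: "l \<in> {0<..<l0}" and z: "z \<in> \<A> l"
  shows "dilation (of_int n * l) z \<in> \<A> l \<and> F l (dilation (of_int n * l) z) = F l z + of_int n"
proof -
  have zH: "z \<in> hplane" using \<A>_hplane[OF l] z by blast
  show ?thesis
  proof (induction n rule: int_induct[where k = 0])
    case base
    then show ?case using z zH by (simp add: dilation_def)
  next
    case (step1 i)
    have "dilation (of_int (i + 1) * l) z = of_real (exp l) * dilation (of_int i * l) z"
      using zH by (simp add: dilation_def distrib_right exp_add)
    then show ?case using step1(2) dilate[OF l] by simp
  next
    case (step2 i)
    define y where "y = dilation (of_int (i - 1) * l) z"
    have y: "y = of_real (exp (- l)) * dilation (of_int i * l) z"
      using zH by (simp add: y_def dilation_def left_diff_distrib exp_diff exp_minus field_simps)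
    then have yA: "y \<in> \<A> l" using step2(2) dilate[OF l] by blast
    have "of_real (exp l) * y = dilation (of_int i * l) z"
      by (simp add: y exp_minus flip: mult.assoc)
    then have "F l y + 1 = F l z + of_int i" using dilate[OF l yA] step2(2) by simp
    then have "F l y = F l z + of_int (i - 1)" by (simp add: algebra_simps)
    then show ?case using yA y_def by simp
  qed
qed

lemma \<phi>_compose:
  assumes l: "l \<in> {0<..<l0}" and A: "A \<in> \<Gamma>l l" and B: "B \<in> \<Gamma>l l"
  shows "\<phi> l (compose hplane A B) = compose hplane (\<phi> l A) (\<phi> l B)"
proof (rule lim.eq_if_eq_at[OF _ _ ii_hplane])
  interpret G: discrete_group "\<Gamma>l l" by (rule \<Gamma>l_discrete[OF l])
  have AB: "compose hplane A B \<in> \<Gamma>l l" by (rule G.compose_closed[OF A B])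
  show "\<phi> l (compose hplane A B) \<in> \<Gamma>" "compose hplane (\<phi> l A) (\<phi> l B) \<in> \<Gamma>"
    using \<phi>_in[OF l] AB lim.compose_closed A B by auto
  define z where "z = Finv l \<i>"
  have z: "z \<in> \<A> l" "F l z = \<i>" "z \<in> hplane"
    using Finv_\<A>[OF l ii_hplane] F_Finv[OF l ii_hplane] \<A>_hplane[OF l] by (auto simp: z_def)
  have "\<phi> l (compose hplane A B) \<i> = F l (compose hplane A B z)"
    using equivariant[OF l AB z(1)] z(2) by simp
  also have "\<dots> = F l (A (B z))" using z(3) by (simp add: compose_eq)
  also have "\<dots> = \<phi> l A (\<phi> l B \<i>)"
    using equivariant[OF l B z(1)] equivariant[OF l A] z(2) by simp
  finally show "\<phi> l (compose hplane A B) \<i> = compose hplane (\<phi> l A) (\<phi> l B) \<i>"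
    by (simp add: compose_eq)
qed

lemma \<phi>_dilation:
  assumes l: "l \<in> {0<..<l0}"
  shows "\<phi> l (dilation (of_int n * l)) = translate n"
proof (rule lim.eq_if_eq_at[OF _ _ ii_hplane])
  show "\<phi> l (dilation (of_int n * l)) \<in> \<Gamma>" by (intro \<phi>_in l dilations_in)
  show "translate n \<in> \<Gamma>" by (rule translate_in)
  define z where "z = Finv l \<i>"
  have z: "z \<in> \<A> l" "F l z = \<i>"
    using Finv_\<A>[OF l ii_hplane] F_Finv[OF l ii_hplane] by (auto simp: z_def)
  show "\<phi> l (dilation (of_int n * l)) \<i> = translate n \<i>"
    using equivariant[OF l dilations_in[OF l, of n] z(1)] F_dilation[OF l z(1), of n] z(2)
    by (simp add: translate_def)
qed

definition cosets :: "(complex \<Rightarrow> complex) set set" where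
  "cosets = rcosets\<^bsub>(BijGroup hplane)\<lparr>carrier := \<Gamma>\<rparr>\<^esub> (range translate)"

lemma coset_representative:
  assumes X: "X \<in> cosets" and A: "A \<in> X"
  shows "A \<in> \<Gamma>" "X = range (\<lambda>n. compose hplane (translate n) A)"
proof -
  have sub: "range translate \<subseteq> \<Gamma>" using translate_in by auto
  obtain B where B: "B \<in> \<Gamma>" "X = (\<lambda>D. compose hplane D B) ` range translate"
    using X unfolding cosets_def lim.rcosets_eq[OF sub] by blast
  then obtain m where m: "A = compose hplane (translate m) B" using A by auto
  show "A \<in> \<Gamma>" unfolding m by (intro lim.compose_closed translate_in B(1))
  have shift: "compose hplane (translate n) (compose hplane (translate m) B) = compose hplane (translate (n + m)) B" for n m
    using lim.hplane_closed[OF B(1)] by (auto simp: compose_def translate_def fun_eq_iff hplane_Im)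
  have "range (\<lambda>n. compose hplane (translate n) A) = range (\<lambda>n. compose hplane (translate (n + m)) B)"
    unfolding m shift ..
  also have "\<dots> = range (\<lambda>n. compose hplane (translate n) B)"
  proof -
    have "compose hplane (translate n) B = compose hplane (translate (n - m + m)) B" for n by simp
    then show ?thesis by blast
  qed
  finally show "X = range (\<lambda>n. compose hplane (translate n) A)" using B(2) by (simp add: image_image)
qed

text \<open>The same choice as in \<open>coset_sum\<close>, so that the Eisenstein series is
  literally the sum over these representatives.\<close>

definition rep :: "(complex \<Rightarrow> complex) set \<Rightarrow> complex \<Rightarrow> complex" where
  "rep X = (SOME A. A \<in> X)"

lemma rep_in:
  assumes "X \<in> cosets" shows "rep X \<in> X" "rep X \<in> \<Gamma>"
proof -
  have sub: "range translate \<subseteq> \<Gamma>" using translate_in by auto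
  have "X \<noteq> {}" using assms unfolding cosets_def lim.rcosets_eq[OF sub] by auto
  then show "rep X \<in> X" unfolding rep_def by (simp add: some_in_eq)
  then show "rep X \<in> \<Gamma>" using coset_representative(1)[OF assms] by blast
qed

section \<open>Orbits in the collar: separation, heights and tails\<close>

lemma separated_lifts:
  obtains r where "r > 0" "\<forall>\<^sub>F l in at_right 0. \<forall>w \<in> hball R. \<forall>\<gamma> \<in> \<Gamma>l l.
      \<gamma> \<noteq> (\<lambda>z\<in>hplane. z) \<longrightarrow> r \<le> hdist (Finv l w) (\<gamma> (Finv l w))"
proof -
  obtain r1 where r1: "r1 > 0"
    "\<And>w A. w \<in> hball R \<Longrightarrow> A \<in> \<Gamma> \<Longrightarrow> A \<noteq> (\<lambda>z\<in>hplane. z) \<Longrightarrow> r1 \<le> hdist w (A w)"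
    by (rule lim.separated[of R]) (rule that; assumption)
  \<comment> \<open>With \<epsilon> = 1 the Lipschitz constant of \<open>F\<close> is 2, hence half
    of the separation r1 of the limit group; r \<le> 1 keeps the displaced point within the radius
    R' to which \<open>F_lipschitz\<close> is applied.\<close>
  define r where "r = min (r1 / 2) 1"
  define R' where "R' = max R 1"
  show ?thesis
  proof (rule that[of r])
    show "r > 0" using r1(1) by (simp add: r_def)
    show "\<forall>\<^sub>F l in at_right 0. \<forall>w \<in> hball R. \<forall>\<gamma> \<in> \<Gamma>l l.
      \<gamma> \<noteq> (\<lambda>z\<in>hplane. z) \<longrightarrow> r \<le> hdist (Finv l w) (\<gamma> (Finv l w))"
      using F_lipschitz[OF zero_less_one order_refl, of R'] small_l
    proof eventually_elim
      case (elim l)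
      note l = elim(2)
      interpret G: discrete_group "\<Gamma>l l" by (rule \<Gamma>l_discrete[OF l])
      show ?case
      proof (intro ballI impI)
        fix w \<gamma> assume w: "w \<in> hball R" and \<gamma>: "\<gamma> \<in> \<Gamma>l l" and ne: "\<gamma> \<noteq> (\<lambda>z\<in>hplane. z)"
        have wH: "w \<in> hplane" using w by (simp add: hball_def)
        have w': "w \<in> hball R'" using w hball_mono[of R R'] by (auto simp: R'_def)
        define z where "z = Finv l w"
        have zH: "z \<in> hplane" using Finv_hplane[OF l wH] by (simp add: z_def)
        have zA: "z \<in> \<A> l" using Finv_\<A>[OF l wH] by (simp add: z_def)
        have "\<phi> l \<gamma> \<noteq> (\<lambda>z\<in>hplane. z)"
        proof
          assume "\<phi> l \<gamma> = (\<lambda>z\<in>hplane. z)"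
          then have "\<gamma> z = z" using \<phi>_Finv[OF l \<gamma> wH] wH by (simp add: z_def)
          then show False using G.free[OF \<gamma> zH] ne by simp
        qed
        then have r1w: "r1 \<le> hdist w (\<phi> l \<gamma> w)" using r1(2)[OF w \<phi>_in[OF l \<gamma>]] by blast
        show "r \<le> hdist (Finv l w) (\<gamma> (Finv l w))"
        proof (rule ccontr)
          assume "\<not> ?thesis"
          then have lt: "hdist z (\<gamma> z) < r" by (simp add: z_def)
          then have "hdist z (\<gamma> z) \<le> R'" by (simp add: r_def R'_def le_max_iff_disj)
          then have "hdist w (F l (\<gamma> z)) \<le> (1 + 1) * hdist z (\<gamma> z)"
            using elim(1) w' G.hplane_closed[OF \<gamma> zH] unfolding z_def by blast
          moreover have "F l (\<gamma> z) = \<phi> l \<gamma> w" using equivariant[OF l \<gamma> zA] F_Finv[OF l wH] by (simp add: z_def)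
          ultimately have "r1 \<le> 2 * hdist z (\<gamma> z)" using r1w by simp
          then show False using lt by (simp add: r_def)
        qed
      qed
    qed
  qed
qed

text \<open>The conjugate of the dilation by \<gamma> moves z = Finv l w exactly as far as the
  dilation moves \<gamma> z. By \<open>separated_lifts\<close> this is at least r, and
  \<open>chd_dilation\<close> converts it into a bound for the sine at \<gamma> z.\<close>

lemma height_bound:
  obtains C where "C > 0" "\<forall>\<^sub>F l in at_right 0. \<forall>w \<in> hball R. \<forall>\<gamma> \<in> \<Gamma>l l.
      Im (\<gamma> (Finv l w)) / cmod (\<gamma> (Finv l w)) \<le> C * l"
proof -
  obtain r where r: "r > 0" "\<forall>\<^sub>F l in at_right 0. \<forall>w \<in> hball R. \<forall>\<gamma> \<in> \<Gamma>l l.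
      \<gamma> \<noteq> (\<lambda>z\<in>hplane. z) \<longrightarrow> r \<le> hdist (Finv l w) (\<gamma> (Finv l w))"
    by (rule separated_lifts[of R]) (rule that; assumption)
  define q where "q = cosh r - 1"
  have q: "q > 0" using r(1) cosh_real_nonneg_less_iff[of 0 r] by (simp add: q_def)
  \<comment> \<open>Read off from 2 q u^2 \<le> (exp l - 1)^2 \<le> (2 l)^2 for the sine u.\<close>
  define C where "C = sqrt (2 / q)"
  show ?thesis
  proof (rule that[of C])
    show "C > 0" using q by (simp add: C_def)
    have "\<forall>\<^sub>F l in at_right (0::real). l < 1 / 2"
      by (rule order_tendstoD(2)[OF tendsto_ident_at]) simp
    then show "\<forall>\<^sub>F l in at_right 0. \<forall>w \<in> hball R. \<forall>\<gamma> \<in> \<Gamma>l l.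
      Im (\<gamma> (Finv l w)) / cmod (\<gamma> (Finv l w)) \<le> C * l"
      using r(2) small_l
    proof eventually_elim
      case (elim l)
      note l = elim(3)
      interpret G: discrete_group "\<Gamma>l l" by (rule \<Gamma>l_discrete[OF l])
      have lpos: "l > 0" using l by simp
      have ne: "dilation l \<noteq> (\<lambda>z\<in>hplane. z)"
      proof
        assume "dilation l = (\<lambda>z\<in>hplane. z)"
        then have "dilation l \<i> = \<i>" by simp
        then show False using lpos by (simp add: dilation_def)
      qed
      show ?case
      proof (intro ballI)
        fix w \<gamma> assume w: "w \<in> hball R" and \<gamma>: "\<gamma> \<in> \<Gamma>l l"
        have wH: "w \<in> hplane" using w by (simp add: hball_def)
        define z where "z = Finv l w"
        have zH: "z \<in> hplane" using Finv_hplane[OF l wH] by (simp add: z_def)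
        have \<gamma>zH: "\<gamma> z \<in> hplane" by (rule G.hplane_closed[OF \<gamma> zH])
        obtain \<gamma>' where \<gamma>': "\<gamma>' \<in> \<Gamma>l l" "\<And>z. z \<in> hplane \<Longrightarrow> \<gamma>' (\<gamma> z) = z" "\<And>z. z \<in> hplane \<Longrightarrow> \<gamma> (\<gamma>' z) = z"
          by (rule G.inverse_exists[OF \<gamma>]) (rule that; assumption)
        define \<beta> where "\<beta> = compose hplane \<gamma>' (compose hplane (dilation l) \<gamma>)"
        have dl: "dilation l \<in> \<Gamma>l l" using dilation_in[OF l] .
        have \<beta>: "\<beta> \<in> \<Gamma>l l" unfolding \<beta>_def by (intro G.compose_closed \<gamma>' dl \<gamma>)
        have \<beta>z: "\<beta> z = \<gamma>' (dilation l (\<gamma> z))" using zH \<gamma>zH by (simp add: \<beta>_def compose_eq)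
        have dH: "dilation l (\<gamma> z) \<in> hplane" by (rule G.hplane_closed[OF dl \<gamma>zH])
        have "\<beta> \<noteq> (\<lambda>z\<in>hplane. z)"
        proof
          assume "\<beta> = (\<lambda>z\<in>hplane. z)"
          then have "\<gamma>' (dilation l (\<gamma> z)) = z" using \<beta>z zH by simp
          then have "dilation l (\<gamma> z) = \<gamma> z" using \<gamma>'(3)[OF dH] by simp
          then show False using G.free[OF dl \<gamma>zH] ne by blast
        qed
        then have "r \<le> hdist z (\<beta> z)" using elim(2) w \<beta> by (auto simp: z_def)
        also have "\<dots> = hdist (\<gamma> z) (\<gamma> (\<beta> z))" using G.isometry[OF \<gamma> zH] G.hplane_closed[OF \<beta> zH] by simp
        also have "\<gamma> (\<beta> z) = dilation l (\<gamma> z)" unfolding \<beta>z by (rule \<gamma>'(3)[OF dH])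
        finally have "cosh r \<le> chd (\<gamma> z) (dilation l (\<gamma> z))"
          using cosh_hdist[OF \<gamma>zH dH] hdist_nonneg[OF \<gamma>zH dH] r(1) cosh_real_nonneg_le_iff[of r] by (metis less_imp_le)
        then have 1: "q \<le> (exp l - 1)\<^sup>2 / (2 * exp l * (Im (\<gamma> z) / cmod (\<gamma> z))\<^sup>2)"
          unfolding chd_dilation[OF \<gamma>zH] by (simp add: q_def)
        define u where "u = Im (\<gamma> z) / cmod (\<gamma> z)"
        have u: "u > 0" using \<gamma>zH by (auto simp: u_def hplane_Im intro!: divide_pos_pos)
        have "q * (2 * exp l * u\<^sup>2) \<le> (exp l - 1)\<^sup>2" using 1 u by (simp add: u_def[symmetric] pos_le_divide_eq)
        moreover have "q * (2 * 1 * u\<^sup>2) \<le> q * (2 * exp l * u\<^sup>2)"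
          using q lpos by (intro mult_left_mono mult_right_mono) auto
        moreover have "(exp l - 1)\<^sup>2 \<le> (2 * l)\<^sup>2"
        proof -
          have "exp l \<le> 1 + l + l\<^sup>2" using elim(1) lpos by (intro exp_bound) auto
          moreover have "l\<^sup>2 \<le> l" using elim(1) lpos by (simp add: power2_eq_square)
          ultimately show ?thesis using lpos by (intro power_mono) auto
        qed
        ultimately have "q * u\<^sup>2 \<le> 2 * l\<^sup>2" by (simp add: power_mult_distrib)
        then have "u\<^sup>2 \<le> 2 * l\<^sup>2 / q" using q by (simp add: pos_le_divide_eq mult.commute[of q])
        also have "\<dots> = (C * l)\<^sup>2" using q by (simp add: C_def power_mult_distrib)
        finally have "u\<^sup>2 \<le> (C * l)\<^sup>2" .
        moreover have "0 \<le> C * l" using q lpos by (simp add: C_def)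
        ultimately have "u \<le> C * l" by (rule power2_le_imp_le)
        then show "Im (\<gamma> (Finv l w)) / cmod (\<gamma> (Finv l w)) \<le> C * l" by (simp add: u_def z_def)
      qed
    qed
  qed
qed

lemma small_sin: "\<forall>\<^sub>F l in at_right (0::real). l / 2 \<le> sin l"
proof -
  have "((\<lambda>l::real. sin l / l) \<longlongrightarrow> 1) (at_right 0)" by real_asymp
  then have "\<forall>\<^sub>F l in at_right (0::real). 1 / 2 < sin l / l" by (rule order_tendstoD) simp
  moreover have "\<forall>\<^sub>F l in at_right (0::real). l > 0" by (rule eventually_at_right_less)
  ultimately show ?thesis by eventually_elim (simp add: field_simps)
qed

lemma small_half: "\<forall>\<^sub>F l in at_right (0::real). l \<le> 1 / 2"
proof -
  have "\<forall>\<^sub>F l in at_right (0::real). l < 1 / 2"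
    by (rule order_tendstoD(2)[OF tendsto_ident_at]) simp
  then show ?thesis by eventually_elim simp
qed

text \<open>The height \<open>\<eta>\<close> depends only on the coset, so the representative may be chosen in a
  fundamental annulus.\<close>

lemma normalized_representative:
  assumes l: "l \<in> {0<..<l0}" and w: "w \<in> hplane" and X: "X \<in> cosets"
  obtains A where "A \<in> X" "A \<in> \<Gamma>" "1 \<le> cmod (Finv l (A w))" "cmod (Finv l (A w)) < exp l"
    "Im (Finv l (A w)) / cmod (Finv l (A w)) = Im (Finv l (rep X w)) / cmod (Finv l (rep X w))"
proof -
  interpret G: discrete_group "\<Gamma>l l" by (rule \<Gamma>l_discrete[OF l])
  have repw: "rep X w \<in> hplane" using lim.hplane_closed[OF rep_in(2)[OF X] w] .
  define z where "z = Finv l (rep X w)"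
  have z: "z \<in> hplane" "z \<in> \<A> l" using Finv_hplane[OF l repw] Finv_\<A>[OF l repw] by (auto simp: z_def)
  obtain n :: int where n: "1 \<le> cmod (dilation (of_int n * l) z)" "cmod (dilation (of_int n * l) z) < exp l"
    by (rule normalize_modulus[OF z(1), of l]) (use l that in auto)
  define A where "A = compose hplane (translate n) (rep X)"
  have AX: "A \<in> X" using coset_representative(2)[OF X rep_in(1)[OF X]] by (auto simp: A_def)
  have "Finv l (A w) = Finv l (F l z + of_int n)"
    using F_Finv[OF l repw] repw w by (simp add: A_def compose_eq translate_def z_def)
  also have "\<dots> = dilation (of_int n * l) z"
    using F_dilation[OF l z(2), of n] Finv_F[OF l] by metis
  finally have eq: "Finv l (A w) = dilation (of_int n * l) z" .
  show ?thesis
    by (rule that[OF AX coset_representative(1)[OF X AX]])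
      (use n dilation_sine[OF z(1)] in \<open>auto simp: eq z_def\<close>)
qed

text \<open>A coset exceeding \<delta> has a representative in the fundamental annulus with scaled
  height between \<delta> and the constant of \<open>height_bound\<close>, hence at bounded distance
  from the point over \<i>. There \<open>F\<close> is Lipschitz, so the corresponding element of
  \<Gamma> returns w to a fixed ball, and only finitely many elements do so.\<close>

lemma finitely_many_high_cosets:
  assumes \<delta>: "\<delta> > 0"
  obtains E where "finite E" "E \<subseteq> cosets" "\<forall>\<^sub>F l in at_right 0. \<forall>w \<in> hball R. \<forall>X \<in> cosets - E.
      Im (Finv l (rep X w)) / cmod (Finv l (rep X w)) / l \<le> \<delta>"
proof -
  obtain C where C: "C > 0" "\<forall>\<^sub>F l in at_right 0. \<forall>w \<in> hball R. \<forall>\<gamma> \<in> \<Gamma>l l.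
      Im (\<gamma> (Finv l w)) / cmod (\<gamma> (Finv l w)) \<le> C * l"
    by (rule height_bound[of R]) (rule that; assumption)
  define c where "c = 1 + 2 * (3 + C\<^sup>2) / \<delta>"
  have c: "c \<ge> 1" using C \<delta> by (simp add: c_def)
  define R' where "R' = arcosh c"
  have R': "R' \<ge> 0" "cosh R' = c" using c by (auto simp: R'_def)
  \<comment> \<open>Independent of l; the factor 2 is the Lipschitz constant of \<open>F\<close> for
    \<epsilon> = 1.\<close>
  define E where "E = (\<lambda>A. range (\<lambda>n. compose hplane (translate n) A)) ` {A \<in> \<Gamma>. \<exists>w \<in> hball R. A w \<in> hball (2 * R')} \<inter> cosets"
  show ?thesis
  proof (rule that[of E])
    show "finite E" unfolding E_def using lim.finite_return by blast
    show "E \<subseteq> cosets" by (simp add: E_def)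
    show "\<forall>\<^sub>F l in at_right 0. \<forall>w \<in> hball R. \<forall>X \<in> cosets - E.
      Im (Finv l (rep X w)) / cmod (Finv l (rep X w)) / l \<le> \<delta>"
      using F_lipschitz[OF zero_less_one order_refl, of R'] C(2) small_l small_sin small_half
    proof eventually_elim
      case (elim l)
      note l = elim(3)
      have lpos: "l > 0" using l by simp
      show ?case
      proof (intro ballI, rule ccontr)
        fix w X assume w: "w \<in> hball R" and X: "X \<in> cosets - E"
          and "\<not> Im (Finv l (rep X w)) / cmod (Finv l (rep X w)) / l \<le> \<delta>"
        then have gt: "\<delta> * l < Im (Finv l (rep X w)) / cmod (Finv l (rep X w))"
          using lpos by (metis not_le pos_less_divide_eq)
        have wH: "w \<in> hplane" using w by (simp add: hball_def)
        have Xc: "X \<in> cosets" using X by simp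
        obtain A where A: "A \<in> X" "A \<in> \<Gamma>" "1 \<le> cmod (Finv l (A w))" "cmod (Finv l (A w)) < exp l"
          "Im (Finv l (A w)) / cmod (Finv l (A w)) = Im (Finv l (rep X w)) / cmod (Finv l (rep X w))"
          by (rule normalized_representative[OF l wH Xc]) (rule that; assumption)
        define z where "z = Finv l (A w)"
        have AwH: "A w \<in> hplane" by (rule lim.hplane_closed[OF A(2) wH])
        have z: "z \<in> \<A> l" using Finv_\<A>[OF l AwH] by (simp add: z_def)
        then have zH: "z \<in> hplane" using \<A>_hplane[OF l] by blast
        have "Im z / cmod z \<le> C * l"
          using elim(2) w \<psi>_in[OF l A(2)] \<psi>_Finv[OF l A(2) wH] unfolding z_def by metis
        then have "chd z (exp (of_real l * \<i>)) \<le> c"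
          unfolding c_def using A(3-5) \<A>_quadrant[OF l z] gt elim(4,5) lpos \<delta>
          by (intro chd_base_bound) (auto simp: z_def)
        moreover have eH: "exp (of_real l * \<i>) \<in> hplane" using base_point[OF l] \<A>_hplane[OF l] by blast
        ultimately have "hdist (exp (of_real l * \<i>)) z \<le> R'"
          using hdist_le_iff[OF eH zH R'(1)] R'(2) by (simp add: chd_commute)
        moreover have Fi: "Finv l \<i> = exp (of_real l * \<i>)" using Finv_lattice[OF l, of 0] by simp
        moreover have "\<i> \<in> hball R'" using R' by (simp add: hball_def)
        ultimately have "hdist \<i> (F l z) \<le> (1 + 1) * hdist (Finv l \<i>) z"
          using elim(1) zH by metis
        then have "hdist \<i> (A w) \<le> 2 * R'"
          using \<open>hdist (exp (of_real l * \<i>)) z \<le> R'\<close> F_Finv[OF l AwH] Fi by (simp add: z_def)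
        then have "A w \<in> hball (2 * R')" using AwH by (simp add: hball_def)
        then have "X \<in> E"
          unfolding E_def using coset_representative(2)[OF Xc A(1)] A(2) w Xc by blast
        then show False using X by simp
      qed
    qed
  qed
qed

text \<open>Normalized representatives, one for each coset, give distinct points of a single orbit
  in the annulus, to which \<open>packing_sum\<close> applies. The level 2^(-k0) is chosen by C * x
  ^ k0 < e, and the cosets above it are the excluded ones.\<close>

lemma height_sum_tail:
  assumes \<sigma>: "\<sigma> > 1" and e: "e > 0"
  obtains E where "finite E" "E \<subseteq> cosets" "\<forall>\<^sub>F l in at_right 0. \<forall>w \<in> hball R. \<forall>E'. finite E' \<and> E' \<subseteq> cosets - E \<longrightarrow>
      (\<Sum>X\<in>E'. (Im (Finv l (rep X w)) / cmod (Finv l (rep X w)) / l) powr \<sigma>) \<le> e"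
proof -
  obtain r where r: "r > 0" "\<forall>\<^sub>F l in at_right 0. \<forall>w \<in> hball R. \<forall>\<gamma> \<in> \<Gamma>l l.
      \<gamma> \<noteq> (\<lambda>z\<in>hplane. z) \<longrightarrow> r \<le> hdist (Finv l w) (\<gamma> (Finv l w))"
    by (rule separated_lifts[of R]) (rule that; assumption)
  define q where "q = cosh r - 1"
  have q: "q > 0" using r(1) cosh_real_nonneg_less_iff[of 0 r] by (simp add: q_def)
  obtain C where C: "0 \<le> C" "\<And>k0 l P. 0 < l \<Longrightarrow> l \<le> 1 / 2 \<Longrightarrow> finite P \<Longrightarrow>
      \<forall>z\<in>P. Re z > 0 \<and> Im z > 0 \<and> 1 \<le> cmod z \<and> cmod z < exp l \<and> Im z / cmod z / l \<le> (1 / 2) ^ k0 \<Longrightarrow>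
      \<forall>z\<in>P. \<forall>z'\<in>P. z \<noteq> z' \<longrightarrow> 1 + q \<le> chd z z' \<Longrightarrow>
      (\<Sum>z\<in>P. (Im z / cmod z / l) powr \<sigma>) \<le> C * (2 powr (1 - \<sigma>)) ^ k0"
    by (rule packing_sum[OF \<sigma> q]) (rule that; assumption)
  define x where "x = 2 powr (1 - \<sigma>)"
  have x: "0 < x" "x < 1" using \<sigma> by (auto simp: x_def powr_less_one)
  have "(\<lambda>k. C * x ^ k) \<longlonglongrightarrow> C * 0" using x by (intro tendsto_intros LIMSEQ_power_zero) auto
  then have "\<forall>\<^sub>F k in sequentially. C * x ^ k < e" by (rule order_tendstoD) (use e in simp)
  then obtain k0 where k0: "C * x ^ k0 < e" by (auto simp: eventually_sequentially)
  have "(1 / 2 :: real) ^ k0 > 0" by simp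
  then obtain E where E: "finite E" "E \<subseteq> cosets" "\<forall>\<^sub>F l in at_right 0. \<forall>w \<in> hball R. \<forall>X \<in> cosets - E.
      Im (Finv l (rep X w)) / cmod (Finv l (rep X w)) / l \<le> (1 / 2) ^ k0"
    by (rule finitely_many_high_cosets[of "(1/2)^k0" R]) (rule that; assumption)
  show ?thesis
  proof (rule that[OF E(1,2)])
    show "\<forall>\<^sub>F l in at_right 0. \<forall>w \<in> hball R. \<forall>E'. finite E' \<and> E' \<subseteq> cosets - E \<longrightarrow>
      (\<Sum>X\<in>E'. (Im (Finv l (rep X w)) / cmod (Finv l (rep X w)) / l) powr \<sigma>) \<le> e"
      using E(3) r(2) small_l small_half
    proof eventually_elim
      case (elim l)
      note l = elim(3)
      interpret G: discrete_group "\<Gamma>l l" by (rule \<Gamma>l_discrete[OF l])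
      have lpos: "l > 0" using l by simp
      show ?case
      proof (intro ballI allI impI)
        fix w E' assume w: "w \<in> hball R" and E': "finite E' \<and> E' \<subseteq> cosets - E"
        have wH: "w \<in> hplane" using w by (simp add: hball_def)
        have "\<forall>X. \<exists>A. X \<in> cosets \<longrightarrow> A \<in> X \<and> A \<in> \<Gamma> \<and> 1 \<le> cmod (Finv l (A w)) \<and> cmod (Finv l (A w)) < exp l \<and>
            Im (Finv l (A w)) / cmod (Finv l (A w)) = Im (Finv l (rep X w)) / cmod (Finv l (rep X w))"
        proof
          fix X
          show "\<exists>A. X \<in> cosets \<longrightarrow> A \<in> X \<and> A \<in> \<Gamma> \<and> 1 \<le> cmod (Finv l (A w)) \<and> cmod (Finv l (A w)) < exp l \<and>
            Im (Finv l (A w)) / cmod (Finv l (A w)) = Im (Finv l (rep X w)) / cmod (Finv l (rep X w))"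
          proof (cases "X \<in> cosets")
            case True
            show ?thesis by (rule normalized_representative[OF l wH True]) blast
          qed simp
        qed
        then obtain B where B: "\<And>X. X \<in> cosets \<Longrightarrow> B X \<in> X \<and> B X \<in> \<Gamma> \<and> 1 \<le> cmod (Finv l (B X w)) \<and> cmod (Finv l (B X w)) < exp l \<and>
            Im (Finv l (B X w)) / cmod (Finv l (B X w)) = Im (Finv l (rep X w)) / cmod (Finv l (rep X w))"
          by metis
        define Z where "Z = (\<lambda>X. Finv l (B X w))"
        have sub: "X \<in> cosets" if "X \<in> E'" for X using E' that by auto
        have BH: "B X w \<in> hplane" if "X \<in> E'" for X using lim.hplane_closed B[OF sub[OF that]] wH by blast
        \<comment> \<open>The inverse of \<alpha> takes the pair of points to z and its image under
          a nontrivial element, where \<open>separated_lifts\<close> is available; no control of the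
          lift at the two points is involved.\<close>
        have sep: "1 + q \<le> chd (Z X) (Z Y)" if XY: "X \<in> E'" "Y \<in> E'" and ne: "X \<noteq> Y" for X Y
        proof -
          have BX: "B X \<in> \<Gamma>" "B Y \<in> \<Gamma>" using B sub XY by auto
          have neB: "B X \<noteq> B Y"
          proof
            assume "B X = B Y"
            then have "X = Y" using coset_representative(2)[of X "B X"] coset_representative(2)[of Y "B Y"] B sub XY by metis
            then show False using ne by simp
          qed
          define \<alpha> \<beta> where "\<alpha> = \<psi> l (B X)" "\<beta> = \<psi> l (B Y)"
          have \<alpha>\<beta>: "\<alpha> \<in> \<Gamma>l l" "\<beta> \<in> \<Gamma>l l" using \<psi>_in[OF l] BX by (auto simp: \<alpha>_\<beta>_def)
          define z where "z = Finv l w"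
          have zH: "z \<in> hplane" using Finv_hplane[OF l wH] by (simp add: z_def)
          have Z: "Z X = \<alpha> z" "Z Y = \<beta> z" using \<psi>_Finv[OF l _ wH] BX by (auto simp: Z_def \<alpha>_\<beta>_def z_def)
          obtain \<alpha>' where \<alpha>': "\<alpha>' \<in> \<Gamma>l l" "\<And>z. z \<in> hplane \<Longrightarrow> \<alpha>' (\<alpha> z) = z" "\<And>z. z \<in> hplane \<Longrightarrow> \<alpha> (\<alpha>' z) = z"
            by (rule G.inverse_exists[OF \<alpha>\<beta>(1)]) (rule that; assumption)
          have cH: "\<alpha> z \<in> hplane" "\<beta> z \<in> hplane" using G.hplane_closed \<alpha>\<beta> zH by auto
          have "compose hplane \<alpha>' \<beta> \<noteq> (\<lambda>z\<in>hplane. z)"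
          proof
            assume "compose hplane \<alpha>' \<beta> = (\<lambda>z\<in>hplane. z)"
            then have "\<alpha>' (\<beta> z) = z" using zH by (metis compose_eq restrict_apply')
            then have "\<beta> z = \<alpha> z" using \<alpha>'(3)[OF cH(2)] by simp
            then have "\<beta> = \<alpha>" using G.eq_if_eq_at \<alpha>\<beta> zH by blast
            then show False using neB \<phi>_\<psi>[OF l BX(1)] \<phi>_\<psi>[OF l BX(2)] by (simp add: \<alpha>_\<beta>_def)
          qed
          then have "r \<le> hdist z (compose hplane \<alpha>' \<beta> z)"
            using elim(2) w G.compose_closed[OF \<alpha>'(1) \<alpha>\<beta>(2)] unfolding z_def by blast
          also have "\<dots> = hdist z (\<alpha>' (\<beta> z))" using zH by (simp add: compose_eq)
          also have "\<dots> = hdist (\<alpha> z) (\<alpha> (\<alpha>' (\<beta> z)))"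
            using G.isometry[OF \<alpha>\<beta>(1) zH G.hplane_closed[OF \<alpha>'(1) cH(2)]] by simp
          also have "\<dots> = hdist (\<alpha> z) (\<beta> z)" using \<alpha>'(3)[OF cH(2)] by simp
          finally have "cosh r \<le> chd (\<alpha> z) (\<beta> z)"
            using cosh_hdist[OF cH] hdist_nonneg[OF cH] r(1) cosh_real_nonneg_le_iff[of r] by (metis less_imp_le)
          then show ?thesis by (simp add: Z q_def)
        qed
        have inj: "inj_on Z E'"
        proof (rule inj_onI, rule ccontr)
          fix X Y assume XY: "X \<in> E'" "Y \<in> E'" "Z X = Z Y" "X \<noteq> Y"
          have "chd (Z X) (Z Y) = 1" using XY(3) by (simp add: chd_def)
          then show False using sep[OF XY(1,2,4)] q by simp
        qed
        have "(\<Sum>X\<in>E'. (Im (Finv l (rep X w)) / cmod (Finv l (rep X w)) / l) powr \<sigma>)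
            = (\<Sum>X\<in>E'. (Im (Z X) / cmod (Z X) / l) powr \<sigma>)"
          using B sub by (intro sum.cong) (auto simp: Z_def)
        also have "\<dots> = (\<Sum>z\<in>Z ` E'. (Im z / cmod z / l) powr \<sigma>)"
          using inj by (simp add: sum.reindex)
        also have "\<dots> \<le> C * x ^ k0" unfolding x_def
        proof (rule C(2)[OF lpos elim(4)])
          show "finite (Z ` E')" using E' by simp
          show "\<forall>z\<in>Z ` E'. Re z > 0 \<and> Im z > 0 \<and> 1 \<le> cmod z \<and> cmod z < exp l \<and> Im z / cmod z / l \<le> (1 / 2) ^ k0"
          proof
            fix z assume "z \<in> Z ` E'"
            then obtain X where X: "X \<in> E'" "z = Z X" by blast
            have "Re z > 0 \<and> Im z > 0" using \<A>_quadrant[OF l Finv_\<A>[OF l BH[OF X(1)]]] X(2) by (simp add: Z_def)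
            moreover have "X \<in> cosets - E" using X(1) E' by blast
            ultimately show "Re z > 0 \<and> Im z > 0 \<and> 1 \<le> cmod z \<and> cmod z < exp l \<and> Im z / cmod z / l \<le> (1 / 2) ^ k0"
              using B[OF sub[OF X(1)]] elim(1) w by (simp add: X(2) Z_def)
          qed
          show "\<forall>z\<in>Z ` E'. \<forall>z'\<in>Z ` E'. z \<noteq> z' \<longrightarrow> 1 + q \<le> chd z z'"
            using sep by blast
        qed
        finally show "(\<Sum>X\<in>E'. (Im (Finv l (rep X w)) / cmod (Finv l (rep X w)) / l) powr \<sigma>) \<le> e"
          using k0 by simp
      qed
    qed
  qed
qed

end

section \<open>Limits of the conjugated elements and of their derivatives\<close>

lemma uniform_limit_compactI':
  fixes f :: "'i \<Rightarrow> 'a::topological_space \<Rightarrow> 'b::metric_space"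
  assumes K: "compact K" and g: "continuous_on K g"
    and lim: "\<And>x0 (H :: ('i \<times> 'a) filter). x0 \<in> K \<Longrightarrow> filterlim fst G H \<Longrightarrow> (snd \<longlongrightarrow> x0) H \<Longrightarrow>
        ((\<lambda>p. f (fst p) (snd p)) \<longlongrightarrow> g x0) H"
  shows "uniform_limit K f g G"
proof (rule uniform_limit_compactI[OF K g])
  fix x0 assume x0: "x0 \<in> K"
  define H where "H = G \<times>\<^sub>F inf (nhds x0) (principal K)"
  have "filterlim fst G H" unfolding H_def by (rule filterlim_fst)
  moreover have "filterlim snd (inf (nhds x0) (principal K)) H" unfolding H_def by (rule filterlim_snd)
  then have "(snd \<longlongrightarrow> x0) H" by (rule filterlim_mono) auto
  ultimately have "((\<lambda>p. f (fst p) (snd p)) \<longlongrightarrow> g x0) H" by (rule lim[OF x0])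
  then show "((\<lambda>(i, x). f i x) \<longlongrightarrow> g x0) (G \<times>\<^sub>F inf (nhds x0) (principal K))"
    unfolding H_def by (simp add: case_prod_unfold)
qed

lemma at_right_0_D:
  assumes "filterlim L (at_right (0::real)) G"
  shows "(L \<longlongrightarrow> 0) G" "\<forall>\<^sub>F i in G. L i > 0"
  using assms by (auto simp: filterlim_at elim: eventually_mono)

lemma exp_quotient_limit:
  assumes L: "filterlim L (at_right (0::real)) G" and Y: "(Y \<longlongrightarrow> (x0::complex)) G"
  shows "((\<lambda>i. (exp (of_real (L i) * Y i) - 1) / of_real (L i)) \<longlongrightarrow> x0) G"
proof (rule tendsto_deriv_ratio[where \<phi> = "\<lambda>x. exp x - 1"])
  have ne: "\<forall>\<^sub>F i in G. complex_of_real (L i) \<noteq> 0"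
    using at_right_0_D(2)[OF L] by eventually_elim simp
  show "((\<lambda>x::complex. exp x - 1) has_field_derivative 1) (at 0)"
    by (auto intro!: derivative_eq_intros)
  show "((\<lambda>i. of_real (L i) * Y i / of_real (L i)) \<longlongrightarrow> x0) G"
    using Y by (rule Lim_transform_eventually) (use ne in \<open>auto elim: eventually_mono\<close>)
  show "((\<lambda>i. complex_of_real (L i)) \<longlongrightarrow> 0) G"
    using tendsto_of_real[OF at_right_0_D(1)[OF L]] by simp
  show "\<forall>\<^sub>F i in G. complex_of_real (L i) \<noteq> 0" by (rule ne)
qed simp

text \<open>Subtracting 1 and dividing by l is a real affine map with positive factor, so it
  preserves \<open>chd\<close>, and it takes exp (l y) to a point tending to y. In the coordinate w
  the hyperbolic metric thus tends to that of the half-plane.\<close>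

lemma chd_exp_limit:
  assumes L: "filterlim L (at_right (0::real)) G" and Y: "(Y \<longlongrightarrow> x0) G" and x0: "x0 \<in> hplane"
  shows "((\<lambda>i. chd (exp (of_real (L i) * \<i>)) (exp (of_real (L i) * Y i))) \<longlongrightarrow> chd \<i> x0) G"
proof -
  define E where "E = (\<lambda>y i. (exp (complex_of_real (L i) * y) - 1) / of_real (L i))"
  have E1: "((\<lambda>i. E \<i> i) \<longlongrightarrow> \<i>) G" unfolding E_def by (rule exp_quotient_limit[OF L tendsto_const])
  have E2: "((\<lambda>i. E (Y i) i) \<longlongrightarrow> x0) G" unfolding E_def by (rule exp_quotient_limit[OF L Y])
  have "((\<lambda>i. chd (E \<i> i) (E (Y i) i)) \<longlongrightarrow> chd \<i> x0) G"
    by (rule tendsto_chd[OF E1 E2]) (use x0 in auto)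
  moreover have "\<forall>\<^sub>F i in G. chd (E \<i> i) (E (Y i) i) = chd (exp (of_real (L i) * \<i>)) (exp (of_real (L i) * Y i))"
    using at_right_0_D(2)[OF L]
  proof eventually_elim
    case (elim i)
    have "E \<i> i - E (Y i) i = (exp (of_real (L i) * \<i>) - exp (of_real (L i) * Y i)) / of_real (L i)"
      by (simp add: E_def diff_divide_distrib)
    then have 1: "cmod (E \<i> i - E (Y i) i) = cmod (exp (of_real (L i) * \<i>) - exp (of_real (L i) * Y i)) / L i"
      using elim by (simp add: norm_divide)
    have 2: "Im (E y i) = Im (exp (of_real (L i) * y)) / L i" for y
      by (simp add: E_def)
    show ?case unfolding chd_def 1 2 using elim by (simp add: power_divide power2_eq_square)
  qed
  ultimately show ?thesis by (rule Lim_transform_eventually)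
qed

lemma w_coord_exp:
  assumes "l > 0" "\<bar>l * Im y\<bar> < pi"
  shows "w_coord l (exp (of_real l * y)) = y"
proof -
  have "Ln (exp (of_real l * y)) = of_real l * y" using assms by (intro Ln_exp) auto
  then show ?thesis using assms by (simp add: w_coord_def)
qed

lemma exp_w_coord: "l \<noteq> 0 \<Longrightarrow> z \<noteq> 0 \<Longrightarrow> w_coord_inv l (w_coord l z) = z"
  by (simp add: w_coord_def w_coord_inv_def)

lemma small_multiple:
  assumes L: "filterlim L (at_right (0::real)) G" and Y: "(Y \<longlongrightarrow> (x0::real)) G" and "c > 0"
  shows "\<forall>\<^sub>F i in G. \<bar>L i * Y i\<bar> < c"
proof -
  have "((\<lambda>i. L i * Y i) \<longlongrightarrow> 0 * x0) G" by (intro tendsto_mult at_right_0_D(1)[OF L] Y)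
  then have "\<forall>\<^sub>F i in G. dist (L i * Y i) 0 < c" using \<open>c > 0\<close> by (auto dest: tendstoD)
  then show ?thesis by (simp add: dist_real_def)
qed

context near_isometric_lifts
begin

lemma w_coord_Finv_uniform: "uniform_limit (hball R) (\<lambda>l w. w_coord l (Finv l w)) (\<lambda>w. w) (at_right 0)"
  by (rule uniform_limit_compactI'[OF compact_hball continuous_on_id])
    (use hball_subset in \<open>auto intro: Finv_asymptotics(1)\<close>)

lemma sine_Finv_uniform:
  "uniform_limit (hball R) (\<lambda>l w. Im (Finv l w) / cmod (Finv l w) / l) Im (at_right 0)"
proof (rule uniform_limit_compactI'[OF compact_hball])
  show "continuous_on (hball R) Im" by (intro continuous_intros)
  fix x0 and H :: "(real \<times> complex) filter"
  assume "x0 \<in> hball R" and H: "filterlim fst (at_right 0) H" "(snd \<longlongrightarrow> x0) H"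
  then have "x0 \<in> hplane" by (simp add: hball_def)
  then show "((\<lambda>p. Im (Finv (fst p) (snd p)) / cmod (Finv (fst p) (snd p)) / fst p) \<longlongrightarrow> Im x0) H"
    by (rule Finv_asymptotics(2)[OF H])
qed

text \<open>The bound is half the minimum of Im on the compact ball. It serves as the denominator in
  \<open>trm_norm\<close>.\<close>

lemma sine_Finv_lower:
  obtains c where "c > 0" "\<forall>\<^sub>F l in at_right 0. \<forall>w \<in> hball R. c \<le> Im (Finv l w) / cmod (Finv l w) / l"
proof (cases "hball R = {}")
  case True
  then show ?thesis using that[of 1] by simp
next
  case False
  have "\<exists>x\<in>hball R. \<forall>y\<in>hball R. Im x \<le> Im y"
    by (rule continuous_attains_inf[OF compact_hball False]) (intro continuous_intros)
  then obtain x where x: "x \<in> hball R" "\<And>y. y \<in> hball R \<Longrightarrow> Im x \<le> Im y" by blast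
  have x0: "Im x > 0" using x(1) by (simp add: hball_def hplane_Im)
  have "\<forall>\<^sub>F l in at_right 0. \<forall>w\<in>hball R. dist (Im (Finv l w) / cmod (Finv l w) / l) (Im w) < Im x / 2"
    by (rule uniform_limitD[OF sine_Finv_uniform]) (use x0 in simp)
  then have "\<forall>\<^sub>F l in at_right 0. \<forall>w \<in> hball R. Im x / 2 \<le> Im (Finv l w) / cmod (Finv l w) / l"
  proof eventually_elim
    case (elim l)
    show ?case
    proof
      fix w assume w: "w \<in> hball R"
      show "Im x / 2 \<le> Im (Finv l w) / cmod (Finv l w) / l"
        using bspec[OF elim w] x(2)[OF w] unfolding dist_real_def abs_less_iff by argo
    qed
  qed
  then show ?thesis using that[of "Im x / 2"] x0 by simp
qed

text \<open>The points exp (l Y) stay at bounded distance from the base point, so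
  \<open>F_lipschitz\<close> puts them into the component and their images into a fixed ball. The
  uniform convergence of \<open>w_coord\<close> after \<open>Finv\<close> is then evaluated at these
  images, which yields the limit of the inverse maps.\<close>

lemma F_exp_limit:
  assumes L: "filterlim L (at_right 0) G" and Y: "(Y \<longlongrightarrow> x0) G" and x0: "x0 \<in> hplane"
  shows "\<forall>\<^sub>F i in G. exp (of_real (L i) * Y i) \<in> \<A> (L i)"
    and "((\<lambda>i. F (L i) (exp (of_real (L i) * Y i))) \<longlongrightarrow> x0) G"
proof -
  define R where "R = hdist \<i> x0 + 1"
  have R: "R \<ge> 0" using hdist_nonneg[OF ii_hplane x0] by (simp add: R_def)
  have "chd \<i> x0 < cosh R"
    using hdist_less_iff[OF ii_hplane x0 R] by (simp add: R_def)
  then have "\<forall>\<^sub>F i in G. chd (exp (of_real (L i) * \<i>)) (exp (of_real (L i) * Y i)) < cosh R"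
    using chd_exp_limit[OF L Y x0] by (intro order_tendstoD)
  moreover have "\<forall>\<^sub>F i in G. L i \<in> {0<..<l0}"
    using small_l L by (rule eventually_compose_filterlim)
  moreover have "\<forall>\<^sub>F i in G. \<forall>w1 \<in> hball R. \<forall>z \<in> hplane. hdist (Finv (L i) w1) z \<le> R \<longrightarrow>
      z \<in> \<A> (L i) \<and> hdist w1 (F (L i) z) \<le> (1 + 1) * hdist (Finv (L i) w1) z"
    using F_lipschitz[OF zero_less_one order_refl, of R] L by (rule eventually_compose_filterlim)
  moreover have "\<forall>\<^sub>F i in G. \<bar>L i * Im (Y i)\<bar> < pi"
    using L tendsto_Im[OF Y] pi_gt_zero by (rule small_multiple)
  moreover have "\<forall>\<^sub>F i in G. Y i \<in> hplane"
    using Y open_hplane x0 by (rule topological_tendstoD)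
  ultimately have main: "\<forall>\<^sub>F i in G. exp (of_real (L i) * Y i) \<in> \<A> (L i) \<and>
      F (L i) (exp (of_real (L i) * Y i)) \<in> hball (2 * R) \<and>
      w_coord (L i) (Finv (L i) (F (L i) (exp (of_real (L i) * Y i)))) = Y i"
  proof eventually_elim
    case (elim i)
    note l = elim(2)
    have lpos: "L i > 0" using l by simp
    define e where "e = exp (of_real (L i) * Y i)"
    have e: "e \<in> hplane"
    proof -
      have "0 < L i * Im (Y i)" using elim(5) lpos by (simp add: hplane_Im)
      then have "sin (L i * Im (Y i)) > 0" using elim(4) by (intro sin_gt_zero) auto
      then show ?thesis by (simp add: e_def hplane_Im Im_exp)
    qed
    have b: "exp (of_real (L i) * \<i>) \<in> hplane" using base_point[OF l] \<A>_hplane[OF l] by blast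
    have Fi: "Finv (L i) \<i> = exp (of_real (L i) * \<i>)" using Finv_lattice[OF l, of 0] by simp
    have d: "hdist (exp (of_real (L i) * \<i>)) e < R" using hdist_less_iff[OF b e R] elim(1) by (simp add: e_def)
    have iR: "\<i> \<in> hball R" using R by (simp add: hball_def)
    have "hdist (Finv (L i) \<i>) e \<le> R" using d Fi by simp
    then have *: "e \<in> \<A> (L i)" "hdist \<i> (F (L i) e) \<le> (1 + 1) * hdist (Finv (L i) \<i>) e"
      using elim(3) iR e by blast+
    have "F (L i) e \<in> hball (2 * R)" using *(2) d Fi F_hplane[OF l *(1)] by (simp add: hball_def)
    moreover have "w_coord (L i) (Finv (L i) (F (L i) e)) = Y i"
      using Finv_F[OF l *(1)] w_coord_exp[OF lpos elim(4)] by (simp add: e_def)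
    ultimately show ?case using *(1) by (simp add: e_def)
  qed
  then show "\<forall>\<^sub>F i in G. exp (of_real (L i) * Y i) \<in> \<A> (L i)" by (auto elim: eventually_mono)
  have "((\<lambda>i. Y i - F (L i) (exp (of_real (L i) * Y i))) \<longlongrightarrow> 0) G"
  proof (rule tendstoI)
    fix \<epsilon> :: real assume "\<epsilon> > 0"
    then have "\<forall>\<^sub>F l in at_right 0. \<forall>w\<in>hball (2 * R). dist (w_coord l (Finv l w)) w < \<epsilon>"
      by (rule uniform_limitD[OF w_coord_Finv_uniform])
    then have "\<forall>\<^sub>F i in G. \<forall>w\<in>hball (2 * R). dist (w_coord (L i) (Finv (L i) w)) w < \<epsilon>"
      using L by (rule eventually_compose_filterlim)
    then show "\<forall>\<^sub>F i in G. dist (Y i - F (L i) (exp (of_real (L i) * Y i))) 0 < \<epsilon>"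
      using main
    proof eventually_elim
      case (elim i)
      then have "dist (w_coord (L i) (Finv (L i) (F (L i) (exp (of_real (L i) * Y i))))) (F (L i) (exp (of_real (L i) * Y i))) < \<epsilon>"
        by blast
      then show ?case using elim(2) by (simp add: dist_norm)
    qed
  qed
  from tendsto_diff[OF Y this]
  show "((\<lambda>i. F (L i) (exp (of_real (L i) * Y i))) \<longlongrightarrow> x0) G" by simp
qed

end

context degenerating_groups
begin

lemma isCont_element:
  assumes "A \<in> \<Gamma>" "w \<in> hplane" shows "isCont A w"
  using PSL2R_deriv(1)[OF subsetD[OF lim.PSL assms(1)] assms(2)] DERIV_isCont by blast

text \<open>In the coordinate w the element is A, preceded by \<open>F\<close> after
  \<open>w_coord_inv\<close> and followed by \<open>w_coord\<close> after \<open>Finv\<close>; both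
  outer maps tend to the identity.\<close>

lemma conjugate_limit:
  assumes L: "filterlim L (at_right 0) G" and Y: "(Y \<longlongrightarrow> x0) G" and x0: "x0 \<in> hplane" and A: "A \<in> \<Gamma>"
  shows "((\<lambda>i. w_coord (L i) (\<psi> (L i) A (w_coord_inv (L i) (Y i)))) \<longlongrightarrow> A x0) G"
proof -
  define W where "W = (\<lambda>i. F (L i) (exp (of_real (L i) * Y i)))"
  have W: "(W \<longlongrightarrow> x0) G" unfolding W_def by (rule F_exp_limit(2)[OF L Y x0])
  have AW: "((\<lambda>i. A (W i)) \<longlongrightarrow> A x0) G" by (rule isCont_tendsto_compose[OF isCont_element[OF A x0] W])
  have "((\<lambda>i. w_coord (L i) (Finv (L i) (A (W i)))) \<longlongrightarrow> A x0) G"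
    by (rule Finv_asymptotics(1)[OF L AW lim.hplane_closed[OF A x0]])
  moreover have "\<forall>\<^sub>F i in G. w_coord (L i) (Finv (L i) (A (W i))) = w_coord (L i) (\<psi> (L i) A (w_coord_inv (L i) (Y i)))"
    using F_exp_limit(1)[OF L Y x0] eventually_compose_filterlim[OF small_l L]
  proof eventually_elim
    case (elim i)
    have "W i \<in> hplane" unfolding W_def by (rule F_hplane[OF elim(2,1)])
    then have "Finv (L i) (A (W i)) = \<psi> (L i) A (Finv (L i) (W i))" using \<psi>_Finv[OF elim(2) A] by simp
    also have "Finv (L i) (W i) = w_coord_inv (L i) (Y i)"
      using Finv_F[OF elim(2,1)] by (simp add: W_def w_coord_inv_def)
    finally show ?case by simp
  qed
  ultimately show ?thesis by (rule Lim_transform_eventually)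
qed

lemma \<psi>_PSL: "l \<in> {0<..<l0} \<Longrightarrow> A \<in> \<Gamma> \<Longrightarrow> \<psi> l A \<in> PSL2R"
  using \<psi>_in discrete_group.PSL[OF \<Gamma>l_discrete] by blast

text \<open>The factor l from \<open>w_coord_inv\<close> and the factor 1 / l from
  \<open>w_coord\<close> cancel, which leaves the derivative of log (\<gamma> z) with respect to log
  z.\<close>

lemma conjugate_derivative:
  assumes l: "l \<in> {0<..<l0}" and A: "A \<in> \<Gamma>" and y: "0 < Im y" "l * Im y < pi"
  defines "e \<equiv> w_coord_inv l y"
  shows "((\<lambda>y. w_coord l (\<psi> l A (w_coord_inv l y))) has_field_derivative
      deriv (\<psi> l A) e * e / \<psi> l A e) (at y)"
proof -
  have lpos: "l > 0" using l by simp
  have eH: "e \<in> hplane"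
  proof -
    have "sin (l * Im y) > 0" using y lpos by (intro sin_gt_zero) auto
    then show ?thesis by (simp add: e_def w_coord_inv_def hplane_Im Im_exp)
  qed
  have PSL: "\<psi> l A \<in> PSL2R" by (rule \<psi>_PSL[OF l A])
  have \<gamma>e: "\<psi> l A e \<in> hplane" by (rule PSL2R_hplane[OF PSL eH])
  have 1: "(w_coord_inv l has_field_derivative of_real l * e) (at y)"
    unfolding e_def w_coord_inv_def by (auto intro!: derivative_eq_intros)
  have 2: "(\<psi> l A has_field_derivative deriv (\<psi> l A) e) (at (w_coord_inv l y))"
    using PSL2R_deriv(1)[OF PSL eH] by (simp add: e_def)
  have np: "\<psi> l A e \<notin> \<real>\<^sub>\<le>\<^sub>0" using \<gamma>e by (auto simp: hplane_Im complex_nonpos_Reals_iff)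
  have 3: "(w_coord l has_field_derivative inverse (\<psi> l A e) / of_real l) (at (\<psi> l A (w_coord_inv l y)))"
    unfolding w_coord_def e_def[symmetric] using np by (intro DERIV_cdivide has_field_derivative_Ln)
  have "((\<lambda>y. w_coord l (\<psi> l A (w_coord_inv l y))) has_field_derivative
      inverse (\<psi> l A e) / of_real l * (deriv (\<psi> l A) e * (of_real l * e))) (at y)"
    using DERIV_chain2[OF 3 DERIV_chain2[OF 2 1]] .
  also have "inverse (\<psi> l A e) / of_real l * (deriv (\<psi> l A) e * (of_real l * e)) = deriv (\<psi> l A) e * e / \<psi> l A e"
    using lpos by (simp add: divide_inverse)
  finally show ?thesis .
qed

lemma derivative_limit:
  assumes L: "filterlim L (at_right 0) G" and W: "(W \<longlongrightarrow> w0) G" and w0: "w0 \<in> hplane" and A: "A \<in> \<Gamma>"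
  shows "((\<lambda>i. deriv (\<psi> (L i) A) (Finv (L i) (W i)) * Finv (L i) (W i) / Finv (L i) (A (W i))) \<longlongrightarrow> deriv A w0) G"
\<comment> \<open>The theorem on derivatives of uniform limits requires a nontrivial filter.\<close>
proof (cases "G = bot")
  case True
  then show ?thesis by simp
next
  case False
  define \<zeta> where "\<zeta> = (\<lambda>i. w_coord (L i) (Finv (L i) (W i)))"
  have \<zeta>: "(\<zeta> \<longlongrightarrow> w0) G" unfolding \<zeta>_def by (rule Finv_asymptotics(1)[OF L W w0])
  obtain r where r: "r > 0" "cball w0 (2 * r) \<subseteq> hplane"
  proof -
    obtain \<rho> where "\<rho> > 0" "cball w0 \<rho> \<subseteq> hplane" using open_hplane w0 open_contains_cball by blast
    then show ?thesis using that[of "\<rho> / 2"] by simp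
  qed
  \<comment> \<open>The derivatives are wanted at the moving points \<zeta> i; the shift of the
    argument brings them all to the fixed point w0.\<close>
  define f where "f = (\<lambda>i x. w_coord (L i) (\<psi> (L i) A (w_coord_inv (L i) (x + (\<zeta> i - w0)))))"
  have sub: "cball w0 r \<subseteq> hplane" using r by (auto intro: subsetD[OF r(2)])
  have ul: "uniform_limit (cball w0 r) f A G"
  proof (rule uniform_limit_compactI'[OF compact_cball])
    show "continuous_on (cball w0 r) A"
      by (rule continuous_on_subset[OF PSL2R_continuous_on[OF subsetD[OF lim.PSL A]] sub])
    fix x0 and H :: "('a \<times> complex) filter"
    assume x0: "x0 \<in> cball w0 r" and H: "filterlim fst G H" "(snd \<longlongrightarrow> x0) H"
    have "filterlim (\<lambda>p. L (fst p)) (at_right 0) H" by (rule filterlim_compose[OF L H(1)])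
    moreover have "((\<lambda>p. snd p + (\<zeta> (fst p) - w0)) \<longlongrightarrow> x0 + (w0 - w0)) H"
      by (intro tendsto_intros H(2) filterlim_compose[OF \<zeta> H(1)])
    then have "((\<lambda>p. snd p + (\<zeta> (fst p) - w0)) \<longlongrightarrow> x0) H" by simp
    ultimately show "((\<lambda>p. f (fst p) (snd p)) \<longlongrightarrow> A x0) H"
      unfolding f_def using x0 sub A by (intro conjugate_limit) auto
  qed
  have ok: "\<forall>\<^sub>F i in G. L i \<in> {0<..<l0} \<and> W i \<in> hplane \<and> (\<forall>x\<in>ball w0 r. 0 < Im (x + (\<zeta> i - w0)) \<and> L i * Im (x + (\<zeta> i - w0)) < pi)"
  proof -
    have "\<forall>\<^sub>F i in G. dist (\<zeta> i) w0 < r" using \<zeta> r(1) by (rule tendstoD)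
    moreover have "\<forall>\<^sub>F i in G. \<bar>L i * (Im w0 + 2 * r)\<bar> < pi"
      by (rule small_multiple[OF L tendsto_const]) simp
    moreover have "\<forall>\<^sub>F i in G. W i \<in> hplane" using W open_hplane w0 by (rule topological_tendstoD)
    moreover have "\<forall>\<^sub>F i in G. L i \<in> {0<..<l0}" using small_l L by (rule eventually_compose_filterlim)
    ultimately show ?thesis
    proof eventually_elim
      case (elim i)
      have "0 < Im (x + (\<zeta> i - w0)) \<and> L i * Im (x + (\<zeta> i - w0)) < pi" if x: "x \<in> ball w0 r" for x
      proof -
        define y where "y = x + (\<zeta> i - w0)"
        have "dist w0 y \<le> dist w0 x + dist (\<zeta> i) w0"
        proof -
          have "w0 - y = (w0 - x) - (\<zeta> i - w0)" by (simp add: y_def)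
          then show ?thesis unfolding dist_norm by (metis norm_triangle_ineq4)
        qed
        then have d: "dist w0 y \<le> 2 * r" using x elim(1) by simp
        then have "y \<in> hplane" using r(2) by auto
        then have 1: "Im y > 0" by (simp add: hplane_Im)
        have "Im y \<le> Im w0 + 2 * r"
          using abs_Im_le_cmod[of "w0 - y"] d by (simp add: dist_norm)
        then have "L i * Im y \<le> L i * (Im w0 + 2 * r)" using elim(4) by (intro mult_left_mono) auto
        then show ?thesis using 1 elim(2) by (simp add: y_def)
      qed
      then show ?case using elim by blast
    qed
  qed
  have der: "(f i has_field_derivative deriv (\<psi> (L i) A) e * e / \<psi> (L i) A e) (at x)"
    if "L i \<in> {0<..<l0}" "0 < Im (x + (\<zeta> i - w0))" "L i * Im (x + (\<zeta> i - w0)) < pi"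
      and "e = w_coord_inv (L i) (x + (\<zeta> i - w0))" for i x e
    using DERIV_shift[THEN iffD1, OF conjugate_derivative[OF that(1) A that(2,3)]] unfolding f_def that(4) .
  have holo: "\<forall>\<^sub>F i in G. f i holomorphic_on ball w0 r"
    using ok
  proof eventually_elim
    case (elim i)
    show ?case
    proof (rule holomorphic_onI)
      fix x assume "x \<in> ball w0 r"
      then have "(f i has_field_derivative deriv (\<psi> (L i) A) (w_coord_inv (L i) (x + (\<zeta> i - w0))) *
          w_coord_inv (L i) (x + (\<zeta> i - w0)) / \<psi> (L i) A (w_coord_inv (L i) (x + (\<zeta> i - w0)))) (at x)"
        using elim by (intro der) auto
      then show "f i field_differentiable (at x within ball w0 r)"
        using field_differentiable_def field_differentiable_at_within by blast
    qed
  qed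
  have "uniform_limit (ball w0 r) f A G" by (rule uniform_limit_on_subset[OF ul]) auto
  then have "((\<lambda>i. (deriv ^^ 1) (f i) w0) \<longlongrightarrow> (deriv ^^ 1) A w0) G"
    by (rule higher_deriv_complex_uniform_limit[OF _ holo False]) (use r in auto)
  then have "((\<lambda>i. deriv (f i) w0) \<longlongrightarrow> deriv A w0) G" by simp
  moreover have "\<forall>\<^sub>F i in G. deriv (f i) w0 = deriv (\<psi> (L i) A) (Finv (L i) (W i)) * Finv (L i) (W i) / Finv (L i) (A (W i))"
    using ok
  proof eventually_elim
    case (elim i)
    then have l: "L i \<in> {0<..<l0}" and WH: "W i \<in> hplane" by auto
    have nz: "Finv (L i) (W i) \<noteq> 0" using Finv_hplane[OF l WH] by (auto simp: hplane_Im)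
    have e: "Finv (L i) (W i) = w_coord_inv (L i) (w0 + (\<zeta> i - w0))"
      using exp_w_coord[OF _ nz, of "L i"] l by (simp add: \<zeta>_def)
    have "w0 \<in> ball w0 r" using r by simp
    then have "0 < Im (w0 + (\<zeta> i - w0)) \<and> L i * Im (w0 + (\<zeta> i - w0)) < pi" using elim by blast
    then have "(f i has_field_derivative deriv (\<psi> (L i) A) (Finv (L i) (W i)) * Finv (L i) (W i) / \<psi> (L i) A (Finv (L i) (W i))) (at w0)"
      by (elim conjE) (rule der[OF l _ _ e])
    then show ?case using \<psi>_Finv[OF l A WH] by (simp add: DERIV_imp_deriv)
  qed
  ultimately show ?thesis by (rule Lim_transform_eventually)
qed

text \<open>The tangent vector \<open>l * Finv l w * v\<close> is the image of v under the
  differential of \<open>w_coord_inv l\<close> at the coordinate of \<open>Finv l w\<close>, so this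
  is the coefficient of a single term in the coordinate w.\<close>

definition trm :: "complex \<Rightarrow> complex \<Rightarrow> real \<Rightarrow> (complex \<Rightarrow> complex) \<Rightarrow> complex \<Rightarrow> complex" where
  "trm s v l A w = 1 / of_real l powr s *
     pull_back (\<psi> l A) (hyperbolic_form s) (Finv l w) (of_real l * Finv l w * v)"

text \<open>The factor l of the tangent vector takes one power out of l^(-s), and the remaining
  exponent s - 1 scales the sine. All bases are positive reals, so the complex powers split as exp
  of multiples of real logarithms.\<close>

lemma trm_eq:
  assumes l: "l \<in> {0<..<l0}" and A: "A \<in> \<Gamma>" and w: "w \<in> hplane"
  shows "trm s v l A w = of_real (Im (Finv l (A w)) / cmod (Finv l (A w)) / l) powr (s - 1) *
     of_real (Im (deriv (\<psi> l A) (Finv l w) * Finv l w / Finv l (A w) * v))"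
proof -
  have lpos: "l > 0" using l by simp
  define z' where "z' = Finv l (A w)"
  have z': "z' \<in> hplane" unfolding z'_def by (intro Finv_hplane[OF l] lim.hplane_closed[OF A w])
  define u where "u = Im z' / cmod z'"
  have u: "u > 0" using z' by (auto simp: u_def hplane_Im intro!: divide_pos_pos)
  have pw: "complex_of_real x powr a = exp (a * of_real (ln x))" if "x > 0" for x :: real and a :: complex
    using that by (simp add: powr_def Ln_of_real)
  have P1: "1 / complex_of_real l powr s * (of_real u powr (s - 1) * of_real l) = of_real (u / l) powr (s - 1)"
  proof -
    have "complex_of_real l = exp (of_real (ln l))" using lpos by (simp add: exp_of_real)
    then have "1 / complex_of_real l powr s * (of_real u powr (s - 1) * of_real l)
        = exp (- (s * of_real (ln l))) * (exp ((s - 1) * of_real (ln u)) * exp (of_real (ln l)))"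
      using u lpos by (metis pw exp_minus inverse_eq_divide)
    also have "\<dots> = exp ((s - 1) * (of_real (ln u) - of_real (ln l)))"
      by (simp add: exp_add[symmetric] algebra_simps)
    also have "\<dots> = exp ((s - 1) * of_real (ln (u / l)))"
      using u lpos by (simp add: ln_div)
    also have "\<dots> = of_real (u / l) powr (s - 1)"
      by (rule pw[symmetric]) (use u lpos in simp)
    finally show ?thesis .
  qed
  have P2: "of_real (Im (inverse z' * (deriv (\<psi> l A) (Finv l w) * (of_real l * Finv l w * v))))
      = complex_of_real l * of_real (Im (deriv (\<psi> l A) (Finv l w) * Finv l w / z' * v))"
  proof -
    have "inverse z' * (deriv (\<psi> l A) (Finv l w) * (of_real l * Finv l w * v))
      = of_real l * (deriv (\<psi> l A) (Finv l w) * Finv l w / z' * v)"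
      by (simp add: divide_inverse mult_ac)
    then have "Im (inverse z' * (deriv (\<psi> l A) (Finv l w) * (of_real l * Finv l w * v)))
      = l * Im (deriv (\<psi> l A) (Finv l w) * Finv l w / z' * v)"
      by (simp only: times_complex.sel Re_complex_of_real Im_complex_of_real)
    then show ?thesis by (simp only: of_real_mult)
  qed
  show ?thesis
    unfolding trm_def pull_back_def hyperbolic_form_def \<psi>_Finv[OF l A w] z'_def[symmetric] u_def[symmetric]
      P2 P1[symmetric] by (simp only: mult.assoc)
qed

text \<open>By \<open>PSL2R_deriv\<close> the derivative in the coordinate w has as modulus the
  quotient of the scaled heights at A w and at w. This raises the exponent Re s - 1 to Re s and
  leaves the height at w in the denominator.\<close>

lemma trm_norm:
  assumes l: "l \<in> {0<..<l0}" and A: "A \<in> \<Gamma>" and w: "w \<in> hplane" and v: "cmod v \<le> 1"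
    and c: "0 < c" "c \<le> Im (Finv l w) / cmod (Finv l w) / l"
  shows "cmod (trm s v l A w) \<le> (Im (Finv l (A w)) / cmod (Finv l (A w)) / l) powr Re s / c"
proof -
  have lpos: "l > 0" using l by simp
  define z where "z = Finv l w"
  define z' where "z' = Finv l (A w)"
  have z': "z' \<in> hplane" unfolding z'_def by (intro Finv_hplane[OF l] lim.hplane_closed[OF A w])
  have z: "z \<in> hplane" unfolding z_def by (rule Finv_hplane[OF l w])
  have nz: "cmod z > 0" "cmod z' > 0" "Im z > 0" "Im z' > 0" using z z' by (auto simp: hplane_Im)
  define u where "u = Im z' / cmod z' / l"
  have u: "u > 0" using nz lpos by (simp add: u_def)
  have "cmod (deriv (\<psi> l A) z) = Im z' / Im z"
    using PSL2R_deriv(2)[OF \<psi>_PSL[OF l A] z] \<psi>_Finv[OF l A w] by (simp add: z_def z'_def)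
  then have "cmod (deriv (\<psi> l A) z * z / z') = u / (Im z / cmod z / l)"
    using nz lpos by (simp add: norm_mult norm_divide u_def)
  also have "\<dots> \<le> u / c"
    using c u unfolding z_def by (intro frac_le) simp_all
  finally have d: "cmod (deriv (\<psi> l A) z * z / z') \<le> u / c" .
  have "cmod (trm s v l A w) = u powr (Re s - 1) * \<bar>Im (deriv (\<psi> l A) z * z / z' * v)\<bar>"
    unfolding trm_eq[OF l A w] z_def[symmetric] z'_def[symmetric] u_def[symmetric]
    using u by (simp add: norm_mult norm_powr_real_powr)
  also have "\<dots> \<le> u powr (Re s - 1) * (u / c)"
  proof (rule mult_left_mono)
    have "\<bar>Im (deriv (\<psi> l A) z * z / z' * v)\<bar> \<le> cmod (deriv (\<psi> l A) z * z / z') * cmod v"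
      using abs_Im_le_cmod norm_mult by metis
    also have "\<dots> \<le> cmod (deriv (\<psi> l A) z * z / z') * 1" using v by (intro mult_left_mono) auto
    finally show "\<bar>Im (deriv (\<psi> l A) z * z / z' * v)\<bar> \<le> u / c" using d by simp
  qed simp
  also have "\<dots> = u powr Re s / c" using u by (simp add: powr_diff)
  finally show ?thesis by (simp add: u_def z'_def)
qed

lemma trm_limit:
  assumes L: "filterlim L (at_right 0) G" and W: "(W \<longlongrightarrow> w0) G" and w0: "w0 \<in> hplane" and A: "A \<in> \<Gamma>"
  shows "((\<lambda>i. trm s v (L i) A (W i)) \<longlongrightarrow> pull_back A (horocyclic_form s) w0 v) G"
proof -
  have Aw0: "A w0 \<in> hplane" by (rule lim.hplane_closed[OF A w0])
  have AW: "((\<lambda>i. A (W i)) \<longlongrightarrow> A w0) G" by (rule isCont_tendsto_compose[OF isCont_element[OF A w0] W])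
  define u where "u = (\<lambda>i. Im (Finv (L i) (A (W i))) / cmod (Finv (L i) (A (W i))) / L i)"
  define d where "d = (\<lambda>i. deriv (\<psi> (L i) A) (Finv (L i) (W i)) * Finv (L i) (W i) / Finv (L i) (A (W i)))"
  have u: "(u \<longlongrightarrow> Im (A w0)) G" unfolding u_def by (rule Finv_asymptotics(2)[OF L AW Aw0])
  have d: "(d \<longlongrightarrow> deriv A w0) G" unfolding d_def by (rule derivative_limit[OF L W w0 A])
  have np: "complex_of_real (Im (A w0)) \<notin> \<real>\<^sub>\<le>\<^sub>0" using Aw0 by (simp add: hplane_Im complex_nonpos_Reals_iff)
  have "((\<lambda>i. of_real (u i) powr (s - 1) * of_real (Im (d i * v))) \<longlongrightarrow>
      of_real (Im (A w0)) powr (s - 1) * of_real (Im (deriv A w0 * v))) G"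
    by (intro tendsto_mult tendsto_powr_complex tendsto_of_real tendsto_Im u d tendsto_const np)
  moreover have "\<forall>\<^sub>F i in G. of_real (u i) powr (s - 1) * of_real (Im (d i * v)) = trm s v (L i) A (W i)"
    using eventually_compose_filterlim[OF small_l L] topological_tendstoD[OF W open_hplane w0]
    by eventually_elim (use trm_eq[OF _ A] in \<open>simp add: u_def d_def\<close>)
  ultimately have "((\<lambda>i. trm s v (L i) A (W i)) \<longlongrightarrow> of_real (Im (A w0)) powr (s - 1) * of_real (Im (deriv A w0 * v))) G"
    by (rule Lim_transform_eventually)
  then show ?thesis by (simp add: pull_back_def horocyclic_form_def)
qed

lemma horocyclic_continuous:
  assumes A: "A \<in> \<Gamma>"
  shows "continuous_on hplane (\<lambda>w. pull_back A (horocyclic_form s) w v)"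
proof -
  have PSL: "A \<in> PSL2R" using lim.PSL A by blast
  have "continuous_on hplane (deriv A)"
    by (intro holomorphic_on_imp_continuous_on holomorphic_deriv PSL2R_holomorphic[OF PSL] open_hplane)
  moreover have "0 \<le> Im (A w)" "Im (A w) \<noteq> 0" if "w \<in> hplane" for w
    using lim.hplane_closed[OF A that] by (auto simp: hplane_Im)
  ultimately show ?thesis
    unfolding pull_back_def horocyclic_form_def
    using PSL2R_continuous_on[OF PSL] by (intro continuous_intros) auto
qed

lemma trm_uniform:
  assumes A: "A \<in> \<Gamma>"
  shows "uniform_limit (hball R) (\<lambda>l w. trm s v l A w) (\<lambda>w. pull_back A (horocyclic_form s) w v) (at_right 0)"
  by (rule uniform_limit_compactI'[OF compact_hball continuous_on_subset[OF horocyclic_continuous[OF A] hball_subset]])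
    (use hball_subset A in \<open>auto intro: trm_limit\<close>)

text \<open>\<open>coset_sum_transfer\<close> re-indexes the series by cosets of translations in
  \<Gamma>. The form is invariant because a dilation changes neither Im z / |z| nor dz / z.\<close>

lemma alpha_form_eq:
  assumes l: "l \<in> {0<..<l0}" and w: "w \<in> hplane"
  shows "1 / of_real l powr s * pull_back (w_coord_inv l) (alpha_form (\<Gamma>l l) l s) (w_coord l (Finv l w)) v
    = (\<Sum>\<^sub>\<infinity>X\<in>cosets. trm s v l (rep X) w)"
proof -
  have lpos: "l > 0" using l by simp
  interpret G: discrete_group "\<Gamma>l l" by (rule \<Gamma>l_discrete[OF l])
  define z where "z = Finv l w"
  have z: "z \<in> hplane" unfolding z_def by (rule Finv_hplane[OF l w])
  then have nz: "z \<noteq> 0" by (auto simp: hplane_Im)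
  have inv: "w_coord_inv l (w_coord l z) = z" using exp_w_coord nz lpos by simp
  have "(w_coord_inv l has_field_derivative of_real l * w_coord_inv l (w_coord l z)) (at (w_coord l z))"
    unfolding w_coord_inv_def by (auto intro!: derivative_eq_intros)
  then have d: "deriv (w_coord_inv l) (w_coord l z) = of_real l * z" using inv by (simp add: DERIV_imp_deriv)
  define \<Delta> where "\<Delta> = group_generated_by (dilation l)"
  have \<Delta>: "\<Delta> = (\<lambda>n. dilation (of_int n * l)) ` UNIV" unfolding \<Delta>_def by (rule group_generated_by_dilation)
  have "alpha_form (\<Gamma>l l) l s z (of_real l * z * v) = coset_sum \<Delta> (\<Gamma>l l) (hyperbolic_form s) z (of_real l * z * v)"
    unfolding alpha_form_def \<Delta>_def hyperbolic_form_def[abs_def] ..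
  also have "\<dots> = (\<Sum>\<^sub>\<infinity> X \<in> rcosets\<^bsub>(BijGroup hplane)\<lparr>carrier := \<Gamma>\<rparr>\<^esub> (range translate).
      pull_back (inv_into (\<Gamma>l l) (\<phi> l) (SOME A. A \<in> X)) (hyperbolic_form s) z (of_real l * z * v))"
  proof (rule coset_sum_transfer[OF \<Gamma>l_discrete[OF l] lim.discrete_group_axioms \<phi>_bij[OF l] \<phi>_compose[OF l]])
    show "\<Delta> \<subseteq> \<Gamma>l l" unfolding \<Delta> using dilations_in[OF l] by auto
    show "\<phi> l ` \<Delta> = range translate" unfolding \<Delta> image_image \<phi>_dilation[OF l] ..
    have "(\<lambda>z\<in>hplane. z) = dilation (of_int 0 * l)" by (simp add: dilation_def restrict_def)
    then show "(\<lambda>z\<in>hplane. z) \<in> \<Delta>" unfolding \<Delta> by blast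
    fix D \<gamma> assume D: "D \<in> \<Delta>" and \<gamma>: "\<gamma> \<in> \<Gamma>l l"
    obtain n where n: "D = dilation (of_int n * l)" using D unfolding \<Delta> by auto
    have \<gamma>z: "\<gamma> z \<in> hplane" by (rule G.hplane_closed[OF \<gamma> z])
    define a where "a = exp (of_int n * l)"
    have "((\<lambda>x. of_real a * \<gamma> x) has_field_derivative of_real a * deriv \<gamma> z) (at z)"
      using PSL2R_deriv(1)[OF subsetD[OF G.PSL \<gamma>] z] by (intro DERIV_cmult)
    then have "(compose hplane D \<gamma> has_field_derivative of_real a * deriv \<gamma> z) (at z)"
      by (rule has_field_derivative_transform_within_open[OF _ open_hplane z])
        (use G.hplane_closed[OF \<gamma>] in \<open>simp add: n dilation_def compose_eq a_def\<close>)
    then have dc: "deriv (compose hplane D \<gamma>) z = of_real a * deriv \<gamma> z" by (rule DERIV_imp_deriv)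
    have cz: "compose hplane D \<gamma> z = of_real a * \<gamma> z"
      using z \<gamma>z by (simp add: n compose_eq dilation_def a_def)
    have a: "a > 0" by (simp add: a_def)
    have nz': "\<gamma> z \<noteq> 0" using \<gamma>z by (auto simp: hplane_Im)
    have sc: "inverse (of_real a * \<gamma> z) * (of_real a * deriv \<gamma> z * x) = inverse (\<gamma> z) * (deriv \<gamma> z * x)" for x
      using a nz' by (simp add: field_simps)
    have sn: "Im (of_real a * \<gamma> z) / cmod (of_real a * \<gamma> z) = Im (\<gamma> z) / cmod (\<gamma> z)"
      using a by (simp add: norm_mult)
    show "pull_back (compose hplane D \<gamma>) (hyperbolic_form s) z (of_real l * z * v) = pull_back \<gamma> (hyperbolic_form s) z (of_real l * z * v)"
      unfolding pull_back_def hyperbolic_form_def cz dc sc sn ..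
  qed
  also have "\<dots> = (\<Sum>\<^sub>\<infinity>X\<in>cosets. pull_back (\<psi> l (rep X)) (hyperbolic_form s) z (of_real l * z * v))"
    unfolding cosets_def \<psi>_def rep_def ..
  finally have "alpha_form (\<Gamma>l l) l s z (of_real l * z * v)
    = (\<Sum>\<^sub>\<infinity>X\<in>cosets. pull_back (\<psi> l (rep X)) (hyperbolic_form s) z (of_real l * z * v))" .
  then have "1 / of_real l powr s * pull_back (w_coord_inv l) (alpha_form (\<Gamma>l l) l s) (w_coord l z) v
    = 1 / of_real l powr s * (\<Sum>\<^sub>\<infinity>X\<in>cosets. pull_back (\<psi> l (rep X)) (hyperbolic_form s) z (of_real l * z * v))"
    unfolding pull_back_def[of "w_coord_inv l"] inv d by simp
  also have "\<dots> = (\<Sum>\<^sub>\<infinity>X\<in>cosets. trm s v l (rep X) w)"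
    unfolding trm_def z_def[symmetric] by (rule infsum_cmult_right'[symmetric])
  finally show ?thesis by (simp add: z_def)
qed

lemma eisenstein_eq:
  "Im_horocyclic_eisenstein \<Gamma> s w v = (\<Sum>\<^sub>\<infinity>X\<in>cosets. pull_back (rep X) (horocyclic_form s) w v)"
  unfolding Im_horocyclic_eisenstein_def coset_sum_def cusp group_generated_by_translation
    cosets_def rep_def horocyclic_form_def[abs_def] ..

theorem series_converges:
  assumes s: "Re s > 1" and v: "cmod v \<le> 1"
  shows "uniform_limit (hball R)
     (\<lambda>l w. 1 / of_real l powr s * pull_back (w_coord_inv l) (alpha_form (\<Gamma>l l) l s) (w_coord l (Finv l w)) v)
     (\<lambda>w. Im_horocyclic_eisenstein \<Gamma> s w v) (at_right 0)"
proof -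
  have "uniform_limit (hball R) (\<lambda>l w. \<Sum>\<^sub>\<infinity>X\<in>cosets. trm s v l (rep X) w)
      (\<lambda>w. \<Sum>\<^sub>\<infinity>X\<in>cosets. pull_back (rep X) (horocyclic_form s) w v) (at_right 0)"
  proof (rule uniform_limit_infsum)
    show "uniform_limit (hball R) (\<lambda>l w. trm s v l (rep X) w) (\<lambda>w. pull_back (rep X) (horocyclic_form s) w v) (at_right 0)"
      if "X \<in> cosets" for X
      by (rule trm_uniform[OF rep_in(2)[OF that]])
    fix e :: real assume e: "e > 0"
    obtain c where c: "c > 0" "\<forall>\<^sub>F l in at_right 0. \<forall>w \<in> hball R. c \<le> Im (Finv l w) / cmod (Finv l w) / l"
      by (rule sine_Finv_lower[of R]) (rule that; assumption)
    \<comment> \<open>\<open>trm_norm\<close> divides by c, so the heights must have tails below e *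
      c.\<close>
    have "e * c > 0" using e c by simp
    then obtain E where E: "finite E" "E \<subseteq> cosets" "\<forall>\<^sub>F l in at_right 0. \<forall>w \<in> hball R. \<forall>E'. finite E' \<and> E' \<subseteq> cosets - E \<longrightarrow>
      (\<Sum>X\<in>E'. (Im (Finv l (rep X w)) / cmod (Finv l (rep X w)) / l) powr Re s) \<le> e * c"
      by (rule height_sum_tail[OF s, of "e * c" R]) (rule that; assumption)
    have "\<forall>\<^sub>F l in at_right 0. \<forall>w\<in>hball R. \<forall>E'. finite E' \<and> E' \<subseteq> cosets - E \<longrightarrow> (\<Sum>X\<in>E'. norm (trm s v l (rep X) w)) \<le> e"
      using E(3) c(2) small_l
    proof eventually_elim
      case (elim l)
      show ?case
      proof (intro ballI allI impI)
        fix w E' assume w: "w \<in> hball R" and E': "finite E' \<and> E' \<subseteq> cosets - E"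
        have wH: "w \<in> hplane" using w by (simp add: hball_def)
        have "(\<Sum>X\<in>E'. norm (trm s v l (rep X) w)) \<le> (\<Sum>X\<in>E'. (Im (Finv l (rep X w)) / cmod (Finv l (rep X w)) / l) powr Re s / c)"
          using E' elim(2) w c(1) by (intro sum_mono trm_norm[OF elim(3) rep_in(2) wH v]) auto
        also have "\<dots> = (\<Sum>X\<in>E'. (Im (Finv l (rep X w)) / cmod (Finv l (rep X w)) / l) powr Re s) / c"
          by (simp add: sum_divide_distrib)
        also have "\<dots> \<le> e * c / c" using elim(1) w E' c(1) by (intro divide_right_mono) auto
        also have "\<dots> = e" using c(1) by simp
        finally show "(\<Sum>X\<in>E'. norm (trm s v l (rep X) w)) \<le> e" .
      qed
    qed
    then show "\<exists>E. finite E \<and> E \<subseteq> cosets \<and> (\<forall>\<^sub>F l in at_right 0. \<forall>w\<in>hball R. \<forall>E'. finite E' \<and> E' \<subseteq> cosets - E \<longrightarrow>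
        (\<Sum>X\<in>E'. norm (trm s v l (rep X) w)) \<le> e)"
      using E(1,2) by blast
  qed simp
  moreover have "\<forall>\<^sub>F l in at_right 0. \<forall>w\<in>hball R. (\<Sum>\<^sub>\<infinity>X\<in>cosets. trm s v l (rep X) w)
      = 1 / of_real l powr s * pull_back (w_coord_inv l) (alpha_form (\<Gamma>l l) l s) (w_coord l (Finv l w)) v"
    using small_l
  proof eventually_elim
    case (elim l)
    show ?case
      using alpha_form_eq[OF elim] hball_subset by (metis subsetD)
  qed
  ultimately show ?thesis
    unfolding eisenstein_eq using uniform_limit_cong[THEN iffD1] by (smt (verit) eventually_mono uniform_limit_cong)
qed

end

section \<open>The component of the complement of the lifts of the pinched geodesic\<close>

lemma PSL2R_compose:
  assumes "A \<in> PSL2R" "B \<in> PSL2R"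
  shows "compose hplane A B \<in> PSL2R"
proof -
  obtain a b c d :: real where det: "a * d - b * c = 1"
    and A: "A = (\<lambda>z\<in>hplane. (complex_of_real a * z + of_real b) / (of_real c * z + of_real d))"
    using PSL2R_cases[OF assms(1)] .
  obtain a' b' c' d' :: real where det': "a' * d' - b' * c' = 1"
    and B: "B = (\<lambda>z\<in>hplane. (complex_of_real a' * z + of_real b') / (of_real c' * z + of_real d'))"
    using PSL2R_cases[OF assms(2)] .
  have "(a * a' + b * c') * (c * b' + d * d') - (a * b' + b * d') * (c * a' + d * c') = (a * d - b * c) * (a' * d' - b' * c')"
    by (simp add: algebra_simps)
  then have det2: "(a * a' + b * c') * (c * b' + d * d') - (a * b' + b * d') * (c * a' + d * c') = 1"
    by (simp add: det det')
  have "A (B z) = (complex_of_real (a * a' + b * c') * z + of_real (a * b' + b * d')) / (of_real (c * a' + d * c') * z + of_real (c * b' + d * d'))"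
    if z: "z \<in> hplane" for z
  proof -
    define N where "N = complex_of_real c' * z + of_real d'"
    have N: "N \<noteq> 0" using moebius_denominator_nz[OF det' z] by (simp add: N_def)
    have Bz: "B z = (of_real a' * z + of_real b') / N" using z by (simp add: B N_def)
    then have 1: "of_real x * B z + of_real y = (of_real x * (of_real a' * z + of_real b') + of_real y * N) / N" for x y :: real
      unfolding Bz using N by (simp add: field_simps)
    have "A (B z) = (of_real a * B z + of_real b) / (of_real c * B z + of_real d)"
      using PSL2R_hplane[OF assms(2) z] by (simp add: A)
    also have "\<dots> = (of_real a * (of_real a' * z + of_real b') + of_real b * N) / (of_real c * (of_real a' * z + of_real b') + of_real d * N)"
      unfolding 1 using N by simp
    also have "of_real a * (of_real a' * z + of_real b') + of_real b * N = complex_of_real (a * a' + b * c') * z + of_real (a * b' + b * d')"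
      by (simp add: N_def algebra_simps)
    also have "of_real c * (of_real a' * z + of_real b') + of_real d * N = complex_of_real (c * a' + d * c') * z + of_real (c * b' + d * d')"
      by (simp add: N_def algebra_simps)
    finally show ?thesis .
  qed
  then have "compose hplane A B = (\<lambda>z\<in>hplane. (complex_of_real (a * a' + b * c') * z + of_real (a * b' + b * d')) / (of_real (c * a' + d * c') * z + of_real (c * b' + d * d')))"
    by (auto simp: compose_def restrict_def fun_eq_iff)
  with det2 show ?thesis unfolding PSL2R_def mem_Collect_eq by (intro exI conjI)
qed

text \<open>In the coordinates \<open>(Re z, |z|\<^sup>2)\<close> of the Klein model, hyperbolic half-planes are Euclidean
  half-planes, so that their intersections are convex.\<close>

lemma connected_halfplane_intersection:
  assumes "\<And>B. B \<in> \<B> \<Longrightarrow> B \<in> PSL2R"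
  shows "connected {z \<in> hplane. \<forall>B\<in>\<B>. Re (B z) < 0}"
proof -
  have "\<exists>\<alpha> \<beta> \<delta>. \<forall>z\<in>hplane. Re (B z) < 0 \<longleftrightarrow> \<alpha> * (cmod z)\<^sup>2 + \<beta> * Re z + \<delta> < 0" if "B \<in> \<B>" for B
    by (rule PSL2R_halfplane[OF assms[OF that]]) blast
  then obtain \<alpha> \<beta> \<delta> where half: "\<And>B z. B \<in> \<B> \<Longrightarrow> z \<in> hplane \<Longrightarrow>
      Re (B z) < 0 \<longleftrightarrow> \<alpha> B * (cmod z)\<^sup>2 + \<beta> B * Re z + \<delta> B < 0" by metis
  \<comment> \<open>The image of the half-plane under z \<mapsto> Re z + \<i> |z|^2, a convex region
    above a parabola; \<open>h\<close> is the inverse map.\<close>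
  define P where "P = {q. (Re q)\<^sup>2 < Im q}"
  define C where "C = P \<inter> (\<Inter>B\<in>\<B>. {q. Complex (\<beta> B) (\<alpha> B) \<bullet> q < - \<delta> B})"
  define h where "h = (\<lambda>q. Complex (Re q) (sqrt (Im q - (Re q)\<^sup>2)))"
  have "convex P"
  proof (rule convexI)
    fix x y :: complex and u v :: real
    assume x: "x \<in> P" and y: "y \<in> P" and uv: "0 \<le> u" "0 \<le> v" "u + v = 1"
    have v: "v = 1 - u" using uv by simp
    have "u * (Re x)\<^sup>2 + v * (Re y)\<^sup>2 - (u * Re x + v * Re y)\<^sup>2 = u * v * (Re x - Re y)\<^sup>2"
      unfolding v by (simp add: power2_eq_square algebra_simps)
    moreover have "u * v * (Re x - Re y)\<^sup>2 \<ge> 0" using uv by simp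
    ultimately have "(u * Re x + v * Re y)\<^sup>2 \<le> u * (Re x)\<^sup>2 + v * (Re y)\<^sup>2" by linarith
    also have "\<dots> < u * Im x + v * Im y"
    proof (cases "u = 0")
      case True
      then show ?thesis using y uv by (simp add: P_def)
    next
      case False
      then have "u * (Re x)\<^sup>2 < u * Im x" using x uv by (simp add: P_def)
      moreover have "v * (Re y)\<^sup>2 \<le> v * Im y" using y uv by (intro mult_left_mono) (auto simp: P_def)
      ultimately show ?thesis by simp
    qed
    finally show "u *\<^sub>R x + v *\<^sub>R y \<in> P" by (simp add: P_def)
  qed
  then have "convex C" unfolding C_def by (intro convex_Int convex_INT convex_halfspace_lt)
  then have "connected C" by (rule convex_connected)
  moreover have "continuous_on C h" unfolding h_def complex_eq_iff
    by (intro continuous_on_Complex continuous_intros)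
  ultimately have "connected (h ` C)" by (rule connected_continuous_image[rotated])
  also have "h ` C = {z \<in> hplane. \<forall>B\<in>\<B>. Re (B z) < 0}"
  proof (intro equalityI subsetI)
    fix z assume "z \<in> h ` C"
    then obtain q where q: "q \<in> C" "z = h q" by auto
    then have qP: "(Re q)\<^sup>2 < Im q" by (simp add: C_def P_def)
    then have zH: "z \<in> hplane" by (simp add: q(2) h_def hplane_Im)
    have "(cmod z)\<^sup>2 = Im q" "Re z = Re q" using qP by (simp_all add: q(2) h_def cmod_power2)
    then show "z \<in> {z \<in> hplane. \<forall>B\<in>\<B>. Re (B z) < 0}"
      using q(1) zH half by (auto simp: C_def inner_complex_def algebra_simps)
  next
    fix z assume z: "z \<in> {z \<in> hplane. \<forall>B\<in>\<B>. Re (B z) < 0}"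
    define q where "q = Complex (Re z) ((cmod z)\<^sup>2)"
    have "Im z > 0" using z by (simp add: hplane_Im)
    then have "h q = z" by (simp add: q_def h_def cmod_power2 complex_eq_iff)
    moreover have "q \<in> C"
      using z half \<open>Im z > 0\<close> by (auto simp: C_def P_def q_def inner_complex_def cmod_power2[of z] algebra_simps)
    ultimately show "z \<in> h ` C" by (metis imageI)
  qed
  finally show ?thesis .
qed

lemma connected_avoiding_zero:
  fixes f :: "complex \<Rightarrow> real"
  assumes "connected A" "continuous_on A f" "\<And>z. z \<in> A \<Longrightarrow> f z \<noteq> 0" "x \<in> A" "f x < 0" "z \<in> A"
  shows "f z < 0"
proof (rule ccontr)
  assume "\<not> f z < 0"
  then have "0 \<in> {f x..f z}" using assms(5) by simp
  also have "{f x..f z} \<subseteq> f ` A"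
    using connected_continuous_image[OF assms(2,1)] assms(4,6) by (intro connected_contains_Icc) auto
  finally show False using assms(3) by auto
qed

text \<open>The lifts of the funnel are half-planes, and the component is the intersection of their
  complements; hence the whole group preserves it.\<close>

lemma component_right_of_funnel:
  assumes PSL: "\<Gamma> \<subseteq> PSL2R" and sub: "subgroup \<Gamma> (BijGroup hplane)"
    and fib: "\<And>z w. z \<in> hplane \<Longrightarrow> w \<in> hplane \<Longrightarrow> p z = p w \<longleftrightarrow> (\<exists>\<gamma>\<in>\<Gamma>. w = \<gamma> z)"
    and fnl: "funnel p F1 c" and right: "p ` right_collar_cover l \<subseteq> - F1" and axis: "axis_is_lift p l c"
    and A: "A \<in> components {z \<in> hplane. p z \<notin> c}" "right_collar_cover l \<subseteq> A"
    and l: "0 < l" "l < pi / 2"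
  shows "\<And>z. z \<in> A \<Longrightarrow> Re z > 0 \<and> Im z > 0" "\<And>\<gamma> z. \<gamma> \<in> \<Gamma> \<Longrightarrow> z \<in> A \<Longrightarrow> \<gamma> z \<in> A"
proof -
  obtain B m where B: "B \<in> PSL2R" and F1: "F1 = (p \<circ> B) ` {z \<in> hplane. Re z > 0}"
    and c: "c = (p \<circ> B) ` {z \<in> hplane. Re z = 0}"
    using fnl unfolding funnel_def by blast
  obtain B' where B': "B' \<in> PSL2R" "\<And>z. z \<in> hplane \<Longrightarrow> B' (B z) = z" "\<And>z. z \<in> hplane \<Longrightarrow> B (B' z) = z"
    by (rule PSL2R_inverse[OF B]) (rule that; assumption)
  have H: "\<gamma> z \<in> hplane" if "\<gamma> \<in> \<Gamma>" "z \<in> hplane" for \<gamma> z using PSL2R_hplane PSL that by blast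
  have p\<gamma>: "p (\<gamma> z) = p z" if "\<gamma> \<in> \<Gamma>" "z \<in> hplane" for \<gamma> z
    using fib[OF that(2) H[OF that]] that(1) by auto
  have Bij: "\<gamma> \<in> Bij hplane" if "\<gamma> \<in> \<Gamma>" for \<gamma>
    using subgroup.mem_carrier[OF sub that] by (simp add: BijGroup_carrier)
  have comp: "compose hplane \<gamma>' \<gamma> \<in> \<Gamma>" if "\<gamma> \<in> \<Gamma>" "\<gamma>' \<in> \<Gamma>" for \<gamma> \<gamma>'
    using subgroup.m_closed[OF sub that(2,1)] by (simp add: BijGroup_mult Bij that)
  define \<Omega> where "\<Omega> = {z \<in> hplane. p z \<notin> c}"
  \<comment> \<open>The points outside all lifts of the funnel and of its boundary; the aim is that
    this set is the whole component.\<close>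
  define D where "D = {z \<in> hplane. \<forall>C \<in> compose hplane B' ` \<Gamma>. Re (C z) < 0}"
  have D_iff: "z \<in> D \<longleftrightarrow> z \<in> hplane \<and> (\<forall>\<gamma>\<in>\<Gamma>. Re (B' (\<gamma> z)) < 0)" for z
    by (auto simp: D_def compose_eq)
  have "connected D" unfolding D_def
    by (rule connected_halfplane_intersection) (use PSL2R_compose B' PSL in blast)
  have key: "p z \<in> c" if "z \<in> hplane" "\<gamma> \<in> \<Gamma>" "Re (B' (\<gamma> z)) = 0" for z \<gamma>
  proof -
    define y where "y = B' (\<gamma> z)"
    have y: "y \<in> hplane" "B y = \<gamma> z" using PSL2R_hplane[OF B'(1)] B'(3) H that by (auto simp: y_def)
    have "p z = (p \<circ> B) y" using y p\<gamma> that by simp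
    moreover have "y \<in> {z \<in> hplane. Re z = 0}" using y that(3) by (simp add: y_def)
    ultimately show ?thesis unfolding c by (rule image_eqI)
  qed
  have key2: "p z \<in> F1" if "z \<in> hplane" "\<gamma> \<in> \<Gamma>" "Re (B' (\<gamma> z)) > 0" for z \<gamma>
  proof -
    define y where "y = B' (\<gamma> z)"
    have y: "y \<in> hplane" "B y = \<gamma> z" using PSL2R_hplane[OF B'(1)] B'(3) H that by (auto simp: y_def)
    have "p z = (p \<circ> B) y" using y p\<gamma> that by simp
    moreover have "y \<in> {z \<in> hplane. Re z > 0}" using y that(3) by (simp add: y_def)
    ultimately show ?thesis unfolding F1 by (rule image_eqI)
  qed
  have A\<Omega>: "A \<subseteq> \<Omega>" using in_components_subset[OF A(1)] by (simp add: \<Omega>_def)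
  then have AH: "A \<subseteq> hplane" by (auto simp: \<Omega>_def)
  have connA: "connected A" using in_components_connected[OF A(1)] .
  \<comment> \<open>A point of the right half-collar, with angle midway between l and pi / 2. It
    lies outside the funnel and off c, so it decides all signs below.\<close>
  define x where "x = of_real 1 * cis ((l + pi / 2) / 2)"
  have x: "x \<in> right_collar_cover l"
    unfolding right_collar_cover_def x_def
    by (intro CollectI exI[of _ "1::real"] exI[of _ "(l + pi / 2) / 2"]) (use l in auto)
  then have xA: "x \<in> A" using A(2) by blast
  have xH: "x \<in> hplane" using xA AH by blast
  have Rex: "Re x > 0" using l by (auto simp: x_def intro!: cos_gt_zero)
  have xneg: "Re (B' (\<gamma> x)) < 0" if "\<gamma> \<in> \<Gamma>" for \<gamma>
  proof (rule ccontr)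
    assume "\<not> Re (B' (\<gamma> x)) < 0"
    then consider "Re (B' (\<gamma> x)) = 0" | "Re (B' (\<gamma> x)) > 0" by linarith
    then show False
    proof cases
      case 1
      then show ?thesis using key[OF xH that] xA A\<Omega> by (auto simp: \<Omega>_def)
    next
      case 2
      then show ?thesis using key2[OF xH that] x right by auto
    qed
  qed
  \<comment> \<open>Connectedness of \<open>D\<close> and maximality of the component, as x lies in
    both.\<close>
  have "D \<subseteq> A"
  proof (rule components_maximal[OF A(1) \<open>connected D\<close>])
    show "D \<subseteq> {z \<in> hplane. p z \<notin> c}"
    proof
      fix z assume z: "z \<in> D"
      then have zH: "z \<in> hplane" by (simp add: D_def)
      have "p z \<notin> c"
      proof
        assume "p z \<in> c"
        then obtain y where y: "y \<in> hplane" "Re y = 0" "p z = p (B y)" unfolding c by auto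
        then obtain \<gamma> where \<gamma>: "\<gamma> \<in> \<Gamma>" "B y = \<gamma> z" using fib[OF zH PSL2R_hplane[OF B y(1)]] by auto
        have "Re (B' (\<gamma> z)) < 0" using z \<gamma>(1) by (simp add: D_iff)
        then show False using B'(2)[OF y(1)] y(2) \<gamma>(2) by simp
      qed
      then show "z \<in> {z \<in> hplane. p z \<notin> c}" using zH by simp
    qed
    have "x \<in> D" using xH xneg by (simp add: D_iff)
    then show "A \<inter> D \<noteq> {}" using xA by blast
  qed
  \<comment> \<open>No function Re (B' (\<gamma> z)) vanishes on the connected set \<open>A\<close>,
    since its zeros lie over c; each keeps the sign it has at x.\<close>
  moreover have "A \<subseteq> D"
  proof
    fix z assume z: "z \<in> A"
    have "Re (B' (\<gamma> z)) < 0" if \<gamma>: "\<gamma> \<in> \<Gamma>" for \<gamma>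
    proof (rule connected_avoiding_zero[OF connA _ _ xA _ z])
      have "continuous_on hplane \<gamma>" by (rule PSL2R_continuous_on[OF subsetD[OF PSL \<gamma>]])
      then have 1: "continuous_on A \<gamma>" using AH by (rule continuous_on_subset)
      have "continuous_on A (\<lambda>z. B' (\<gamma> z))"
        by (rule continuous_on_compose2[OF PSL2R_continuous_on[OF B'(1)] 1]) (use AH H \<gamma> in auto)
      then show "continuous_on A (\<lambda>z. Re (B' (\<gamma> z)))" by (rule continuous_on_Re)
      show "Re (B' (\<gamma> z)) \<noteq> 0" if "z \<in> A" for z
        using key[OF _ \<gamma>, of z] that A\<Omega> by (auto simp: \<Omega>_def)
      show "Re (B' (\<gamma> x)) < 0" by (rule xneg[OF \<gamma>])
    qed
    then show "z \<in> D" using z AH by (auto simp: D_iff)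
  qed
  ultimately have AD: "A = D" by blast
  show "\<gamma> z \<in> A" if "\<gamma> \<in> \<Gamma>" "z \<in> A" for \<gamma> z
  proof -
    have z: "z \<in> hplane" "\<And>\<gamma>. \<gamma> \<in> \<Gamma> \<Longrightarrow> Re (B' (\<gamma> z)) < 0" using that(2) by (auto simp: AD D_iff)
    have "Re (B' (\<gamma>' (\<gamma> z))) < 0" if "\<gamma>' \<in> \<Gamma>" for \<gamma>'
      using z(2)[OF comp[OF \<open>\<gamma> \<in> \<Gamma>\<close> that]] z(1) by (simp add: compose_eq)
    then show ?thesis using H[OF that(1) z(1)] by (simp add: AD D_iff)
  qed
  show "Re z > 0 \<and> Im z > 0" if z: "z \<in> A" for z
  proof -
    have "- Re z < 0"
    proof (rule connected_avoiding_zero[OF connA _ _ xA _ z])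
      show "continuous_on A (\<lambda>z. - Re z)" by (intro continuous_intros)
      show "- Re y \<noteq> 0" if "y \<in> A" for y
        using that A\<Omega> axis by (auto simp: \<Omega>_def axis_is_lift_def)
    qed (use Rex in simp)
    then show ?thesis using z AH by (auto simp: hplane_Im)
  qed
qed

section \<open>The isomorphism of groups induced by the lifts\<close>

text \<open>\<open>F\<close> after \<gamma> and B after \<open>F\<close> lift the same map through
  \<open>p0\<close>, so they agree on \<open>A\<close> once B is chosen to match at one point.
  Injectivity of \<phi> comes from freeness, surjectivity from the injectivity of f on the image of
  \<open>A\<close>.\<close>

lemma lifted_isomorphism:
  fixes p :: "complex \<Rightarrow> 'm::t2_space" and p0 :: "complex \<Rightarrow> 'm"
  assumes G1: "discrete_group \<Gamma>1" and G2: "discrete_group \<Gamma>"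
    and cov: "covering_space hplane p0 S0"
    and fib0: "\<And>z w. z \<in> hplane \<Longrightarrow> w \<in> hplane \<Longrightarrow> p0 z = p0 w \<longleftrightarrow> (\<exists>\<gamma>\<in>\<Gamma>. w = \<gamma> z)"
    and fib: "\<And>z w. z \<in> hplane \<Longrightarrow> w \<in> hplane \<Longrightarrow> p z = p w \<longleftrightarrow> (\<exists>\<gamma>\<in>\<Gamma>1. w = \<gamma> z)"
    and homeo: "homeomorphism A hplane F Finv" and A: "A \<subseteq> hplane" "connected A"
    and inv: "\<And>\<gamma> z. \<gamma> \<in> \<Gamma>1 \<Longrightarrow> z \<in> A \<Longrightarrow> \<gamma> z \<in> A"
    and comm: "\<And>z. z \<in> A \<Longrightarrow> p0 (F z) = f (p z)" and inj: "inj_on f (p ` A)"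
  obtains \<phi> where "bij_betw \<phi> \<Gamma>1 \<Gamma>" "\<And>\<gamma> z. \<gamma> \<in> \<Gamma>1 \<Longrightarrow> z \<in> A \<Longrightarrow> F (\<gamma> z) = \<phi> \<gamma> (F z)"
proof -
  interpret G1: discrete_group \<Gamma>1 by (rule G1)
  interpret G2: discrete_group \<Gamma> by (rule G2)
  have FH: "F z \<in> hplane" if "z \<in> A" for z using homeomorphism_image1[OF homeo] that by blast
  have FiA: "Finv w \<in> A" if "w \<in> hplane" for w using homeomorphism_image2[OF homeo] that by blast
  have contF: "continuous_on A F" by (rule homeomorphism_cont1[OF homeo])
  have contp0: "continuous_on hplane p0" and p0S: "p0 ` hplane = S0" using cov by (auto simp: covering_space_def)
  define b where "b = Finv \<i>"
  have b: "b \<in> A" unfolding b_def by (rule FiA) simp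
  have pinv: "p (\<gamma> z) = p z" if "\<gamma> \<in> \<Gamma>1" "z \<in> A" for \<gamma> z
  proof -
    have z: "z \<in> hplane" using that A(1) by blast
    show ?thesis using fib[OF z G1.hplane_closed[OF that(1) z]] that(1) by metis
  qed
  have p0inv: "p0 (B w) = p0 w" if "B \<in> \<Gamma>" "w \<in> hplane" for B w
    using fib0[OF that(2) G2.hplane_closed[OF that]] that by auto
  have "\<exists>B\<in>\<Gamma>. \<forall>z\<in>A. F (\<gamma> z) = B (F z)" if \<gamma>: "\<gamma> \<in> \<Gamma>1" for \<gamma>
  proof -
    have "p0 (F b) = p0 (F (\<gamma> b))" using comm b inv[OF \<gamma>] pinv[OF \<gamma>] by simp
    then obtain B where B: "B \<in> \<Gamma>" "F (\<gamma> b) = B (F b)"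
      using fib0[OF FH[OF b] FH[OF inv[OF \<gamma> b]]] by blast
    have "F (\<gamma> z) = B (F z)" if z: "z \<in> A" for z
    proof (rule covering_space_lift_unique[OF cov, where ?g1.0 = "\<lambda>z. F (\<gamma> z)" and ?g2.0 = "\<lambda>z. B (F z)" and a = b and f = "\<lambda>z. p0 (F z)" and T = A])
      show "F (\<gamma> b) = B (F b)" by (rule B(2))
      show "continuous_on A (\<lambda>z. p0 (F z))"
        by (rule continuous_on_compose2[OF contp0 contF]) (use FH in auto)
      show "(\<lambda>z. p0 (F z)) \<in> A \<rightarrow> S0" using FH p0S by auto
      have "continuous_on A \<gamma>"
        by (rule continuous_on_subset[OF PSL2R_continuous_on[OF subsetD[OF G1.PSL \<gamma>]] A(1)])
      then show "continuous_on A (\<lambda>z. F (\<gamma> z))"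
        by (rule continuous_on_compose2[OF contF]) (use inv[OF \<gamma>] in auto)
      show "continuous_on A (\<lambda>z. B (F z))"
        by (rule continuous_on_compose2[OF PSL2R_continuous_on[OF subsetD[OF G2.PSL B(1)]] contF]) (use FH in auto)
      show "(\<lambda>z. F (\<gamma> z)) \<in> A \<rightarrow> hplane" using FH inv[OF \<gamma>] by auto
      show "(\<lambda>z. B (F z)) \<in> A \<rightarrow> hplane" using FH G2.hplane_closed[OF B(1)] by auto
      show "p0 (F x) = p0 (F (\<gamma> x))" if "x \<in> A" for x using comm that inv[OF \<gamma>] pinv[OF \<gamma>] by simp
      show "p0 (F x) = p0 (B (F x))" if "x \<in> A" for x using p0inv[OF B(1) FH[OF that]] by simp
      show "connected A" by (rule A(2))
    qed (use b z in auto)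
    then show ?thesis using B(1) by blast
  qed
  then obtain \<phi> where \<phi>: "\<And>\<gamma>. \<gamma> \<in> \<Gamma>1 \<Longrightarrow> \<phi> \<gamma> \<in> \<Gamma>" "\<And>\<gamma> z. \<gamma> \<in> \<Gamma>1 \<Longrightarrow> z \<in> A \<Longrightarrow> F (\<gamma> z) = \<phi> \<gamma> (F z)"
    by metis
  have "inj_on \<phi> \<Gamma>1"
  proof (rule inj_onI)
    fix \<gamma> \<gamma>' assume g: "\<gamma> \<in> \<Gamma>1" "\<gamma>' \<in> \<Gamma>1" "\<phi> \<gamma> = \<phi> \<gamma>'"
    have "F (\<gamma> b) = F (\<gamma>' b)" using \<phi>(2) g b by simp
    then have "\<gamma> b = \<gamma>' b" using homeomorphism_apply1[OF homeo] inv g b by metis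
    then show "\<gamma> = \<gamma>'" using G1.eq_if_eq_at[OF g(1,2)] b A(1) by blast
  qed
  moreover have "\<phi> ` \<Gamma>1 = \<Gamma>"
  proof (intro equalityI subsetI)
    fix B assume B: "B \<in> \<Gamma>"
    define z where "z = Finv (B (F b))"
    have BF: "B (F b) \<in> hplane" by (rule G2.hplane_closed[OF B FH[OF b]])
    have z: "z \<in> A" "F z = B (F b)" using FiA[OF BF] homeomorphism_apply2[OF homeo BF] by (auto simp: z_def)
    have "f (p z) = f (p b)" using comm[OF z(1)] comm[OF b] z(2) p0inv[OF B FH[OF b]] by simp
    then have "p b = p z" using inj z(1) b by (auto dest: inj_onD)
    then obtain \<gamma> where \<gamma>: "\<gamma> \<in> \<Gamma>1" "z = \<gamma> b" using fib[of b z] b z A(1) by blast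
    have "\<phi> \<gamma> (F b) = B (F b)" using \<phi>(2)[OF \<gamma>(1) b] \<gamma>(2) z(2) by simp
    then have "\<phi> \<gamma> = B" by (rule G2.eq_if_eq_at[OF \<phi>(1)[OF \<gamma>(1)] B FH[OF b]])
    then show "B \<in> \<phi> ` \<Gamma>1" using \<gamma>(1) by blast
  qed (use \<phi>(1) in auto)
  ultimately have "bij_betw \<phi> \<Gamma>1 \<Gamma>" by (rule bij_betw_imageI)
  then show ?thesis using that \<phi>(2) by blast
qed

section \<open>Compactness of the fundamental domain over compact sets\<close>

text \<open>Invariance of domain, applied in a chart to the locally injective map of
  \<open>local_isometry_chart\<close>.\<close>

lemma local_isometry_open_map:
  assumes atl: "oriented_surface atl" and iso: "local_isometry atl W hyp_metric S g h" and W: "W \<subseteq> hplane"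
    and O: "open U" "U \<subseteq> W"
  shows "open (h ` U)"
proof (subst open_subopen, intro ballI)
  fix y assume "y \<in> h ` U"
  then obtain q where q: "q \<in> U" "y = h q" by auto
  have "h q \<in> (\<Union>\<kappa>\<in>atl. fst \<kappa>)" using atl by (simp add: oriented_surface_def)
  then obtain \<kappa> where \<kappa>: "\<kappa> \<in> atl" "h q \<in> fst \<kappa>" by blast
  have op: "open (fst \<kappa>)" and hom: "homeomorphism (fst \<kappa>) (snd \<kappa> ` fst \<kappa>) (snd \<kappa>) (chart_inv \<kappa>)"
    using atl \<kappa>(1) unfolding oriented_surface_def by blast+
  obtain r where r: "r > 0" "ball q r \<subseteq> W \<inter> h -` fst \<kappa>" "inj_on (snd \<kappa> \<circ> h) (ball q r)"
    "continuous_on (ball q r) (snd \<kappa> \<circ> h)"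
    by (rule local_isometry_chart[OF iso W \<kappa>(1) op subsetD[OF O(2) q(1)] \<kappa>(2)]) (rule that; assumption)
  define N where "N = (snd \<kappa> \<circ> h) ` (ball q r \<inter> U)"
  have "open N" unfolding N_def
    using r O(1) by (intro invariance_of_domain) (auto intro: continuous_on_subset inj_on_subset)
  then have "open (fst \<kappa> \<inter> snd \<kappa> -` N)"
    by (rule continuous_open_preimage[OF homeomorphism_cont1[OF hom] op])
  moreover have "y \<in> fst \<kappa> \<inter> snd \<kappa> -` N" using q r(1) \<kappa>(2) by (auto simp: N_def)
  moreover have "fst \<kappa> \<inter> snd \<kappa> -` N \<subseteq> h ` U"
  proof
    fix x assume x: "x \<in> fst \<kappa> \<inter> snd \<kappa> -` N"
    then obtain q' where q': "q' \<in> ball q r" "q' \<in> U" "snd \<kappa> x = snd \<kappa> (h q')" by (auto simp: N_def)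
    then have "h q' \<in> fst \<kappa>" using r(2) by auto
    then have "x = h q'" using q'(3) x homeomorphism_apply1[OF hom] by (metis IntD1)
    then show "x \<in> h ` U" using q'(2) by blast
  qed
  ultimately show "\<exists>T. open T \<and> y \<in> T \<and> T \<subseteq> h ` U" by blast
qed

text \<open>The images of the open balls of integral radius are open and exhaust the image of h, so
  finitely many of them cover K.\<close>

lemma compact_covered_by_hball:
  assumes atl: "oriented_surface atl" and iso: "local_isometry atl hplane hyp_metric S g h"
    and K: "compact K" "K \<subseteq> h ` hplane"
  obtains R where "K \<subseteq> h ` hball R"
proof -
  define U where "U = (\<lambda>n::nat. {w \<in> hplane. hdist \<i> w < real n})"
  have op: "open (h ` U n)" for n
    by (rule local_isometry_open_map[OF atl iso subset_refl]) (auto simp: U_def open_hdist_ball)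
  have cover: "K \<subseteq> (\<Union>n\<in>UNIV. h ` U n)"
  proof
    fix x assume "x \<in> K"
    then obtain w where w: "w \<in> hplane" "x = h w" using K(2) by auto
    obtain n where "hdist \<i> w < real n" using reals_Archimedean2 by blast
    then show "x \<in> (\<Union>n\<in>UNIV. h ` U n)" using w by (auto simp: U_def)
  qed
  have "\<exists>C. C \<subseteq> UNIV \<and> finite C \<and> K \<subseteq> (\<Union>n\<in>C. h ` U n)"
    by (rule compactE_image[OF K(1) op cover]) (rule exI, intro conjI)
  then obtain C where C: "finite C" "K \<subseteq> (\<Union>n\<in>C. h ` U n)" by (elim exE conjE)
  have "K \<subseteq> h ` hball (real (Max (insert 0 C)))"
  proof
    fix x assume "x \<in> K"
    then obtain n w where w: "n \<in> C" "w \<in> U n" "x = h w" using C(2) by auto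
    have "n \<le> Max (insert 0 C)" using C(1) w(1) by (intro Max_ge) auto
    then have "w \<in> hball (real (Max (insert 0 C)))" using w(2) by (auto simp: U_def hball_def)
    then show "x \<in> h ` hball (real (Max (insert 0 C)))" using w(3) by blast
  qed
  then show ?thesis by (rule that)
qed

text \<open>The height of a point of the fundamental domain is the largest one in its orbit; it is bounded
  because the translation \<open>w \<mapsto> w + 1\<close> moves high points by a small amount.\<close>

lemma (in discrete_group) fundamental_domain_compact:
  assumes trans: "translation \<in> \<Gamma>"
    and fib: "\<And>z w. z \<in> hplane \<Longrightarrow> w \<in> hplane \<Longrightarrow> p z = p w \<longleftrightarrow> (\<exists>\<gamma>\<in>\<Gamma>. w = \<gamma> z)"
    and K: "K \<subseteq> p ` hball R"
  obtains R' where "{w \<in> standard_fundamental_domain \<Gamma>. p w \<in> K} \<subseteq> hball R'"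
proof (cases "hball R = {}")
  case True
  then show ?thesis using K that[of 0] by auto
next
  case False
  have "\<exists>x\<in>hball R. \<forall>y\<in>hball R. Im x \<le> Im y"
    by (rule continuous_attains_inf[OF compact_hball False]) (intro continuous_intros)
  then obtain x where x: "x \<in> hball R" "\<And>y. y \<in> hball R \<Longrightarrow> Im x \<le> Im y" by blast
  have x0: "Im x > 0" using x(1) by (simp add: hball_def hplane_Im)
  obtain r where r: "r > 0" "\<And>w A. w \<in> hball R \<Longrightarrow> A \<in> \<Gamma> \<Longrightarrow> A \<noteq> (\<lambda>z\<in>hplane. z) \<Longrightarrow> r \<le> hdist w (A w)"
    by (rule separated[of R]) (rule that; assumption)
  define q where "q = cosh r - 1"
  have q: "q > 0" using r(1) cosh_real_nonneg_less_iff[of 0 r] by (simp add: q_def)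
  \<comment> \<open>Since \<open>chd w (w + 1)\<close> is 1 + 1 / (2 (Im w)^2), a displacement of at
    least r under the translation forces Im w \<le> M.\<close>
  define M where "M = sqrt (1 / (2 * q))"
  have box: "w \<in> cbox (Complex 0 (Im x)) (Complex 1 M)" if w: "w \<in> standard_fundamental_domain \<Gamma>" "p w \<in> K" for w
  proof -
    have wH: "w \<in> hplane" and Re: "0 \<le> Re w" "Re w < 1" and max: "\<And>A. A \<in> \<Gamma> \<Longrightarrow> Im (A w) \<le> Im w"
      using w(1) by (auto simp: standard_fundamental_domain_def)
    obtain w1 where w1: "w1 \<in> hball R" "p w = p w1" using w(2) K by auto
    have w1H: "w1 \<in> hplane" using w1(1) by (simp add: hball_def)
    obtain A where A: "A \<in> \<Gamma>" "w1 = A w" using fib[OF wH w1H] w1(2) by auto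
    \<comment> \<open>The point w is highest in its orbit, and the orbit meets the ball, where
      heights are at least Im x.\<close>
    have low: "Im x \<le> Im w" using x(2)[OF w1(1)] max[OF A(1)] A(2) by simp
    obtain B where B: "B \<in> \<Gamma>" "\<And>z. z \<in> hplane \<Longrightarrow> B (A z) = z" "\<And>z. z \<in> hplane \<Longrightarrow> A (B z) = z"
      by (rule inverse_exists[OF A(1)]) (rule that; assumption)
    have Bw1: "B w1 = w" using B(2)[OF wH] A(2) by simp
    \<comment> \<open>The conjugate of the translation that moves w1 as far as the translation moves
      w. As w1 lies in the ball, \<open>separated\<close> bounds this displacement from
      below.\<close>
    define C where "C = compose hplane A (compose hplane translation B)"
    have C: "C \<in> \<Gamma>" unfolding C_def by (intro compose_closed A(1) B(1) trans)
    have w'H: "w + 1 \<in> hplane" using wH by (simp add: hplane_Im)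
    have Cw1: "C w1 = A (w + 1)" using w1H wH Bw1 by (simp add: C_def compose_eq translation_def)
    have "C \<noteq> (\<lambda>z\<in>hplane. z)"
    proof
      assume "C = (\<lambda>z\<in>hplane. z)"
      then have "A (w + 1) = A w" using Cw1 w1H A(2) by simp
      then have "w + 1 = w" using B(2) wH w'H by metis
      then show False by simp
    qed
    then have "r \<le> hdist w1 (C w1)" by (rule r(2)[OF w1(1) C])
    also have "\<dots> = hdist (A w) (A (w + 1))" by (simp only: Cw1, simp only: A(2))
    also have "\<dots> = hdist w (w + 1)" by (rule isometry[OF A(1) wH w'H])
    finally have "cosh r \<le> chd w (w + 1)"
      using cosh_hdist[OF wH w'H] hdist_nonneg[OF wH w'H] r(1) cosh_real_nonneg_le_iff[of r] by (metis less_imp_le)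
    then have "q \<le> 1 / (2 * (Im w)\<^sup>2)" by (simp add: chd_def q_def power2_eq_square)
    then have "(Im w)\<^sup>2 \<le> 1 / (2 * q)" using q wH by (simp add: hplane_Im field_simps)
    then have "Im w \<le> M" unfolding M_def by (rule real_le_rsqrt)
    then show ?thesis using low Re by (simp add: in_cbox_complex_iff)
  qed
  have "cbox (Complex 0 (Im x)) (Complex 1 M) \<subseteq> hplane"
    using x0 by (auto simp: in_cbox_complex_iff hplane_Im)
  then obtain R' where "cbox (Complex 0 (Im x)) (Complex 1 M) \<subseteq> hball R'"
    by (rule compact_subset_hball[OF compact_cbox]) (rule that; assumption)
  then show ?thesis using that[of R'] box by blast
qed

theorem theorem5p1:
  fixes atl :: "('m::{t2_space, second_countable_topology}) surface_chart set"
    and l0 :: real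
    and J :: "real set" and \<psi> :: "complex \<Rightarrow> 'm" and c :: "'m set"
    and g :: "real \<Rightarrow> 'm metric_field" and g0 :: "'m metric_field"
    and \<Gamma>l :: "real \<Rightarrow> (complex \<Rightarrow> complex) set" and p :: "real \<Rightarrow> complex \<Rightarrow> 'm"
    and F1 :: "real \<Rightarrow> 'm set"
    and f \<pi>l :: "real \<Rightarrow> 'm \<Rightarrow> 'm"
    and \<Gamma> :: "(complex \<Rightarrow> complex) set" and p0 :: "complex \<Rightarrow> 'm" and S0 :: "'m set"
    and \<A> :: "real \<Rightarrow> complex set" and F Finv :: "real \<Rightarrow> complex \<Rightarrow> complex"
    and s :: complex
  assumes l0: "0 < l0" "l0 \<le> pi / 2"
    and family: "degenerating_family atl l0 1 (\<lambda>_ l. l) (\<lambda>_. J) (\<lambda>_. \<psi>) g g0"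
    and c: "c = pinched_curve \<psi>"
    \<comment> \<open>\<open>S\<^sub>l\<close> is the quotient of \<open>H\<close> by \<open>\<Gamma>l l\<close>, and \<open>\<sigma>\<^sub>l\<close> corresponds to \<open>c\<close>\<close>
    and S_l: "\<And>l. l \<in> {0<..<l0} \<Longrightarrow> uniformization atl UNIV (g l) (\<Gamma>l l) (p l)"
    and geom_finite: "\<And>l. l \<in> {0<..<l0} \<Longrightarrow> geometrically_finite (\<Gamma>l l)"
    and sigma: "\<And>l. l \<in> {0<..<l0} \<Longrightarrow> dilation l \<in> \<Gamma>l l \<and> axis_is_lift (p l) l c"
    \<comment> \<open>the only funnel, on the left of \<open>c\<close>\<close>
    and funnel: "\<And>l. l \<in> {0<..<l0} \<Longrightarrow> funnel (p l) (F1 l) c"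
    and only_funnel: "\<And>l F' c'. l \<in> {0<..<l0} \<Longrightarrow> funnel (p l) F' c' \<Longrightarrow> F' = F1 l"
    and right_side: "\<And>l. l \<in> {0<..<l0} \<Longrightarrow> p l ` right_collar_cover l \<subseteq> - F1 l"
    \<comment> \<open>the component \<open>S\<^sub>0\<close> of the limit surface and its cusp at infinity\<close>
    and S0_component: "S0 \<in> components (- c)"
    and S0: "uniformization atl S0 g0 \<Gamma> p0"
    and cusp: "stabilizer_infinity \<Gamma> = group_generated_by translation"
    \<comment> \<open>the homeomorphisms \<open>f\<^sub>l\<close> and \<open>\<pi>\<^sub>l\<close>\<close>
    and f: "\<And>l. l \<in> {0<..<l0} \<Longrightarrow> homeomorphism (- c) (- c) (f l) (\<pi>l l)"
    and f_K: "tends_to_isometries_C2 atl (- c) g g0 f (\<lambda>l. - (p l ` collar_cover l))"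
    and f_compact: "\<And>K. compact K \<Longrightarrow> K \<subseteq> - c \<Longrightarrow>
          tends_to_isometries_C2 atl (- c) g g0 f (\<lambda>l. \<pi>l l ` K)"
    \<comment> \<open>the lifts \<open>F\<^sub>l\<close> on \<open>\<A>\<^sub>l\<close> and their normalization\<close>
    and A_l: "\<And>l. l \<in> {0<..<l0} \<Longrightarrow>
          \<A> l \<in> components {z \<in> hplane. p l z \<notin> c} \<and> right_collar_cover l \<subseteq> \<A> l"
    and F_l: "\<And>l. l \<in> {0<..<l0} \<Longrightarrow> homeomorphism (\<A> l) hplane (F l) (Finv l) \<and>
          (\<forall>z \<in> \<A> l. p0 (F l z) = f l (p l z))"
    and F_translation: "\<And>l z. l \<in> {0<..<l0} \<Longrightarrow> z \<in> \<A> l \<Longrightarrow> F l (dilation l z) = F l z + 1"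
    and F_i: "\<And>l. l \<in> {0<..<l0} \<Longrightarrow> w_coord_inv l \<i> \<in> \<A> l \<and> F l (w_coord_inv l \<i>) = \<i>"
    and s: "Re s > 1"
  shows "\<forall>K. compact K \<and> K \<subseteq> S0 \<longrightarrow> (\<forall>v \<in> {1, \<i>}.
     uniform_limit {w \<in> standard_fundamental_domain \<Gamma>. p0 w \<in> K}
       (\<lambda>l w. 1 / complex_of_real l powr s *
          pull_back (w_coord_inv l) (alpha_form (\<Gamma>l l) l s) (w_coord l (Finv l w)) v)
       (\<lambda>w. Im_horocyclic_eisenstein \<Gamma> s w v)
       (at_right 0))"
proof (intro allI impI ballI)
  fix K v assume K: "compact K \<and> K \<subseteq> S0" and v: "v \<in> {1, \<i>}"
  have atl: "oriented_surface atl" using family by (simp add: degenerating_family_def)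
  have "complete_hyperbolic_metric atl (- (\<Union>i<1::nat. pinched_curve ((\<lambda>_. \<psi>) i))) g0"
    using family unfolding degenerating_family_def by blast
  then have openc: "open (- c)"
    by (simp add: complete_hyperbolic_metric_def riemannian_metric_def c lessThan_Suc)
  have S0c: "S0 \<subseteq> - c" by (rule in_components_subset[OF S0_component])
  have PSL: "\<Gamma>l l \<subseteq> PSL2R" and sub: "subgroup (\<Gamma>l l) (BijGroup hplane)"
    and fib: "\<And>z w. z \<in> hplane \<Longrightarrow> w \<in> hplane \<Longrightarrow> p l z = p l w \<longleftrightarrow> (\<exists>\<gamma>\<in>\<Gamma>l l. w = \<gamma> z)"
    and iso: "local_isometry atl hplane hyp_metric UNIV (g l) (p l)"
    and contp: "continuous_on hplane (p l)"
    if "l \<in> {0<..<l0}" for l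
    using S_l[OF that] by (auto simp: uniformization_def covering_space_def)
  have cov0: "covering_space hplane p0 S0"
    and fib0: "\<And>z w. z \<in> hplane \<Longrightarrow> w \<in> hplane \<Longrightarrow> p0 z = p0 w \<longleftrightarrow> (\<exists>\<gamma>\<in>\<Gamma>. w = \<gamma> z)"
    and iso0: "local_isometry atl hplane hyp_metric S0 g0 p0"
    using S0 by (auto simp: uniformization_def)
  have contp0: "continuous_on hplane p0" and p0S: "p0 ` hplane = S0"
    using cov0 by (auto simp: covering_space_def)
  have small: "0 < l \<and> l < pi / 2" if "l \<in> {0<..<l0}" for l using that l0 by auto
  interpret lim: discrete_group \<Gamma> by (rule uniformization_discrete_group[OF atl S0])
  have G: "discrete_group (\<Gamma>l l)" if "l \<in> {0<..<l0}" for l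
    by (rule uniformization_discrete_group[OF atl S_l[OF that]])
  have A_quadrant: "Re z > 0 \<and> Im z > 0" if "l \<in> {0<..<l0}" "z \<in> \<A> l" for l z
    using component_right_of_funnel(1)[OF PSL sub fib funnel right_side sigma[THEN conjunct2] A_l[THEN conjunct1] A_l[THEN conjunct2]]
      that small by blast
  have A_inv: "\<gamma> z \<in> \<A> l" if "l \<in> {0<..<l0}" "\<gamma> \<in> \<Gamma>l l" "z \<in> \<A> l" for l \<gamma> z
    using component_right_of_funnel(2)[OF PSL sub fib funnel right_side sigma[THEN conjunct2] A_l[THEN conjunct1] A_l[THEN conjunct2]]
      that small by blast
  have A_hplane: "\<A> l \<subseteq> hplane" if "l \<in> {0<..<l0}" for l
    using A_quadrant[OF that] by (auto simp: hplane_Im)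
  have A_conn: "connected (\<A> l)" if "l \<in> {0<..<l0}" for l
    using A_l[OF that] in_components_connected by blast
  have A_open: "open (\<A> l)" if "l \<in> {0<..<l0}" for l
  proof -
    have "open (hplane \<inter> p l -` (- c))"
      by (rule continuous_open_preimage[OF contp[OF that] open_hplane openc])
    also have "hplane \<inter> p l -` (- c) = {z \<in> hplane. p l z \<notin> c}" by auto
    finally show ?thesis using A_l[OF that] open_components by blast
  qed
  have A_c: "p l z \<in> - c" if "l \<in> {0<..<l0}" "z \<in> \<A> l" for l z
    using in_components_subset[OF conjunct1[OF A_l[OF that(1)]]] that(2) by auto
  have homeo: "homeomorphism (\<A> l) hplane (F l) (Finv l)" and comm: "\<And>z. z \<in> \<A> l \<Longrightarrow> p0 (F l z) = f l (p l z)"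
    if "l \<in> {0<..<l0}" for l using F_l[OF that] by auto
  have f_inverse: "\<pi>l l (f l x) = x" if "l \<in> {0<..<l0}" "x \<in> - c" for l x
    by (rule homeomorphism_apply1[OF f[OF that(1)] that(2)])
  have "\<exists>\<phi>. bij_betw \<phi> (\<Gamma>l l) \<Gamma> \<and> (\<forall>\<gamma>\<in>\<Gamma>l l. \<forall>z\<in>\<A> l. F l (\<gamma> z) = \<phi> \<gamma> (F l z))"
    if l: "l \<in> {0<..<l0}" for l
  proof -
    have "inj_on (f l) (p l ` \<A> l)"
      by (rule inj_on_inverseI[where g = "\<pi>l l"]) (use f_inverse[OF l] A_c[OF l] in blast)
    note inj = this
    show ?thesis
    proof (rule lifted_isomorphism[where p = "p l" and ?p0.0 = p0 and f = "f l" and A = "\<A> l" and F = "F l"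
          and Finv = "Finv l" and ?\<Gamma>1.0 = "\<Gamma>l l" and \<Gamma> = \<Gamma> and ?S0.0 = S0])
      show "discrete_group (\<Gamma>l l)" by (rule G[OF l])
      show "discrete_group \<Gamma>" by (rule lim.discrete_group_axioms)
      show "covering_space hplane p0 S0" by (rule cov0)
      show "p0 z = p0 w \<longleftrightarrow> (\<exists>\<gamma>\<in>\<Gamma>. w = \<gamma> z)" if "z \<in> hplane" "w \<in> hplane" for z w by (rule fib0[OF that])
      show "p l z = p l w \<longleftrightarrow> (\<exists>\<gamma>\<in>\<Gamma>l l. w = \<gamma> z)" if "z \<in> hplane" "w \<in> hplane" for z w by (rule fib[OF l that])
      show "homeomorphism (\<A> l) hplane (F l) (Finv l)" by (rule homeo[OF l])
      show "\<A> l \<subseteq> hplane" "connected (\<A> l)" by (rule A_hplane[OF l], rule A_conn[OF l])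
      show "\<gamma> z \<in> \<A> l" if "\<gamma> \<in> \<Gamma>l l" "z \<in> \<A> l" for \<gamma> z by (rule A_inv[OF l that])
      show "p0 (F l z) = f l (p l z)" if "z \<in> \<A> l" for z by (rule comm[OF l that])
      show "inj_on (f l) (p l ` \<A> l)" by (rule inj)
    qed blast
  qed
  then obtain \<phi> where \<phi>: "\<And>l. l \<in> {0<..<l0} \<Longrightarrow> bij_betw (\<phi> l) (\<Gamma>l l) \<Gamma>"
    "\<And>l \<gamma> z. l \<in> {0<..<l0} \<Longrightarrow> \<gamma> \<in> \<Gamma>l l \<Longrightarrow> z \<in> \<A> l \<Longrightarrow> F l (\<gamma> z) = \<phi> l \<gamma> (F l z)"
    by metis
  have near: "\<forall>\<^sub>F l in at_right 0. \<forall>w \<in> hball R. \<exists>D.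
          (F l has_derivative D) (at (Finv l w)) \<and>
          (\<forall>u. (1 - \<epsilon>) * (cmod u / Im (Finv l w)) \<le> cmod (D u) / Im w \<and>
               cmod (D u) / Im w \<le> (1 + \<epsilon>) * (cmod u / Im (Finv l w)))" if \<epsilon>: "\<epsilon> > 0" for \<epsilon> R
  proof -
    \<comment> \<open>For w in the ball, \<open>Finv l w\<close> lies over
      \<open>\<pi>l l (p0 w)\<close>. Control of f on the image under \<open>\<pi>l l\<close> of
      this compact set is therefore control of \<open>F l\<close> at the points
      \<open>Finv l w\<close>.\<close>
    have "compact (p0 ` hball R)"
      by (intro compact_continuous_image compact_hball continuous_on_subset[OF contp0 hball_subset])
    moreover have "p0 ` hball R \<subseteq> - c" using p0S hball_subset S0c by blast
    ultimately have "tends_to_isometries_C2 atl (- c) g g0 f (\<lambda>l. \<pi>l l ` p0 ` hball R)" by (rule f_compact)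
    \<comment> \<open>The passage to the lift in \<open>lift_near_isometry_derivative\<close>
      doubles the error, hence \<epsilon> / 2.\<close>
    then have "\<forall>\<^sub>F l in at_right 0. \<forall>x \<in> \<pi>l l ` p0 ` hball R. C2_near_isometry_at atl (- c) (g l) (- c) g0 (\<epsilon> / 2) (f l) x"
      unfolding tends_to_isometries_C2_def using \<epsilon> half_gt_zero by blast
    moreover have "\<forall>\<^sub>F l in at_right 0. l \<in> {0<..<l0}" using eventually_at_right_real[OF l0(1)] .
    ultimately show ?thesis
    proof eventually_elim
      case (elim l)
      note l = elim(2)
      show ?case
      proof
        fix w assume w: "w \<in> hball R"
        have wH: "w \<in> hplane" using w by (simp add: hball_def)
        define z where "z = Finv l w"
        have z: "z \<in> \<A> l" "F l z = w"
          using homeomorphism_image2[OF homeo[OF l]] homeomorphism_apply2[OF homeo[OF l] wH] wH by (auto simp: z_def)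
        have "\<pi>l l (p0 w) = p l z"
          using comm[OF l z(1)] f_inverse[OF l A_c[OF l z(1)]] z(2) by simp
        then have near: "C2_near_isometry_at atl (- c) (g l) (- c) g0 (\<epsilon> / 2) (f l) (p l z)"
          using elim(1) w by (metis imageI)
        have FH: "F l ` \<A> l \<subseteq> hplane" using homeomorphism_image1[OF homeo[OF l]] by simp
        have half: "\<epsilon> / 2 > 0" using \<epsilon> by simp
        obtain D where D: "(F l has_derivative D) (at z)"
          "\<And>u. (1 - 2 * (\<epsilon> / 2)) * (cmod u / Im z) \<le> cmod (D u) / Im (F l z)"
          "\<And>u. cmod (D u) / Im (F l z) \<le> (1 + 2 * (\<epsilon> / 2)) * (cmod u / Im z)"
          by (rule lift_near_isometry_derivative[OF atl iso[OF l] iso0 A_open[OF l] A_hplane[OF l] z(1)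
                homeomorphism_cont1[OF homeo[OF l]] FH comm[OF l] near half]) (assumption, (rule that; assumption))
        then show "\<exists>D. (F l has_derivative D) (at (Finv l w)) \<and>
          (\<forall>u. (1 - \<epsilon>) * (cmod u / Im (Finv l w)) \<le> cmod (D u) / Im w \<and>
               cmod (D u) / Im w \<le> (1 + \<epsilon>) * (cmod u / Im (Finv l w)))"
          unfolding z_def[symmetric] z(2) by (intro exI[of _ D]) simp
      qed
    qed
  qed
  have dil: "of_real (exp l) * z \<in> \<A> l \<and> of_real (exp (- l)) * z \<in> \<A> l \<and> F l (of_real (exp l) * z) = F l z + 1"
    if l: "l \<in> {0<..<l0}" and z: "z \<in> \<A> l" for l z
  proof -
    interpret Gl: discrete_group "\<Gamma>l l" by (rule G[OF l])
    have d: "dilation l \<in> \<Gamma>l l" using sigma[OF l] by simp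
    have zH: "z \<in> hplane" using z A_hplane[OF l] by blast
    have 1: "dilation l z = of_real (exp l) * z" using zH by (simp add: dilation_def)
    \<comment> \<open>The inverse of the dilation is multiplication by exp (- l); as an element of
      the group it preserves the component.\<close>
    obtain B where B: "B \<in> \<Gamma>l l" "\<And>z. z \<in> hplane \<Longrightarrow> dilation l (B z) = z"
      by (rule Gl.inverse_exists[OF d]) (rule that; assumption)
    have "of_real (exp l) * B z = z" using B(2)[OF zH] Gl.hplane_closed[OF B(1) zH] by (simp add: dilation_def)
    then have "B z = of_real (exp (- l)) * z" by (metis exp_minus_inverse mult.assoc mult.commute mult_1 of_real_1 of_real_mult)
    then show ?thesis using A_inv[OF l d z] A_inv[OF l B(1) z] F_translation[OF l z] 1 by simp
  qed
  interpret degenerating_groups l0 \<A> F Finv \<Gamma> \<Gamma>l \<phi>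
  proof (intro degenerating_groups.intro near_isometric_lifts.intro degenerating_groups_axioms.intro)
    show "discrete_group \<Gamma>" by (rule lim.discrete_group_axioms)
    show "0 < l0" "l0 \<le> pi / 2" by (rule l0)+
    show "stabilizer_infinity \<Gamma> = group_generated_by translation" by (rule cusp)
    show "\<forall>\<^sub>F l in at_right 0. \<forall>w \<in> hball R. \<exists>D.
          (F l has_derivative D) (at (Finv l w)) \<and>
          (\<forall>u. (1 - \<epsilon>) * (cmod u / Im (Finv l w)) \<le> cmod (D u) / Im w \<and>
               cmod (D u) / Im w \<le> (1 + \<epsilon>) * (cmod u / Im (Finv l w)))" if "\<epsilon> > 0" for \<epsilon> R
      by (rule near[OF that])
    fix l assume l: "l \<in> {0<..<l0}"
    show "open (\<A> l)" by (rule A_open[OF l])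
    show "Re z > 0 \<and> Im z > 0" if "z \<in> \<A> l" for z by (rule A_quadrant[OF l that])
    show "homeomorphism (\<A> l) hplane (F l) (Finv l)" by (rule homeo[OF l])
    show "exp (of_real l * \<i>) \<in> \<A> l \<and> F l (exp (of_real l * \<i>)) = \<i>"
      using F_i[OF l] by (simp add: w_coord_inv_def)
    show "of_real (exp l) * z \<in> \<A> l \<and> of_real (exp (- l)) * z \<in> \<A> l \<and> F l (of_real (exp l) * z) = F l z + 1"
      if "z \<in> \<A> l" for z by (rule dil[OF l that])
    show "discrete_group (\<Gamma>l l)" by (rule G[OF l])
    show "bij_betw (\<phi> l) (\<Gamma>l l) \<Gamma>" by (rule \<phi>(1)[OF l])
    show "\<gamma> z \<in> \<A> l \<and> F l (\<gamma> z) = \<phi> l \<gamma> (F l z)" if "\<gamma> \<in> \<Gamma>l l" "z \<in> \<A> l" for \<gamma> z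
      using A_inv[OF l that] \<phi>(2)[OF l that] by simp
    show "dilation l \<in> \<Gamma>l l" using sigma[OF l] by simp
  qed
  have trans: "translation \<in> \<Gamma>"
    using translate_in[of 1] by (simp add: translate_def translation_def)
  \<comment> \<open>The series converge uniformly on balls; what remains is that the part of the
    fundamental domain over K lies in one.\<close>
  have "K \<subseteq> p0 ` hplane" using K p0S by simp
  then obtain R where R: "K \<subseteq> p0 ` hball R"
    using compact_covered_by_hball[OF atl iso0] K by blast
  obtain R' where R': "{w \<in> standard_fundamental_domain \<Gamma>. p0 w \<in> K} \<subseteq> hball R'"
    using lim.fundamental_domain_compact[OF trans fib0 R] by blast
  have "cmod v \<le> 1" using v by auto
  from uniform_limit_on_subset[OF series_converges[OF s this] R']
  show "uniform_limit {w \<in> standard_fundamental_domain \<Gamma>. p0 w \<in> K}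
       (\<lambda>l w. 1 / complex_of_real l powr s *
          pull_back (w_coord_inv l) (alpha_form (\<Gamma>l l) l s) (w_coord l (Finv l w)) v)
       (\<lambda>w. Im_horocyclic_eisenstein \<Gamma> s w v)
       (at_right 0)" .
qed

end
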